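(* Let $p>2$ and let $\mathcal G$ be a regular single-knot metric graph of length $\ell$ with $H$ half-lines, $P$ pendants and $L$ loops. Fix $0\le P_0\le P$ and $0\le L_0\le L$ with $E_0:=P_0+2L_0>0$, and let $\mathcal G_0$ be a subgraph of $\mathcal G$ consisting of $P_0$ pendants and $L_0$ loops. There is a constant $C>0$ such that for every $\epsilon>0$ small, if $\ell$ is sufficiently large (depending on $\epsilon$), there exists a bound-state $v$ on $\mathcal G$ with: 1. $0<v(\mathbf 0)<\epsilon$; 2. the restrictions of $v$ to all compact edges in $\mathcal G_0$ coincide, and the restrictions of $v$ to all compact edges not in $\mathcal G_0$ coincide; 3. for each compact edge $e\notin\mathcal G_0$, $v_e$ is decreasing and $\|v_e\|_{L^\infty(0,\ell)}<\epsilon$; 4. for each compact edge $\kappa\in\mathcal G_0$, $\|v_\kappa-\varphi(\ell-\cdot)\|_{L^\infty(0,\ell)}\le C\epsilon$; 5. for each half-line $h$, $v_h$ is decreasing. In particular $|S(v)-\frac{E_0}{2}S(\varphi)|\le C\epsilon$.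
   Context: A single-knot metric graph consists of $H\ge1$ half-lines, $P\ge0$ pendants and $L\ge0$ loops attached at a common vertex $\mathbf 0$; regular of length $\ell$ means each pendant has length $\ell$ and each loop length $2\ell$. Convention: a dummy vertex is placed at the midpoint of each loop, so every compact edge has length $\ell$, identified with $[0,\ell]$ with $\mathbf 0$ at $x=0$; half-lines are identified with $[0,\infty)$ with $\mathbf 0$ at $x=0$. A bound-state is a nontrivial $u\in H^1(\mathcal G)$ with $\int_{\mathcal G}u'\eta'+u\eta-|u|^{p-2}u\eta=0$ for all $\eta\in H^1(\mathcal G)$. $S(u)=\frac12\int(|u'|^2+|u|^2)-\frac1p\int|u|^p$ (on $\mathbb R$ for $\varphi$). $\varphi(x)=(p/2)^{1/(p-2)}\operatorname{sech}^{2/(p-2)}\big(\frac{p-2}{2}x\big)$ is the real-line soliton. *)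

theory Defs
  imports "HOL-Analysis.Analysis"
begin

text \<open>
Regular single-knot metric graph of length l with H half-lines, P pendants, L loops.
A function on the graph is a pair (uh, uc):
  uh h : the restriction to half-line h (h < H), identified with [0,\<infinity>), knot at x = 0;
  uc e : the restriction to compact edge e (e < P + 2 L), identified with [0,l], knot at x = 0.
Edges e < P are the pendants; loop j (j < L) is split by its dummy midpoint vertex into
the two compact edges P + 2 j and P + 2 j + 1, which meet at x = l.
\<close>

definition H1_interval :: "real set \<Rightarrow> (real \<Rightarrow> real) \<Rightarrow> (real \<Rightarrow> real) \<Rightarrow> bool" where
  "H1_interval I u u' \<longleftrightarrow>
     set_borel_measurable lborel I u \<and> set_borel_measurable lborel I u' \<and>
     set_integrable lborel I (\<lambda>x. (u x)\<^sup>2) \<and>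
     set_integrable lborel I (\<lambda>x. (u' x)\<^sup>2) \<and>
     (\<forall>x\<in>I. set_integrable lborel {0..x} u' \<and>
              u x = u 0 + (LINT t:{0..x}|lborel. u' t))"

definition H1_graph ::
  "nat \<Rightarrow> nat \<Rightarrow> nat \<Rightarrow> real \<Rightarrow> (nat \<Rightarrow> real \<Rightarrow> real) \<Rightarrow> (nat \<Rightarrow> real \<Rightarrow> real)
   \<Rightarrow> (nat \<Rightarrow> real \<Rightarrow> real) \<Rightarrow> (nat \<Rightarrow> real \<Rightarrow> real) \<Rightarrow> bool" where
  "H1_graph H P L l uh uc uh' uc' \<longleftrightarrow>
     (\<forall>h<H. H1_interval {0..} (uh h) (uh' h)) \<and>
     (\<forall>e<P + 2 * L. H1_interval {0..l} (uc e) (uc' e)) \<and>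
     (\<exists>c. (\<forall>h<H. uh h 0 = c) \<and> (\<forall>e<P + 2 * L. uc e 0 = c)) \<and>
     (\<forall>j<L. uc (P + 2 * j) l = uc (P + 2 * j + 1) l)"

definition nontrivial_graph_fun ::
  "nat \<Rightarrow> nat \<Rightarrow> nat \<Rightarrow> real \<Rightarrow> (nat \<Rightarrow> real \<Rightarrow> real) \<Rightarrow> (nat \<Rightarrow> real \<Rightarrow> real) \<Rightarrow> bool" where
  "nontrivial_graph_fun H P L l uh uc \<longleftrightarrow>
     (\<exists>h<H. \<exists>x\<ge>0. uh h x \<noteq> 0) \<or> (\<exists>e<P + 2 * L. \<exists>x\<in>{0..l}. uc e x \<noteq> 0)"

definition bound_state ::
  "nat \<Rightarrow> nat \<Rightarrow> nat \<Rightarrow> real \<Rightarrow> real \<Rightarrow> (nat \<Rightarrow> real \<Rightarrow> real) \<Rightarrow> (nat \<Rightarrow> real \<Rightarrow> real)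
   \<Rightarrow> (nat \<Rightarrow> real \<Rightarrow> real) \<Rightarrow> (nat \<Rightarrow> real \<Rightarrow> real) \<Rightarrow> bool" where
  "bound_state H P L l p uh uc uh' uc' \<longleftrightarrow>
     H1_graph H P L l uh uc uh' uc' \<and> nontrivial_graph_fun H P L l uh uc \<and>
     (\<forall>\<eta>h \<eta>c \<eta>h' \<eta>c'. H1_graph H P L l \<eta>h \<eta>c \<eta>h' \<eta>c' \<longrightarrow>
        (\<Sum>h<H. LINT x:{0..}|lborel.
             uh' h x * \<eta>h' h x + uh h x * \<eta>h h x - \<bar>uh h x\<bar> powr (p - 2) * uh h x * \<eta>h h x)
      + (\<Sum>e<P + 2 * L. LINT x:{0..l}|lborel.
             uc' e x * \<eta>c' e x + uc e x * \<eta>c e x - \<bar>uc e x\<bar> powr (p - 2) * uc e x * \<eta>c e x)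
      = 0)"

definition action ::
  "nat \<Rightarrow> nat \<Rightarrow> nat \<Rightarrow> real \<Rightarrow> real \<Rightarrow> (nat \<Rightarrow> real \<Rightarrow> real) \<Rightarrow> (nat \<Rightarrow> real \<Rightarrow> real)
   \<Rightarrow> (nat \<Rightarrow> real \<Rightarrow> real) \<Rightarrow> (nat \<Rightarrow> real \<Rightarrow> real) \<Rightarrow> real" where
  "action H P L l p uh uc uh' uc' =
     1/2 * ((\<Sum>h<H. LINT x:{0..}|lborel. (uh' h x)\<^sup>2 + (uh h x)\<^sup>2)
          + (\<Sum>e<P + 2 * L. LINT x:{0..l}|lborel. (uc' e x)\<^sup>2 + (uc e x)\<^sup>2))
   - 1/p * ((\<Sum>h<H. LINT x:{0..}|lborel. \<bar>uh h x\<bar> powr p)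
          + (\<Sum>e<P + 2 * L. LINT x:{0..l}|lborel. \<bar>uc e x\<bar> powr p))"

definition soliton :: "real \<Rightarrow> real \<Rightarrow> real" where
  "soliton p x = (p / 2) powr (1 / (p - 2)) * (1 / cosh ((p - 2) / 2 * x)) powr (2 / (p - 2))"

definition soliton_action :: "real \<Rightarrow> real" where
  "soliton_action p =
     1/2 * (LINT x|lborel. (deriv (soliton p) x)\<^sup>2 + (soliton p x)\<^sup>2)
   - 1/p * (LINT x|lborel. \<bar>soliton p x\<bar> powr p)"

definition G0_edges :: "nat \<Rightarrow> nat set \<Rightarrow> nat set \<Rightarrow> nat set" where
  "G0_edges P Ps Ls = Ps \<union> (\<Union>j\<in>Ls. {P + 2 * j, P + 2 * j + 1})"

end

theory Submission
  imports Defs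
begin

text \<open>
  On every half-line take a translate \<open>\<phi>(x + a)\<close> of the soliton, so that \<open>v(0) = \<phi>(a) =: s\<close> is small.
  On the edges outside \<open>G\<^sub>0\<close> shoot from the free end with a small value \<open>m\<close> and zero derivative; this gives
  a decreasing profile whose value \<open>s(m)\<close> and slope at the knot depend continuously on \<open>m\<close>.
  The Kirchhoff condition then dictates the slope \<open>b(m) > 0\<close> with which the profile on the edges of \<open>G\<^sub>0\<close>
  leaves the knot, and one equation \<open>u'(l) = 0\<close> for the one parameter \<open>m\<close> remains.
  For tiny \<open>m\<close> the profile still grows at \<open>x = l\<close>; for \<open>s(m) = \<delta>\<close> it must have turned before a time
  depending on \<open>\<delta>\<close> only. For the first \<open>m\<close> at which \<open>u'\<close> vanishes somewhere on \<open>[0, l]\<close>, conservation of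
  \<open>u'\<^sup>2 - u\<^sup>2 + (2/p) u\<^sup>p\<close> excludes interior zeros, so \<open>u'(l) = 0\<close>, and puts \<open>u(l)\<close> close to \<open>\<phi>(0)\<close>.
  Gronwall's inequality on a fixed interval behind the maximum and the smallness of both functions beyond it
  compare \<open>u\<close> with the soliton. Testing the equation with the solution itself reduces the action of
  each edge to its \<open>L\<^sup>p\<close> norm and a boundary term.
\<close>

section \<open>Lipschitz initial value problems\<close>

text \<open>The profiles outside \<open>G\<^sub>0\<close>, and with them the data \<open>s\<close>
  and \<open>b\<close> of the shooting problem, depend on the length, whereas the time by which a
  trajectory turns must not. Hence the data enter \<open>growing_edge\<close> only through c0 s <= b
  <= c1 s, with constants fixed by the edge counts, and its time bound precedes the quantifiers over
  length and data. The smallness parameters are chosen in the order \<open>\<epsilon>\<close>,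
  \<open>Y\<close>, \<open>\<kappa>\<close>, \<open>\<eta>\<close>, \<open>\<delta>\<close>, length:
  \<open>Y\<close> cuts off the tail of the soliton, \<open>\<kappa>\<close> and
  \<open>\<eta>\<close> pay for Gronwall's factor on [0, Y], and \<open>\<delta>\<close> keeps the
  energy within the tolerance that \<open>\<eta>\<close> allows at the maximum. The constant does
  not depend on \<open>Y\<close>, because \<open>\<kappa>\<close> is taken below
  \<open>\<epsilon> / Y\<close>. The shooting parameter is \<open>m\<close> and not the knot value,
  which is only known to be continuous in \<open>m\<close>. The half-lines carry zero energy, so
  their slope is an explicit continuous function of the knot value. Every edge of
  \<open>G\<^sub>0\<close> carries half a soliton, whence E_0 / 2. Both halves of a loop carry the
  same profile, flat at the dummy vertex, so nothing has to be matched there.\<close>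

lemma lipschitz_ivp_integral:
  fixes G :: "'a::banach \<Rightarrow> 'a"
  assumes K: "0 < K" and lip: "\<And>x y. norm (G x - G y) \<le> K * norm (x - y)"
  obtains Z :: "real \<Rightarrow> 'a" where "continuous_on {0..} Z"
    and "\<And>x. 0 \<le> x \<Longrightarrow> Z x = z0 + integral {0..x} (\<lambda>t. G (Z t))"
proof -
  \<comment> \<open>Picard iteration in an exponentially weighted sup norm: for Z t = exp (lam t) v
    t with bounded v the integral operator has Lipschitz constant K / lam = 1/2. One fixed point
    then covers the whole half-line, and no local solutions have to be glued.\<close>
  define lam where "lam = 2 * K"
  have lam: "lam > 0" using K by (simp add: lam_def)
  have contG: "continuous_on UNIV G"
    by (rule lipschitz_on_continuous_on[of K], rule lipschitz_onI)
      (use lip K in \<open>auto simp: dist_norm\<close>)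
  define h where "h v t = G (exp (lam * t) *\<^sub>R apply_bcontfun v t)" for v :: "real \<Rightarrow>\<^sub>C 'a" and t
  have conth: "continuous_on S (h v)" for v S
    unfolding h_def
    by (rule continuous_on_compose2[OF contG]) (auto intro!: continuous_intros)
  have inth: "h v integrable_on {a..b}" for v a b
    by (rule integrable_continuous_real[OF conth])
  \<comment> \<open>Bounded continuous functions live on the whole line; for negative x the operator
    is frozen at its value \<open>z0\<close> at 0.\<close>
  define F where "F v x = exp (- lam * max 0 x) *\<^sub>R (z0 + integral {0..max 0 x} (h v))" for v x
  have expint: "integral {0..x} (\<lambda>t. c * exp (lam * t)) = c / lam * (exp (lam * x) - 1)"
    and expint': "(\<lambda>t. c * exp (lam * t)) integrable_on {0..x}" if "x \<ge> 0" for c x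
  proof -
    have "((\<lambda>t. c * exp (lam * t)) has_integral (c / lam * exp (lam * x) - c / lam * exp (lam * 0))) {0..x}"
      using lam that
      by (intro fundamental_theorem_of_calculus)
        (auto intro!: derivative_eq_intros simp flip: has_real_derivative_iff_has_vector_derivative)
    thus "integral {0..x} (\<lambda>t. c * exp (lam * t)) = c / lam * (exp (lam * x) - 1)"
      "(\<lambda>t. c * exp (lam * t)) integrable_on {0..x}"
      by (auto simp: algebra_simps dest: integral_unique)
  qed
  have F_bcontfun: "F v \<in> bcontfun" for v
  proof (rule bcontfun_normI)
    show "continuous_on UNIV (F v)"
      unfolding F_def
    proof (intro continuous_intros)
      have "isCont (\<lambda>x. integral {0..max 0 x} (h v)) x" for x
      proof -
        have "continuous_on {..<\<bar>x\<bar>+1} (\<lambda>x. integral {0..max 0 x} (h v))"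
          by (rule continuous_on_compose2[OF indefinite_integral_continuous_1[OF inth, of 0 "\<bar>x\<bar>+1"]])
             (auto intro!: continuous_intros)
        thus ?thesis by (subst (asm) continuous_on_eq_continuous_at) auto
      qed
      thus "continuous_on UNIV (\<lambda>x. integral {0..max 0 x} (h v))"
        by (simp add: continuous_at_imp_continuous_on)
    qed
    fix x :: real
    define y where "y = max 0 x"
    have y: "y \<ge> 0" by (simp add: y_def)
    have "norm (integral {0..y} (h v)) \<le> integral {0..y} (\<lambda>t. norm (G 0) + K * norm v * exp (lam * t))"
    proof (rule integral_norm_bound_integral[OF inth])
      show "(\<lambda>t. norm (G 0) + K * norm v * exp (lam * t)) integrable_on {0..y}"
        by (intro integrable_add expint' y) auto
      fix t :: real
      have "norm (h v t) \<le> norm (G 0) + norm (h v t - G 0)"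
        by norm
      also have "norm (h v t - G 0) \<le> K * norm (exp (lam * t) *\<^sub>R apply_bcontfun v t)"
        unfolding h_def using lip[of "exp (lam * t) *\<^sub>R apply_bcontfun v t" 0] by simp
      also have "\<dots> \<le> K * (exp (lam * t) * norm v)"
        using K by (auto intro!: mult_left_mono norm_bounded)
      finally show "norm (h v t) \<le> norm (G 0) + K * norm v * exp (lam * t)" by (simp add: mult_ac)
    qed
    also have "\<dots> = y * norm (G 0) + K * norm v / lam * (exp (lam * y) - 1)"
      using y expint[OF y] expint'[OF y] by (subst integral_add) auto
    also have "\<dots> \<le> exp (lam * y) * (norm (G 0) / lam) + K * norm v / lam * exp (lam * y)"
    proof (intro add_mono mult_left_mono)
      have "lam * y \<le> exp (lam * y)" using exp_ge_add_one_self[of "lam * y"] by linarith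
      hence "y \<le> exp (lam * y) / lam" using lam by (simp add: field_simps)
      thus "y * norm (G 0) \<le> exp (lam * y) * (norm (G 0) / lam)"
        using mult_right_mono[of y "exp (lam * y) / lam" "norm (G 0)"] by simp
    qed (use K lam in auto)
    finally have 1: "norm (integral {0..y} (h v)) \<le> exp (lam * y) * (norm (G 0) / lam + K * norm v / lam)"
      by (simp add: algebra_simps)
    have "norm (F v x) \<le> exp (- lam * y) * (norm z0 + norm (integral {0..y} (h v)))"
      unfolding F_def y_def[symmetric] by (auto intro!: mult_left_mono norm_triangle_ineq)
    also have "\<dots> \<le> exp (- lam * y) * (exp (lam * y) * norm z0 + exp (lam * y) * (norm (G 0) / lam + K * norm v / lam))"
    proof (intro mult_left_mono add_mono 1)
      show "norm z0 \<le> exp (lam * y) * norm z0"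
        using lam y mult_right_mono[of 1 "exp (lam * y)" "norm z0"] by simp
    qed auto
    also have "\<dots> = (exp (- lam * y) * exp (lam * y)) * (norm z0 + (norm (G 0) / lam + K * norm v / lam))"
      by (simp only: distrib_left mult.assoc)
    also have "exp (- lam * y) * exp (lam * y) = 1" by (simp flip: exp_add)
    finally show "norm (F v x) \<le> norm z0 + (norm (G 0) / lam + K * norm v / lam)" by simp
  qed
  define T where "T v = Bcontfun (F v)" for v
  have T: "apply_bcontfun (T v) x = F v x" for v x
    unfolding T_def by (subst Bcontfun_inverse[OF F_bcontfun]) simp
  have "\<exists>!v. T v = v"
  proof (rule banach_fix_type[of "1/2"])
    show "\<forall>v w. dist (T v) (T w) \<le> 1 / 2 * dist v w"
    proof (intro allI dist_bound)
      fix v w :: "real \<Rightarrow>\<^sub>C 'a" and x :: real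
      define y where "y = max 0 x"
      have y: "y \<ge> 0" by (simp add: y_def)
      have "norm (integral {0..y} (\<lambda>t. h v t - h w t)) \<le> integral {0..y} (\<lambda>t. K * dist v w * exp (lam * t))"
      proof (rule integral_norm_bound_integral)
        show "(\<lambda>t. h v t - h w t) integrable_on {0..y}" by (intro integrable_diff inth)
        show "(\<lambda>t. K * dist v w * exp (lam * t)) integrable_on {0..y}" by (rule expint'[OF y])
        fix t
        have "norm (h v t - h w t) \<le> K * (exp (lam * t) * dist (v t) (w t))"
          unfolding h_def using lip[of "exp (lam * t) *\<^sub>R apply_bcontfun v t" "exp (lam * t) *\<^sub>R apply_bcontfun w t"]
          by (simp add: dist_norm flip: scaleR_diff_right)
        also have "\<dots> \<le> K * (exp (lam * t) * dist v w)"
          using K by (auto intro!: mult_left_mono dist_bounded)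
        finally show "norm (h v t - h w t) \<le> K * dist v w * exp (lam * t)" by (simp add: mult_ac)
      qed
      also have "\<dots> = K * dist v w / lam * (exp (lam * y) - 1)" by (rule expint[OF y])
      also have "\<dots> \<le> dist v w / 2 * exp (lam * y)" using K by (simp add: lam_def mult_left_mono field_simps)
      finally have 1: "norm (integral {0..y} (h v) - integral {0..y} (h w)) \<le> dist v w / 2 * exp (lam * y)"
        by (subst Henstock_Kurzweil_Integration.integral_diff[OF inth inth, symmetric])
      have "dist (T v x) (T w x) = exp (- lam * y) * norm (integral {0..y} (h v) - integral {0..y} (h w))"
        unfolding T F_def y_def[symmetric] dist_norm by (simp flip: scaleR_diff_right)
      also have "\<dots> \<le> exp (- lam * y) * (dist v w / 2 * exp (lam * y))"
        by (intro mult_left_mono 1) auto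
      also have "\<dots> = (exp (- lam * y) * exp (lam * y)) * (1/2 * dist v w)" by simp
      also have "exp (- lam * y) * exp (lam * y) = 1" by (simp flip: exp_add)
      finally show "dist (T v x) (T w x) \<le> 1 / 2 * dist v w" by simp
    qed
  qed auto
  then obtain v where v: "T v = v" by blast
  define Z where "Z x = exp (lam * x) *\<^sub>R apply_bcontfun v x" for x
  show ?thesis
  proof
    show "continuous_on {0..} Z" unfolding Z_def by (auto intro!: continuous_intros)
    fix x :: real assume "x \<ge> 0"
    hence "Z x = exp (lam * x) *\<^sub>R F v x" unfolding Z_def using v T[of v x] by simp
    also have "\<dots> = z0 + integral {0..x} (h v)"
      using \<open>x \<ge> 0\<close> by (simp add: F_def max_def flip: exp_add)
    also have "h v = (\<lambda>t. G (Z t))" by (auto simp: h_def Z_def)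
    finally show "Z x = z0 + integral {0..x} (\<lambda>t. G (Z t))" .
  qed
qed

text \<open>Two-sided differentiability at the initial time is obtained by continuing the vector field
  constantly to negative times.\<close>

lemma lipschitz_ivp:
  fixes G :: "'a::banach \<Rightarrow> 'a"
  assumes K: "0 < K" and lip: "\<And>x y. norm (G x - G y) \<le> K * norm (x - y)"
  obtains Z :: "real \<Rightarrow> 'a" where "Z 0 = z0" and "\<And>t. 0 \<le> t \<Longrightarrow> (Z has_vector_derivative G (Z t)) (at t)"
proof -
  obtain Z :: "real \<Rightarrow> 'a" where cZ: "continuous_on {0..} Z"
    and Z: "\<And>x. 0 \<le> x \<Longrightarrow> Z x = z0 + integral {0..x} (\<lambda>t. G (Z t))"
    using lipschitz_ivp_integral[OF K lip] by blast
  have contG: "continuous_on UNIV G"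
    by (rule lipschitz_on_continuous_on[of K], rule lipschitz_onI)
      (use lip K in \<open>auto simp: dist_norm\<close>)
  define h where "h t = G (Z (max t 0))" for t
  have conth: "continuous_on S h" for S unfolding h_def
    by (rule continuous_on_compose2[OF contG], rule continuous_on_compose2[OF cZ])
       (auto intro!: continuous_intros)
  \<comment> \<open>Starting the integral at -1 makes 0 an interior point; the subtracted part
    restores the initial value.\<close>
  define W where "W x = z0 + (integral {-1..x} h - integral {-1..0} h)" for x
  have W: "W x = Z x" if "x \<ge> 0" for x
  proof -
    have "integral {-1..0} h + integral {0..x} h = integral {-1..x} h"
      by (rule Henstock_Kurzweil_Integration.integral_combine)
        (use that in \<open>auto intro!: integrable_continuous_real conth\<close>)
    moreover have "integral {0..x} h = integral {0..x} (\<lambda>t. G (Z t))"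
      by (rule integral_cong) (auto simp: h_def)
    ultimately show ?thesis unfolding W_def Z[OF that]
      by (metis add_diff_cancel_left')
  qed
  show ?thesis
  proof
    show "W 0 = z0" by (simp add: W_def)
    fix t :: real assume t: "0 \<le> t"
    have "((\<lambda>x. integral {-1..x} h) has_vector_derivative h t) (at t within {-1..t+1})"
      by (rule integral_has_vector_derivative[OF conth]) (use t in auto)
    hence "((\<lambda>x. integral {-1..x} h) has_vector_derivative h t) (at t)"
      using t by (subst (asm) at_within_interior) auto
    hence "(W has_vector_derivative h t) (at t)"
      unfolding W_def
      by (auto intro!: derivative_eq_intros)
    thus "(W has_vector_derivative G (W t)) (at t)" using t by (simp add: W h_def)
  qed
qed

lemma second_order_ivp:
  fixes g :: "real \<Rightarrow> real"
  assumes K: "0 \<le> K" and lip: "\<And>x y. \<bar>g x - g y\<bar> \<le> K * \<bar>x - y\<bar>"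
  shows "\<exists>u v. u 0 = a \<and> v 0 = b \<and> (\<forall>t\<ge>0. (u has_real_derivative v t) (at t) \<and>
    (v has_real_derivative g (u t)) (at t))"
proof -
  define G where "G z = (snd z, g (fst z))" for z :: "real \<times> real"
  have lipG: "norm (G x - G y) \<le> (1 + K) * norm (x - y)" for x y
  proof -
    have "norm (G x - G y) \<le> \<bar>snd (x - y)\<bar> + \<bar>g (fst x) - g (fst y)\<bar>"
      using norm_Pair_le[of "snd (x - y)" "g (fst x) - g (fst y)"] by (simp add: G_def)
    also have "\<dots> \<le> norm (x - y) + K * norm (x - y)"
    proof (intro add_mono)
      show "\<bar>snd (x - y)\<bar> \<le> norm (x - y)"
        by (metis norm_snd_le prod.collapse real_norm_def)
      have "\<bar>fst x - fst y\<bar> \<le> norm (x - y)"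
        by (metis fst_diff norm_fst_le prod.collapse real_norm_def)
      thus "\<bar>g (fst x) - g (fst y)\<bar> \<le> K * norm (x - y)"
        using lip[of "fst x" "fst y"] K by (meson mult_left_mono order_trans)
    qed
    finally show ?thesis by (simp add: algebra_simps)
  qed
  have "0 < 1 + K" using K by simp
  then obtain Z where Z: "Z 0 = (a, b)" "\<And>t. 0 \<le> t \<Longrightarrow> (Z has_vector_derivative G (Z t)) (at t)"
    using lipschitz_ivp[OF _ lipG, of "(a, b)"] by blast
  have "((fst \<circ> Z) has_vector_derivative snd (Z t)) (at t)"
       "((snd \<circ> Z) has_vector_derivative g (fst (Z t))) (at t)" if "t \<ge> 0" for t
    using bounded_linear.has_vector_derivative[OF bounded_linear_fst Z(2)[OF that]]
      bounded_linear.has_vector_derivative[OF bounded_linear_snd Z(2)[OF that]]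
    by (auto simp: G_def comp_def)
  hence "(fst \<circ> Z) 0 = a \<and> (snd \<circ> Z) 0 = b \<and> (\<forall>t\<ge>0. ((fst \<circ> Z) has_real_derivative (snd \<circ> Z) t) (at t) \<and>
    ((snd \<circ> Z) has_real_derivative g ((fst \<circ> Z) t)) (at t))"
    using Z(1) by (simp add: has_real_derivative_iff_has_vector_derivative)
  thus ?thesis by blast
qed

text \<open>The squared distance \<open>e\<close> in phase space satisfies e' <= 2 (1 + K) e,
  because both cross terms are absorbed by 2 A B <= A^2 + B^2. Weighted with exp (- 2 (1 + K) t) it
  is nonincreasing, and the square root halves the rate.\<close>

lemma second_order_gronwall:
  fixes g :: "real \<Rightarrow> real"
  assumes K: "0 \<le> K" and lip: "\<And>x y. \<bar>g x - g y\<bar> \<le> K * \<bar>x - y\<bar>"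
    and u1: "\<And>t. 0 \<le> t \<Longrightarrow> t \<le> T \<Longrightarrow> (u1 has_real_derivative v1 t) (at t)"
    and v1: "\<And>t. 0 \<le> t \<Longrightarrow> t \<le> T \<Longrightarrow> (v1 has_real_derivative g (u1 t)) (at t)"
    and u2: "\<And>t. 0 \<le> t \<Longrightarrow> t \<le> T \<Longrightarrow> (u2 has_real_derivative v2 t) (at t)"
    and v2: "\<And>t. 0 \<le> t \<Longrightarrow> t \<le> T \<Longrightarrow> (v2 has_real_derivative g (u2 t)) (at t)"
    and t: "0 \<le> t" "t \<le> T"
  shows "\<bar>u1 t - u2 t\<bar> \<le> exp ((1 + K) * t) * (\<bar>u1 0 - u2 0\<bar> + \<bar>v1 0 - v2 0\<bar>)"
    and "\<bar>v1 t - v2 t\<bar> \<le> exp ((1 + K) * t) * (\<bar>u1 0 - u2 0\<bar> + \<bar>v1 0 - v2 0\<bar>)"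
proof -
  define e where "e t = (u1 t - u2 t)\<^sup>2 + (v1 t - v2 t)\<^sup>2" for t
  define k where "k = 1 + K"
  have "exp (- 2 * k * t) * e t \<le> exp (- 2 * k * 0) * e 0"
  proof (rule DERIV_nonpos_imp_nonincreasing[OF t(1)])
    fix x assume x: "0 \<le> x" "x \<le> t"
    define A B where "A = u1 x - u2 x" and "B = v1 x - v2 x"
    have "((\<lambda>t. exp (- 2 * k * t) * e t) has_real_derivative
       exp (- 2 * k * x) * (-2 * k * (A\<^sup>2 + B\<^sup>2) + 2 * A * B + 2 * B * (g (u1 x) - g (u2 x)))) (at x)"
      unfolding e_def A_def B_def using x t
      by (auto intro!: derivative_eq_intros u1 u2 v1 v2 simp: algebra_simps)
    moreover have "2 * A * B \<le> A\<^sup>2 + B\<^sup>2" using sum_squares_bound by blast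
    moreover have "2 * B * (g (u1 x) - g (u2 x)) \<le> K * A\<^sup>2 + K * B\<^sup>2"
    proof -
      have "2 * B * (g (u1 x) - g (u2 x)) \<le> 2 * \<bar>B\<bar> * \<bar>g (u1 x) - g (u2 x)\<bar>"
        by (metis abs_le_iff abs_mult abs_numeral mult.assoc order_refl)
      also have "\<dots> \<le> 2 * \<bar>B\<bar> * (K * \<bar>A\<bar>)" unfolding A_def by (intro mult_left_mono lip) auto
      also have "\<dots> = K * (2 * \<bar>A\<bar> * \<bar>B\<bar>)" by simp
      also have "\<dots> \<le> K * (\<bar>A\<bar>\<^sup>2 + \<bar>B\<bar>\<^sup>2)" by (intro mult_left_mono sum_squares_bound K)
      finally show ?thesis by (simp add: algebra_simps)
    qed
    moreover have "-2 * k * (A\<^sup>2 + B\<^sup>2) = - 2 * A\<^sup>2 - 2 * B\<^sup>2 - 2 * (K * A\<^sup>2) - 2 * (K * B\<^sup>2)"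
      by (simp add: k_def algebra_simps)
    moreover have "0 \<le> A\<^sup>2" "0 \<le> B\<^sup>2" "0 \<le> K * A\<^sup>2" "0 \<le> K * B\<^sup>2" using K by simp_all
    ultimately have "-2 * k * (A\<^sup>2 + B\<^sup>2) + 2 * A * B + 2 * B * (g (u1 x) - g (u2 x)) \<le> 0"
      by linarith
    thus "\<exists>y. ((\<lambda>t. exp (- 2 * k * t) * e t) has_real_derivative y) (at x) \<and> y \<le> 0"
      using \<open>(_ has_real_derivative _) _\<close> by (meson mult_nonneg_nonpos exp_ge_zero)
  qed
  hence "exp (2 * k * t) * (exp (- 2 * k * t) * e t) \<le> exp (2 * k * t) * e 0"
    by (intro mult_left_mono) auto
  hence e: "e t \<le> exp (2 * k * t) * e 0"
    by (simp flip: exp_add mult.assoc)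
  have sq: "exp (2 * k * t) = (exp (k * t))\<^sup>2" by (simp add: power2_eq_square flip: exp_add)
  have "e 0 \<le> (\<bar>u1 0 - u2 0\<bar> + \<bar>v1 0 - v2 0\<bar>)\<^sup>2"
    unfolding e_def power2_sum by simp
  hence "e t \<le> exp (2 * k * t) * (\<bar>u1 0 - u2 0\<bar> + \<bar>v1 0 - v2 0\<bar>)\<^sup>2"
    using e by (meson mult_left_mono order_trans exp_ge_zero)
  hence *: "e t \<le> (exp (k * t) * (\<bar>u1 0 - u2 0\<bar> + \<bar>v1 0 - v2 0\<bar>))\<^sup>2"
    by (simp add: sq power_mult_distrib)
  have "\<bar>u1 t - u2 t\<bar>\<^sup>2 \<le> e t" "\<bar>v1 t - v2 t\<bar>\<^sup>2 \<le> e t" by (auto simp: e_def)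
  with * show "\<bar>u1 t - u2 t\<bar> \<le> exp ((1 + K) * t) * (\<bar>u1 0 - u2 0\<bar> + \<bar>v1 0 - v2 0\<bar>)"
    and "\<bar>v1 t - v2 t\<bar> \<le> exp ((1 + K) * t) * (\<bar>u1 0 - u2 0\<bar> + \<bar>v1 0 - v2 0\<bar>)"
    unfolding k_def by (auto intro: power2_le_imp_le order_trans)
qed

section \<open>The nonlinearity and the soliton\<close>

text \<open>The equation on every edge is u'' = \<open>nlforce p u\<close>.\<close>

definition nlforce :: "real \<Rightarrow> real \<Rightarrow> real" where
  "nlforce p u = u - \<bar>u\<bar> powr (p - 2) * u"

text \<open>Twice the primitive of the force on positive arguments, so that u'^2 -
  \<open>potential p u\<close> is the conserved energy. It rises on [0, 1], falls from 1 on, and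
  vanishes at 0 and at \<open>peak p\<close>.\<close>

definition potential :: "real \<Rightarrow> real \<Rightarrow> real" where
  "potential p u = u\<^sup>2 - 2 / p * u powr p"

definition peak :: "real \<Rightarrow> real" where
  "peak p = (p / 2) powr (1 / (p - 2))"

text \<open>Below this threshold the nonlinear term is at most half of the linear one.\<close>

definition small_bound :: "real \<Rightarrow> real" where
  "small_bound p = (1 / 2) powr (1 / (p - 2))"

text \<open>Closed form of the derivative; \<open>deriv\<close> itself enters only when the action
  of the soliton is evaluated.\<close>

definition soliton_deriv :: "real \<Rightarrow> real \<Rightarrow> real" where
  "soliton_deriv p x = - soliton p x * tanh ((p - 2) / 2 * x)"

definition clip :: "real \<Rightarrow> real \<Rightarrow> real" where
  "clip B u = max 0 (min B u)"

lemma clip_id: "0 \<le> u \<Longrightarrow> u \<le> B \<Longrightarrow> clip B u = u"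
  by (simp add: clip_def)

lemma powr_lipschitz:
  fixes r :: real
  assumes r: "1 \<le> r" and a: "0 \<le> a" "a \<le> B" and b: "0 \<le> b" "b \<le> B"
  shows "\<bar>a powr r - b powr r\<bar> \<le> r * B powr (r - 1) * \<bar>a - b\<bar>"
proof -
  have main: "\<bar>a powr r - b powr r\<bar> \<le> r * B powr (r - 1) * \<bar>a - b\<bar>"
    if "0 \<le> a" "a < b" "b \<le> B" for a b
  proof -
    have "continuous_on {a..b} (\<lambda>x. x powr r)"
      using that r by (intro continuous_on_powr' continuous_intros) auto
    moreover have "((\<lambda>x. x powr r) has_real_derivative r * x powr (r - 1)) (at x)" if "a < x" for x
      using that \<open>0 \<le> a\<close> has_real_derivative_powr[of x r] by auto
    ultimately obtain z where z: "a < z" "z < b" "b powr r - a powr r = (b - a) * (r * z powr (r - 1))"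
      using MVT[OF \<open>a < b\<close>, of "\<lambda>x. x powr r"] by (metis DERIV_unique real_differentiable_def)
    have "z powr (r - 1) \<le> B powr (r - 1)"
      using z that r by (intro powr_mono2) auto
    hence "(b - a) * (r * z powr (r - 1)) \<le> (b - a) * (r * B powr (r - 1))"
      using that r by (intro mult_left_mono) auto
    moreover have "(b - a) * (r * z powr (r - 1)) \<ge> 0" using that r by auto
    ultimately show ?thesis using z that by (simp add: abs_if mult_ac)
  qed
  show ?thesis
    using main[of a b] main[of b a] a b by (cases a b rule: linorder_cases) (auto simp: abs_minus_commute)
qed

lemma nlforce_nonneg_eq:
  assumes "0 \<le> u" shows "nlforce p u = u - u powr (p - 1)"
proof (cases "u = 0")
  case False
  hence "u powr (p - 2) * u = u powr (p - 2) * u powr 1" using assms by simp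
  also have "\<dots> = u powr (p - 1)" by (subst powr_add[symmetric]) simp
  finally show ?thesis using assms by (simp add: nlforce_def)
qed (auto simp: nlforce_def)

lemma nlforce_0 [simp]: "nlforce p 0 = 0"
  by (simp add: nlforce_def)

lemma abs_powr_mult_self: "\<bar>u\<bar> powr (p - 2) * u * u = \<bar>u\<bar> powr p" for u p :: real
proof (cases "u = 0")
  case False
  hence "\<bar>u\<bar> powr p = \<bar>u\<bar> powr (p - 2) * \<bar>u\<bar> powr 2" by (subst powr_add[symmetric]) simp
  also have "\<bar>u\<bar> powr 2 = u * u" using False by (subst powr_numeral) (auto simp: power2_eq_square)
  finally show ?thesis by simp
qed auto

section \<open>Sign, monotonicity and Lipschitz bounds of the force and its potential\<close>

context
  fixes p :: real
  assumes p: "p > 2"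
begin

lemma nlforce_pos:
  assumes "0 < u" "u < 1" shows "0 < nlforce p u"
proof -
  have "u powr (p - 1) < u powr 1" using assms p by (intro powr_less_mono') auto
  thus ?thesis using assms by (simp add: nlforce_nonneg_eq)
qed

lemma nlforce_neg:
  assumes "1 < u" shows "nlforce p u < 0"
proof -
  have "u powr 1 < u powr (p - 1)" using assms p by (intro powr_less_mono) auto
  thus ?thesis using assms by (simp add: nlforce_nonneg_eq)
qed

lemma nlforce_1 [simp]: "nlforce p 1 = 0"
  by (simp add: nlforce_def)

lemma nlforce_nonneg: "0 \<le> u \<Longrightarrow> u \<le> 1 \<Longrightarrow> 0 \<le> nlforce p u"
  using nlforce_pos[of u] by (cases "u = 0 \<or> u = 1") force+

lemma nlforce_le_1:
  assumes "0 \<le> u" shows "nlforce p u \<le> 1"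
proof (cases "u \<le> 1")
  case True
  thus ?thesis using assms powr_ge_zero[of u "p - 1"] by (simp add: nlforce_nonneg_eq del: powr_ge_zero)
next
  case False
  thus ?thesis using nlforce_neg[of u] by simp
qed

lemma nlforce_antimono:
  assumes "1 \<le> a" "a \<le> b" shows "nlforce p b \<le> nlforce p a"
proof -
  have "a - a * a powr (p - 2) = a * (1 - a powr (p - 2))" by (simp add: algebra_simps)
  have 1: "1 \<le> a powr (p - 2)" using assms p by (intro ge_one_powr_ge_zero) auto
  have 2: "a powr (p - 2) \<le> b powr (p - 2)" using assms p by (intro powr_mono2) auto
  have "a * (a powr (p - 2) - 1) \<le> b * (b powr (p - 2) - 1)"
    using assms 1 2 by (intro mult_mono) auto
  thus ?thesis using assms by (simp add: nlforce_def algebra_simps)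
qed

lemma nlforce_continuous: "continuous_on S (nlforce p)"
  unfolding nlforce_def using p by (auto intro!: continuous_intros continuous_on_powr')

lemma nlforce_lipschitz:
  assumes B: "0 \<le> B"
  shows "\<bar>nlforce p (clip B x) - nlforce p (clip B y)\<bar> \<le> (1 + (p - 1) * B powr (p - 2)) * \<bar>x - y\<bar>"
proof -
  define a b where "a = clip B x" and "b = clip B y"
  have ab: "0 \<le> a" "a \<le> B" "0 \<le> b" "b \<le> B" "\<bar>a - b\<bar> \<le> \<bar>x - y\<bar>"
    using B by (auto simp: a_def b_def clip_def)
  have "\<bar>nlforce p a - nlforce p b\<bar> \<le> \<bar>a - b\<bar> + \<bar>a powr (p - 1) - b powr (p - 1)\<bar>"
    using ab by (simp add: nlforce_nonneg_eq)
  also have "\<dots> \<le> \<bar>a - b\<bar> + (p - 1) * B powr (p - 2) * \<bar>a - b\<bar>"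
    using powr_lipschitz[of "p - 1" a B b] ab p by simp
  also have "\<dots> = (1 + (p - 1) * B powr (p - 2)) * \<bar>a - b\<bar>" by (simp add: algebra_simps)
  also have "\<dots> \<le> (1 + (p - 1) * B powr (p - 2)) * \<bar>x - y\<bar>"
    using ab p by (intro mult_left_mono) auto
  finally show ?thesis by (simp add: a_def b_def)
qed

lemma potential_deriv:
  assumes "0 < u" shows "(potential p has_real_derivative 2 * nlforce p u) (at u)"
proof -
  have "((\<lambda>u. u\<^sup>2 - 2 / p * u powr p) has_real_derivative 2 * u - 2 / p * (p * u powr (p - 1))) (at u)"
    using assms p by (auto intro!: derivative_eq_intros has_real_derivative_powr)
  thus ?thesis using assms p
    by (simp add: potential_def[abs_def] nlforce_nonneg_eq algebra_simps)
qed

lemma potential_0 [simp]: "potential p 0 = 0"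
  by (simp add: potential_def)

lemma potential_continuous: "continuous_on {0..} (potential p)"
  unfolding potential_def[abs_def] using p
  by (auto intro!: continuous_intros continuous_on_powr')

lemma potential_strict_mono:
  assumes "0 \<le> a" "a < b" "b \<le> 1" shows "potential p a < potential p b"
proof (rule DERIV_pos_imp_increasing_open[OF \<open>a < b\<close>])
  fix x assume "a < x" "x < b"
  thus "\<exists>y. (potential p has_real_derivative y) (at x) \<and> 0 < y"
    using potential_deriv[of x] nlforce_pos[of x] assms by auto
qed (use assms in \<open>auto intro: continuous_on_subset[OF potential_continuous]\<close>)

lemma potential_mono:
  assumes "0 \<le> a" "a \<le> b" "b \<le> 1" shows "potential p a \<le> potential p b"
  using potential_strict_mono[of a b] assms by (cases "a = b") auto

lemma potential_strict_antimono:
  assumes "1 \<le> a" "a < b" shows "potential p b < potential p a"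
proof (rule DERIV_neg_imp_decreasing_open[OF \<open>a < b\<close>])
  fix x assume "a < x" "x < b"
  thus "\<exists>y. (potential p has_real_derivative y) (at x) \<and> y < 0"
    using potential_deriv[of x] nlforce_neg[of x] assms by auto
qed (use assms in \<open>auto intro: continuous_on_subset[OF potential_continuous]\<close>)

lemma potential_antimono:
  assumes "1 \<le> a" "a \<le> b" shows "potential p b \<le> potential p a"
  using potential_strict_antimono[of a b] assms by (cases "a = b") auto

lemma potential_le_square: "potential p u \<le> u\<^sup>2"
  using p by (simp add: potential_def)

lemma potential_eq: "0 \<le> u \<Longrightarrow> potential p u = u\<^sup>2 * (1 - 2 / p * u powr (p - 2))"
  using abs_powr_mult_self[of u p] by (simp add: potential_def algebra_simps power2_eq_square)

lemma peak_powr: "peak p powr (p - 2) = p / 2"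
  using p by (simp add: peak_def powr_powr)

lemma peak_gt_1: "1 < peak p"
  unfolding peak_def using p powr_less_mono2[of "1 / (p - 2)" 1 "p / 2"] by simp

lemma potential_peak [simp]: "potential p (peak p) = 0"
  using p peak_gt_1 by (subst potential_eq) (auto simp: peak_powr)

lemma small_bound_pos: "0 < small_bound p"
  by (simp add: small_bound_def)

lemma small_bound_lt_1: "small_bound p < 1"
  unfolding small_bound_def using p powr_less_mono2[of "1 / (p - 2)" "1 / 2" 1] by simp

lemma small_powr:
  assumes "0 \<le> u" "u \<le> small_bound p" shows "u powr (p - 2) \<le> 1 / 2"
proof -
  have "u powr (p - 2) \<le> small_bound p powr (p - 2)" using assms p by (intro powr_mono2) auto
  also have "\<dots> = 1 / 2" using p by (simp add: small_bound_def powr_powr)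
  finally show ?thesis .
qed

lemma small_powr_p:
  assumes "0 \<le> u" "u \<le> small_bound p" shows "u powr p \<le> u\<^sup>2 / 2"
  using mult_right_mono[OF small_powr[OF assms], of "u * u"] abs_powr_mult_self[of u p] assms
  by (simp add: power2_eq_square mult.assoc)

text \<open>Gives s / 2 <= sqrt (potential p s) for small s, the lower slope bound behind
  \<open>c0\<close>. The estimate yields u^2 / 2; the quarter is stated because it is a perfect
  square.\<close>

lemma potential_ge:
  assumes "0 \<le> u" "u \<le> small_bound p" shows "u\<^sup>2 / 4 \<le> potential p u"
proof -
  have "2 / p * u powr p \<le> 1 * u powr p" using p by (intro mult_right_mono) auto
  hence "u\<^sup>2 / 2 \<le> potential p u" using small_powr_p[OF assms] by (simp add: potential_def)
  thus ?thesis using zero_le_power2[of u] by linarith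
qed

section \<open>The explicit soliton: equation, energy level, monotonicity and decay\<close>

lemma soliton_eq: "soliton p x = peak p * exp (- (2 / (p - 2)) * ln (cosh ((p - 2) / 2 * x)))"
  by (simp add: soliton_def peak_def powr_def ln_div)

lemma soliton_0 [simp]: "soliton p 0 = peak p"
  by (simp add: soliton_eq)

lemma soliton_pos: "0 < soliton p x"
  using peak_gt_1 by (simp add: soliton_eq)

lemma soliton_even: "soliton p (- x) = soliton p x"
  by (simp add: soliton_def)

text \<open>The power p - 2 removes both fractional exponents. The differential equation and the
  energy identity then reduce to tanh^2 = 1 - 1 / cosh^2.\<close>

lemma soliton_powr: "soliton p x powr (p - 2) = p / 2 / (cosh ((p - 2) / 2 * x))\<^sup>2"
proof -
  have pp: "2 / (p - 2) * (p - 2) = 2" using p by (intro nonzero_eq_divide_eq[THEN iffD1, OF _ refl]) auto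
  have "soliton p x powr (p - 2) = peak p powr (p - 2) * ((1 / cosh ((p - 2) / 2 * x)) powr (2 / (p - 2))) powr (p - 2)"
    unfolding soliton_def peak_def by (subst powr_mult) auto
  also have "((1 / cosh ((p - 2) / 2 * x)) powr (2 / (p - 2))) powr (p - 2) = (1 / cosh ((p - 2) / 2 * x)) powr 2"
    by (simp only: powr_powr pp)
  also have "\<dots> = 1 / (cosh ((p - 2) / 2 * x))\<^sup>2"
    by (subst powr_numeral) (auto simp: power_divide)
  finally show ?thesis by (simp add: peak_powr)
qed

lemma tanh_square: "(tanh z)\<^sup>2 = 1 - 1 / (cosh z)\<^sup>2" for z :: real
proof -
  have "(sinh z)\<^sup>2 = (cosh z)\<^sup>2 - 1" by (simp add: cosh_square_eq)
  thus ?thesis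
    unfolding tanh_def power_divide by (simp add: diff_divide_distrib)
qed

lemma soliton_has_deriv: "(soliton p has_real_derivative soliton_deriv p x) (at x)"
proof -
  define c where "c = (p - 2) / 2"
  have c: "c \<noteq> 0" "2 / (p - 2) = 1 / c" using p by (auto simp: c_def)
  have "((\<lambda>x. peak p * exp (- (1 / c) * ln (cosh (c * x)))) has_real_derivative
     - (peak p * exp (- (1 / c) * ln (cosh (c * x)))) * tanh (c * x)) (at x)"
    using c(1) by (auto intro!: derivative_eq_intros simp: tanh_def)
  thus ?thesis
    unfolding soliton_deriv_def soliton_eq[abs_def] c(2) c_def[symmetric] .
qed

lemma soliton_deriv_has_deriv:
  "(soliton_deriv p has_real_derivative nlforce p (soliton p x)) (at x)"
proof -
  define z where "z = (p - 2) / 2 * x"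
  have "((\<lambda>x. - soliton p x * tanh ((p - 2) / 2 * x)) has_real_derivative
      - soliton_deriv p x * tanh z - soliton p x * ((1 - (tanh z)\<^sup>2) * ((p - 2) / 2))) (at x)"
    unfolding z_def by (auto intro!: derivative_eq_intros soliton_has_deriv)
  also have "(\<lambda>x. - soliton p x * tanh ((p - 2) / 2 * x)) = soliton_deriv p"
    by (simp add: soliton_deriv_def fun_eq_iff)
  also have "- soliton_deriv p x * tanh z - soliton p x * ((1 - (tanh z)\<^sup>2) * ((p - 2) / 2))
     = soliton p x * (1 - p / 2 * (1 - (tanh z)\<^sup>2))"
    unfolding soliton_deriv_def z_def[symmetric] by (simp add: field_simps power2_eq_square)
  also have "1 - (tanh z)\<^sup>2 = 1 / (cosh z)\<^sup>2"
    by (simp add: tanh_square)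
  also have "p / 2 * (1 / (cosh z)\<^sup>2) = soliton p x powr (p - 2)"
    by (simp add: soliton_powr z_def)
  also have "soliton p x * (1 - soliton p x powr (p - 2)) = nlforce p (soliton p x)"
    using soliton_pos[of x] by (simp add: nlforce_def algebra_simps)
  finally show ?thesis .
qed

text \<open>The soliton is an orbit of energy zero.\<close>

lemma soliton_deriv_square: "(soliton_deriv p x)\<^sup>2 = potential p (soliton p x)"
proof -
  define z where "z = (p - 2) / 2 * x"
  have "(tanh z)\<^sup>2 = 1 - 1 / (cosh z)\<^sup>2"
    by (rule tanh_square)
  also have "1 / (cosh z)\<^sup>2 = 2 / p * soliton p x powr (p - 2)"
    using p by (simp add: soliton_powr z_def)
  finally show ?thesis using soliton_pos[of x]
    unfolding soliton_deriv_def z_def[symmetric] by (simp add: potential_eq power_mult_distrib)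
qed

lemma soliton_deriv_0 [simp]: "soliton_deriv p 0 = 0"
  by (simp add: soliton_deriv_def)

lemma soliton_deriv_neg: "0 < x \<Longrightarrow> soliton_deriv p x < 0"
  using soliton_pos[of x] p by (simp add: soliton_deriv_def)

lemma soliton_deriv_abs_le: "\<bar>soliton_deriv p x\<bar> \<le> soliton p x"
proof -
  have "(soliton_deriv p x)\<^sup>2 \<le> (soliton p x)\<^sup>2"
    unfolding soliton_deriv_square by (rule potential_le_square)
  thus ?thesis using soliton_pos[of x] by (simp add: abs_le_square_iff[symmetric])
qed

lemma soliton_decreasing:
  assumes "0 \<le> x" "x < y" shows "soliton p y < soliton p x"
proof (rule DERIV_neg_imp_decreasing_open[OF \<open>x < y\<close>])
  fix z assume "x < z" "z < y"
  thus "\<exists>y. (soliton p has_real_derivative y) (at z) \<and> y < 0"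
    using soliton_has_deriv soliton_deriv_neg[of z] assms by force
qed (use soliton_has_deriv DERIV_isCont continuous_at_imp_continuous_on in blast)

lemma soliton_le_peak: "soliton p x \<le> peak p"
  using soliton_decreasing[of 0 x] soliton_decreasing[of 0 "-x"]
  by (cases x "0::real" rule: linorder_cases) (auto simp: soliton_even)

text \<open>From cosh z >= exp z / 2; the factors (p - 2) / 2 and 2 / (p - 2) cancel, so the decay
  rate is 1 for every p.\<close>

lemma soliton_le_exp: "soliton p x \<le> peak p * 2 powr (2 / (p - 2)) * exp (- x)"
proof -
  define z where "z = (p - 2) / 2 * x"
  have "exp z / 2 \<le> cosh z" by (simp add: cosh_def)
  hence "ln (exp z / 2) \<le> ln (cosh z)" by (subst ln_le_cancel_iff) auto
  hence "z - ln 2 \<le> ln (cosh z)" by (simp add: ln_div)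
  hence "- (2 / (p - 2)) * ln (cosh z) \<le> - (2 / (p - 2)) * (z - ln 2)"
    using p by (intro mult_left_mono_neg) auto
  also have "\<dots> = 2 / (p - 2) * ln 2 - x" using p by (simp add: z_def field_simps)
  finally have "exp (- (2 / (p - 2)) * ln (cosh z)) \<le> exp (2 / (p - 2) * ln 2) * exp (- x)"
    by (simp flip: exp_add)
  also have "exp (2 / (p - 2) * ln 2) = 2 powr (2 / (p - 2))" by (simp add: powr_def)
  finally show ?thesis
    unfolding soliton_eq z_def[symmetric] mult.assoc using peak_gt_1 by (intro mult_left_mono) auto
qed

lemma soliton_tendsto_0: "(soliton p \<longlongrightarrow> 0) at_top"
proof (rule tendsto_sandwich[of "\<lambda>_. 0" _ _ "\<lambda>x. peak p * 2 powr (2 / (p - 2)) * exp (- x)"])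
  have "((\<lambda>x::real. exp (- x)) \<longlongrightarrow> 0) at_top"
    by (rule filterlim_compose[OF exp_at_bot filterlim_uminus_at_bot_at_top])
  thus "((\<lambda>x. peak p * 2 powr (2 / (p - 2)) * exp (- x)) \<longlongrightarrow> 0) at_top"
    using tendsto_mult_left by fastforce
qed (auto intro!: always_eventually soliton_le_exp less_imp_le[OF soliton_pos])

lemma soliton_continuous: "continuous_on S (soliton p)"
  using soliton_has_deriv DERIV_isCont continuous_at_imp_continuous_on by blast

lemma soliton_deriv_continuous: "continuous_on S (soliton_deriv p)"
  using soliton_deriv_has_deriv DERIV_isCont continuous_at_imp_continuous_on by blast

lemma soliton_small:
  assumes "0 < e" obtains Y where "0 < Y" "soliton p Y < e"
proof -
  have "eventually (\<lambda>x. soliton p x < e \<and> x > 0) at_top"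
    using order_tendstoD(2)[OF soliton_tendsto_0 assms] eventually_gt_at_top[of 0]
    by eventually_elim auto
  from eventually_happens[OF this] show ?thesis using that by auto
qed

text \<open>Supplies the translate on the half-lines once the knot value is known.\<close>

lemma soliton_attains:
  assumes "0 < s" "s < peak p" obtains a where "0 < a" "soliton p a = s"
proof -
  obtain Y where Y: "0 < Y" "soliton p Y < s" using soliton_small assms by blast
  have "\<exists>x\<ge>0. x \<le> Y \<and> soliton p x = s"
    using Y assms soliton_continuous by (intro IVT2') auto
  then obtain a where "0 \<le> a" "soliton p a = s" by blast
  moreover have "a \<noteq> 0" using calculation assms by auto
  ultimately show ?thesis using that[of a] by simp
qed

end

section \<open>Integration by parts against test functions\<close>

lemma set_borel_measurable_continuous_lborel:
  fixes f :: "real \<Rightarrow> real"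
  assumes "A \<in> sets borel" "continuous_on A f"
  shows "set_borel_measurable lborel A f"
  using borel_measurable_continuous_on_indicator[OF assms] by (simp add: set_borel_measurable_def)

lemma set_borel_measurable_mono:
  fixes f :: "real \<Rightarrow> real"
  assumes "set_borel_measurable lborel A f" "B \<subseteq> A" "B \<in> sets borel"
  shows "set_borel_measurable lborel B f"
proof -
  have "(\<lambda>x. indicator B x *\<^sub>R (indicator A x *\<^sub>R f x)) \<in> borel_measurable lborel"
    using assms unfolding set_borel_measurable_def by measurable
  also have "(\<lambda>x. indicator B x *\<^sub>R (indicator A x *\<^sub>R f x)) = (\<lambda>x. indicator B x *\<^sub>R f x)"
    using assms(2) by (auto simp: fun_eq_iff indicator_def)
  finally show ?thesis unfolding set_borel_measurable_def .
qed

lemma set_borel_measurable_times: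
  fixes f g :: "real \<Rightarrow> real"
  assumes "set_borel_measurable lborel A f" "set_borel_measurable lborel A g"
  shows "set_borel_measurable lborel A (\<lambda>x. f x * g x)"
proof -
  have "(\<lambda>x. (indicator A x *\<^sub>R f x) * (indicator A x *\<^sub>R g x)) \<in> borel_measurable lborel"
    using assms unfolding set_borel_measurable_def by measurable
  also have "(\<lambda>x. (indicator A x *\<^sub>R f x) * (indicator A x *\<^sub>R g x)) = (\<lambda>x. indicator A x *\<^sub>R (f x * g x))"
    by (auto simp: fun_eq_iff indicator_def)
  finally show ?thesis unfolding set_borel_measurable_def .
qed

lemma set_integral_FTC:
  fixes f f' :: "real \<Rightarrow> real"
  assumes "a \<le> b" and "\<And>x. a \<le> x \<Longrightarrow> x \<le> b \<Longrightarrow> (f has_real_derivative f' x) (at x)"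
    and "continuous_on {a..b} f'"
  shows "(LINT x:{a..b}|lborel. f' x) = f b - f a"
  unfolding set_lebesgue_integral_def
  using assms by (intro integral_FTC_atLeastAtMost)
    (auto simp: has_real_derivative_iff_has_vector_derivative intro: has_vector_derivative_at_within)

lemma set_integrable_exp_Ici: "set_integrable lborel {0..} (\<lambda>x::real. exp (- x))"
proof -
  have "(\<integral>\<^sup>+x. ennreal (exp (- x)) * indicator {0..} x \<partial>lborel) = ennreal (0 - (- exp (- 0)))"
  proof (rule nn_integral_FTC_atLeast)
    have "((\<lambda>x::real. exp (- x)) \<longlongrightarrow> 0) at_top"
      by (rule filterlim_compose[OF exp_at_bot filterlim_uminus_at_bot_at_top])
    thus "((\<lambda>x::real. - exp (- x)) \<longlongrightarrow> 0) at_top"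
      using tendsto_minus by fastforce
  qed (auto intro!: derivative_eq_intros)
  moreover have "(\<integral>\<^sup>+x. ennreal (exp (- x)) * indicator {0..} x \<partial>lborel)
    = (\<integral>\<^sup>+x. ennreal (norm (indicator {0..} x *\<^sub>R exp (- x) :: real)) \<partial>lborel)"
    by (intro nn_integral_cong) (auto simp: indicator_def)
  ultimately have "(\<integral>\<^sup>+x. ennreal (norm (indicator {0..} x *\<^sub>R exp (- x) :: real)) \<partial>lborel) < \<infinity>"
    by simp
  thus ?thesis
    unfolding set_integrable_def by (intro integrableI_bounded) simp_all
qed

lemma set_integrable_exp_bound:
  fixes f :: "real \<Rightarrow> real"
  assumes "set_borel_measurable lborel {0..} f" "\<And>x. 0 \<le> x \<Longrightarrow> \<bar>f x\<bar> \<le> A * exp (- x)"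
  shows "set_integrable lborel {0..} f"
proof (rule set_integrable_bound)
  show "set_integrable lborel {0..} (\<lambda>x. A * exp (- x))"
    using set_integrable_exp_Ici by simp
  have "\<bar>f x\<bar> \<le> \<bar>A * exp (- x)\<bar>" if "0 \<le> x" for x
    using assms(2)[OF that] by linarith
  thus "AE x in lborel. x \<in> {0..} \<longrightarrow> norm (f x) \<le> norm (A * exp (- x))"
    by auto
qed fact

section \<open>Integration by parts with absolutely continuous test functions\<close>

lemma H1_intervalD:
  assumes "H1_interval I u u'"
  shows "set_borel_measurable lborel I u" "set_borel_measurable lborel I u'"
    and "set_integrable lborel I (\<lambda>x. (u x)\<^sup>2)" "set_integrable lborel I (\<lambda>x. (u' x)\<^sup>2)"
    and "\<And>x. x \<in> I \<Longrightarrow> set_integrable lborel {0..x} u'"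
    and "\<And>x. x \<in> I \<Longrightarrow> u x = u 0 + (LINT t:{0..x}|lborel. u' t)"
  using assms unfolding H1_interval_def by blast+

lemma H1_interval_Icc_subset:
  assumes "H1_interval {0..} u u'" "0 \<le> R" shows "H1_interval {0..R} u u'"
proof -
  note H = H1_intervalD[OF assms(1)]
  have "{0..R} \<subseteq> {0..}" "{0..R} \<in> sets borel" "{0..R} \<in> sets lborel" by auto
  thus ?thesis
    unfolding H1_interval_def
    by (intro conjI ballI H(5,6) set_borel_measurable_mono[OF H(1)] set_borel_measurable_mono[OF H(2)]
        set_integrable_subset[OF H(3)] set_integrable_subset[OF H(4)]) blast+
qed

text \<open>The test function is only absolutely continuous, so the product rule is replaced by Fubini's
  theorem on the triangle \<open>t \<le> x\<close>.\<close>

lemma integral_by_parts_H1: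
  fixes v v' \<eta> \<eta>' :: "real \<Rightarrow> real"
  assumes l: "0 \<le> l"
    and v: "\<And>x. 0 \<le> x \<Longrightarrow> x \<le> l \<Longrightarrow> (v has_real_derivative v' x) (at x)"
    and cv': "continuous_on {0..l} v'"
    and \<eta>: "H1_interval {0..l} \<eta> \<eta>'"
  shows "set_integrable lborel {0..l} (\<lambda>x. v x * \<eta>' x + v' x * \<eta> x)"
    and "(LINT x:{0..l}|lborel. v x * \<eta>' x + v' x * \<eta> x) = v l * \<eta> l - v 0 * \<eta> 0"
proof -
  have cv: "continuous_on {0..l} v"
    by (rule DERIV_continuous_on, rule has_field_derivative_at_within, rule v) auto
  \<comment> \<open>\<open>f\<close> and \<open>g\<close> are the two derivatives extended by zero,
    which turns all integrals into integrals over the line.\<close>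
  define f where "f t = indicator {0..l} t * \<eta>' t" for t
  define g where "g x = indicator {0..l} x * v' x" for x
  have int_f: "integrable lborel f"
    using H1_intervalD(5)[OF \<eta>, of l] l by (simp add: f_def[abs_def] set_integrable_def)
  have int_g: "integrable lborel g"
    using borel_integrable_atLeastAtMost'[OF cv'] by (simp add: g_def[abs_def] set_integrable_def)
  note [measurable] = borel_measurable_integrable[OF int_f] borel_measurable_integrable[OF int_g]
  have mv: "(\<lambda>x. indicator {0..l} x * v x) \<in> borel_measurable lborel"
    using set_borel_measurable_continuous_lborel[OF _ cv] by (simp add: set_borel_measurable_def)
  have "bounded (v ` {0..l})" by (rule compact_imp_bounded[OF compact_continuous_image[OF cv]]) simp
  then obtain Bv where Bv: "\<And>x. x \<in> {0..l} \<Longrightarrow> \<bar>v x\<bar> \<le> Bv"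
    unfolding bounded_iff by (metis imageI real_norm_def)
  have int_vf: "integrable lborel (\<lambda>x. f x * (indicator {0..l} x * v x))"
  proof (rule Bochner_Integration.integrable_bound)
    show "integrable lborel (\<lambda>x. f x * Bv)" using int_f by simp
    show "AE x in lborel. norm (f x * (indicator {0..l} x * v x)) \<le> norm (f x * Bv)"
      using Bv by (intro always_eventually allI) (force simp: indicator_def abs_mult intro!: mult_left_mono)
    show "(\<lambda>x. f x * (indicator {0..l} x * v x)) \<in> borel_measurable lborel"
      using mv by measurable
  qed
  have g_int: "(\<integral>x. g x \<partial>lborel) = v l - v 0"
    using set_integral_FTC[OF l v cv'] by (simp add: g_def[abs_def] set_lebesgue_integral_def)
  have f_int: "(\<integral>t. f t * indicator {..x} t \<partial>lborel) = \<eta> x - \<eta> 0" if "x \<in> {0..l}" for x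
  proof -
    have "(\<integral>t. f t * indicator {..x} t \<partial>lborel) = (LINT t:{0..x}|lborel. \<eta>' t)"
      unfolding set_lebesgue_integral_def f_def using that
      by (intro Bochner_Integration.integral_cong) (auto simp: indicator_def)
    thus ?thesis using H1_intervalD(6)[OF \<eta> that] by linarith
  qed
  have g_int': "(\<integral>x. g x * indicator {t..} x \<partial>lborel) = v l - v t" if "t \<in> {0..l}" for t
  proof -
    have "(\<integral>x. g x * indicator {t..} x \<partial>lborel) = (LINT x:{t..l}|lborel. v' x)"
      unfolding set_lebesgue_integral_def g_def using that
      by (intro Bochner_Integration.integral_cong) (auto simp: indicator_def)
    also have "\<dots> = v l - v t"
      using that by (intro set_integral_FTC v continuous_on_subset[OF cv']) auto
    finally show ?thesis .
  qed
  \<comment> \<open>Integrating over t first turns this kernel into v'(x) (\<open>\<eta>\<close>(x)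
    - \<open>\<eta>\<close>(0)), over x first into \<open>\<eta>'\<close>(t) (v(l) - v(t)). Equating
    the two results is integration by parts.\<close>
  define F where "F x t = g x * f t * indicator {..x} t" for x t :: real
  have ind: "indicator {..x} t = (if t \<le> x then 1 else 0 :: real)" for x t :: real by auto
  have int_G: "integrable (lborel \<Otimes>\<^sub>M lborel) (\<lambda>(x, t). g x * f t)"
  proof (rule lborel_pair.Fubini_integrable)
    show "integrable lborel (\<lambda>x. \<integral>y. norm (case (x, y) of (x, t) \<Rightarrow> g x * f t) \<partial>lborel)"
      using int_f int_g by (simp add: abs_mult)
    show "AE x in lborel. integrable lborel (\<lambda>y. case (x, y) of (x, t) \<Rightarrow> g x * f t)"
      using int_f by simp
  qed measurable
  have int_F: "integrable (lborel \<Otimes>\<^sub>M lborel) (\<lambda>(x, t). F x t)"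
  proof (rule Bochner_Integration.integrable_bound[OF int_G])
    show "(\<lambda>(x, t). F x t) \<in> borel_measurable (lborel \<Otimes>\<^sub>M lborel)"
      unfolding F_def ind by measurable
    show "AE z in lborel \<Otimes>\<^sub>M lborel. norm (case z of (x, t) \<Rightarrow> F x t) \<le> norm (case z of (x, t) \<Rightarrow> g x * f t)"
      by (intro always_eventually allI) (auto simp: F_def indicator_def)
  qed
  have inner1: "(\<integral>t. F x t \<partial>lborel) = g x * (\<eta> x - \<eta> 0)" for x
  proof (cases "x \<in> {0..l}")
    case True
    have "(\<integral>t. F x t \<partial>lborel) = g x * (\<integral>t. f t * indicator {..x} t \<partial>lborel)"
      unfolding F_def mult.assoc by simp
    thus ?thesis using f_int[OF True] by simp
  qed (auto simp: F_def g_def)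
  have inner2: "(\<integral>x. F x t \<partial>lborel) = f t * (v l - indicator {0..l} t * v t)" for t
  proof (cases "t \<in> {0..l}")
    case True
    have "(\<integral>x. F x t \<partial>lborel) = (\<integral>x. f t * (g x * indicator {t..} x) \<partial>lborel)"
      unfolding F_def by (intro Bochner_Integration.integral_cong) (auto simp: indicator_def)
    thus ?thesis using g_int'[OF True] True by simp
  qed (auto simp: F_def f_def)
  have int_g\<eta>: "integrable lborel (\<lambda>x. g x * (\<eta> x - \<eta> 0))"
    using lborel_pair.integrable_fst'[OF int_F] by (simp add: inner1)
  have "(\<integral>x. g x * (\<eta> x - \<eta> 0) \<partial>lborel) = (\<integral>t. f t * (v l - indicator {0..l} t * v t) \<partial>lborel)"
    using lborel_pair.Fubini_integral[OF int_F] by (simp add: inner1 inner2)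
  also have "\<dots> = (\<integral>t. f t * v l - f t * (indicator {0..l} t * v t) \<partial>lborel)"
    by (simp add: algebra_simps)
  also have "\<dots> = (\<integral>t. f t \<partial>lborel) * v l - (\<integral>t. f t * (indicator {0..l} t * v t) \<partial>lborel)"
    using int_vf int_f by (subst Bochner_Integration.integral_diff) auto
  also have "(\<integral>t. f t \<partial>lborel) = \<eta> l - \<eta> 0"
  proof -
    have "(\<integral>t. f t \<partial>lborel) = (\<integral>t. f t * indicator {..l} t \<partial>lborel)"
      by (intro Bochner_Integration.integral_cong) (auto simp: f_def indicator_def)
    thus ?thesis using f_int[of l] l by simp
  qed
  finally have eq: "(\<integral>x. g x * (\<eta> x - \<eta> 0) \<partial>lborel)
      = (\<eta> l - \<eta> 0) * v l - (\<integral>t. f t * (indicator {0..l} t * v t) \<partial>lborel)" .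
  have dec: "(\<lambda>x. indicator {0..l} x *\<^sub>R (v x * \<eta>' x + v' x * \<eta> x))
     = (\<lambda>x. f x * (indicator {0..l} x * v x) + (g x * (\<eta> x - \<eta> 0) + g x * \<eta> 0))"
    by (auto simp: f_def g_def indicator_def fun_eq_iff algebra_simps)
  show "set_integrable lborel {0..l} (\<lambda>x. v x * \<eta>' x + v' x * \<eta> x)"
    unfolding set_integrable_def dec
    by (intro Bochner_Integration.integrable_add int_vf int_g\<eta> integrable_mult_left int_g)
  have "(LINT x:{0..l}|lborel. v x * \<eta>' x + v' x * \<eta> x)
    = (\<integral>x. f x * (indicator {0..l} x * v x) \<partial>lborel) + ((\<integral>x. g x * (\<eta> x - \<eta> 0) \<partial>lborel) + (\<integral>x. g x * \<eta> 0 \<partial>lborel))"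
    unfolding set_lebesgue_integral_def dec
    by (subst Bochner_Integration.integral_add;
        (intro int_vf int_g\<eta> int_g integrable_mult_left Bochner_Integration.integrable_add)?)+ simp
  also have "\<dots> = (\<eta> l - \<eta> 0) * v l + (v l - v 0) * \<eta> 0" using g_int by (simp add: eq)
  finally show "(LINT x:{0..l}|lborel. v x * \<eta>' x + v' x * \<eta> x) = v l * \<eta> l - v 0 * \<eta> 0"
    by (simp add: algebra_simps)
qed

text \<open>From |y| <= 1 + y^2 applied to the derivative. Linear growth is crude for an H1
  function, but it suffices against an exponentially decaying factor and spares the proof that test
  functions vanish at infinity.\<close>

lemma H1_interval_growth:
  assumes "H1_interval {0..} \<eta> \<eta>'"
  obtains C where "\<And>x. 0 \<le> x \<Longrightarrow> \<bar>\<eta> x\<bar> \<le> C + x"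
proof
  fix x :: real assume x: "0 \<le> x"
  define C where "C = (LINT t:{0..}|lborel. (\<eta>' t)\<^sup>2)"
  have int: "set_integrable lborel {0..x} \<eta>'" and eq: "\<eta> x = \<eta> 0 + (LINT t:{0..x}|lborel. \<eta>' t)"
    and sq: "set_integrable lborel {0..} (\<lambda>t. (\<eta>' t)\<^sup>2)"
    using H1_intervalD[OF assms] x by blast+
  have sq': "set_integrable lborel {0..x} (\<lambda>t. (\<eta>' t)\<^sup>2)"
    by (rule set_integrable_subset[OF sq]) auto
  have one: "set_integrable lborel {0..x} (\<lambda>t. 1 :: real)" by (rule borel_integrable_atLeastAtMost') simp
  have bound: "\<bar>\<eta>' t\<bar> \<le> 1 + (\<eta>' t)\<^sup>2" for t
    using sum_squares_bound[of "\<bar>\<eta>' t\<bar>" 1] by simp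
  have "\<bar>LINT t:{0..x}|lborel. \<eta>' t\<bar> \<le> (LINT t:{0..x}|lborel. \<bar>\<eta>' t\<bar>)"
    using set_integral_norm_bound[OF int] by simp
  also have "\<dots> \<le> (LINT t:{0..x}|lborel. 1 + (\<eta>' t)\<^sup>2)"
    using int sq' one bound by (intro set_integral_mono set_integrable_abs) auto
  also have "\<dots> = (LINT t:{0..x}|lborel. 1) + (LINT t:{0..x}|lborel. (\<eta>' t)\<^sup>2)"
    by (rule set_integral_add(2)[OF one sq'])
  also have "(LINT t:{0..x}|lborel. 1) = x" using x set_integral_FTC[of 0 x "\<lambda>x. x" "\<lambda>_. 1"] by simp
  also have "(LINT t:{0..x}|lborel. (\<eta>' t)\<^sup>2) \<le> C"
    unfolding C_def set_lebesgue_integral_def using sq sq'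
    by (intro integral_mono) (auto simp: set_integrable_def indicator_def)
  finally show "\<bar>\<eta> x\<bar> \<le> (\<bar>\<eta> 0\<bar> + C) + x" using eq by linarith
qed

lemma set_integral_tendsto_Ici:
  fixes f :: "real \<Rightarrow> real"
  assumes "set_integrable lborel {0..} f"
  shows "((\<lambda>R. LINT x:{0..R}|lborel. f x) \<longlongrightarrow> (LINT x:{0..}|lborel. f x)) at_top"
proof -
  have "((\<lambda>R. \<integral>x. indicator {..R} x *\<^sub>R (indicator {0..} x *\<^sub>R f x) \<partial>lborel) \<longlongrightarrow> (LINT x:{0..}|lborel. f x)) at_top"
    unfolding set_lebesgue_integral_def using assms
    by (intro tendsto_integral_at_top) (auto simp: set_integrable_def)
  also have "(\<lambda>R. \<integral>x. indicator {..R} x *\<^sub>R (indicator {0..} x *\<^sub>R f x) \<partial>lborel) = (\<lambda>R. LINT x:{0..R}|lborel. f x)"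
    unfolding set_lebesgue_integral_def
    by (intro ext Bochner_Integration.integral_cong) (auto simp: indicator_def)
  finally show ?thesis .
qed

text \<open>Integration by parts on [0, R], then R to infinity: exponential decay of v against
  linear growth of \<open>\<eta>\<close> kills the boundary term at R. Integrability of the products
  follows from |y z| <= y^2 + z^2.\<close>

lemma integral_by_parts_H1_Ici:
  fixes v v' \<eta> \<eta>' :: "real \<Rightarrow> real"
  assumes v: "\<And>x. 0 \<le> x \<Longrightarrow> (v has_real_derivative v' x) (at x)"
    and cv': "continuous_on {0..} v'"
    and bv: "\<And>x. 0 \<le> x \<Longrightarrow> \<bar>v x\<bar> \<le> A * exp (- x)"
    and bv': "\<And>x. 0 \<le> x \<Longrightarrow> \<bar>v' x\<bar> \<le> A * exp (- x)"
    and \<eta>: "H1_interval {0..} \<eta> \<eta>'"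
  shows "set_integrable lborel {0..} (\<lambda>x. v x * \<eta>' x + v' x * \<eta> x)"
    and "(LINT x:{0..}|lborel. v x * \<eta>' x + v' x * \<eta> x) = - v 0 * \<eta> 0"
proof -
  have cv: "continuous_on {0..} v"
    by (rule DERIV_continuous_on, rule has_field_derivative_at_within, rule v) auto
  have prod: "set_integrable lborel {0..} (\<lambda>x. w x * \<xi> x)"
    if cw: "continuous_on {0..} w" and bw: "\<And>x. 0 \<le> x \<Longrightarrow> \<bar>w x\<bar> \<le> A * exp (- x)"
      and \<xi>: "set_borel_measurable lborel {0..} \<xi>" "set_integrable lborel {0..} (\<lambda>x. (\<xi> x)\<^sup>2)" for w \<xi>
  proof (rule set_integrable_bound)
    have "set_integrable lborel {0..} (\<lambda>x. (w x)\<^sup>2)"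
    proof (rule set_integrable_exp_bound[of _ "A\<^sup>2"])
      show "set_borel_measurable lborel {0..} (\<lambda>x. (w x)\<^sup>2)"
        by (intro set_borel_measurable_continuous_lborel continuous_intros cw) auto
      fix x :: real assume x: "0 \<le> x"
      have "\<bar>w x\<bar>\<^sup>2 \<le> (A * exp (- x))\<^sup>2" using bw[OF x] by (intro power_mono) auto
      also have "\<dots> = A\<^sup>2 * (exp (- x) * exp (- x))" by (simp add: power2_eq_square)
      also have "\<dots> \<le> A\<^sup>2 * (exp (- x) * 1)" using x by (intro mult_left_mono) auto
      finally show "\<bar>(w x)\<^sup>2\<bar> \<le> A\<^sup>2 * exp (- x)" by simp
    qed
    thus "set_integrable lborel {0..} (\<lambda>x. (w x)\<^sup>2 + (\<xi> x)\<^sup>2)" using \<xi> by auto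
    show "set_borel_measurable lborel {0..} (\<lambda>x. w x * \<xi> x)"
      by (intro set_borel_measurable_times \<xi> set_borel_measurable_continuous_lborel cw) auto
    have "\<bar>w x * \<xi> x\<bar> \<le> (w x)\<^sup>2 + (\<xi> x)\<^sup>2" for x
      using sum_squares_bound[of "\<bar>w x\<bar>" "\<bar>\<xi> x\<bar>"] abs_ge_zero[of "w x * \<xi> x"]
      unfolding abs_mult power2_abs by linarith
    thus "AE x in lborel. x \<in> {0..} \<longrightarrow> norm (w x * \<xi> x) \<le> norm ((w x)\<^sup>2 + (\<xi> x)\<^sup>2)"
      by (auto intro!: order_trans[OF _ abs_ge_self])
  qed
  show int: "set_integrable lborel {0..} (\<lambda>x. v x * \<eta>' x + v' x * \<eta> x)"
    using H1_intervalD[OF \<eta>] cv cv' bv bv' by (intro set_integral_add(1) prod) blast+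
  obtain C where C: "\<And>x. 0 \<le> x \<Longrightarrow> \<bar>\<eta> x\<bar> \<le> C + x" using H1_interval_growth[OF \<eta>] by blast
  have "((\<lambda>R. v R * \<eta> R) \<longlongrightarrow> 0) at_top"
  proof (rule Lim_null_comparison)
    show "\<forall>\<^sub>F R in at_top. norm (v R * \<eta> R) \<le> A * ((C + R) * exp (- R))"
      using eventually_ge_at_top[of 0]
    proof eventually_elim
      case (elim R)
      have "\<bar>v R\<bar> * \<bar>\<eta> R\<bar> \<le> (A * exp (- R)) * (C + R)"
        using bv[of R] C[of R] elim by (intro mult_mono) (auto intro: order_trans[OF abs_ge_zero])
      thus ?case by (simp add: abs_mult mult_ac)
    qed
    have "((\<lambda>R::real. R / exp R) \<longlongrightarrow> 0) at_top" using tendsto_power_div_exp_0[of 1] by simp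
    moreover have "((\<lambda>R::real. exp (- R)) \<longlongrightarrow> 0) at_top"
      by (rule filterlim_compose[OF exp_at_bot filterlim_uminus_at_bot_at_top])
    ultimately have "((\<lambda>R. A * (C * exp (- R) + R / exp R)) \<longlongrightarrow> A * (C * 0 + 0)) at_top"
      by (intro tendsto_intros)
    thus "((\<lambda>R. A * ((C + R) * exp (- R))) \<longlongrightarrow> 0) at_top"
      by (simp add: algebra_simps exp_minus divide_inverse)
  qed
  hence "((\<lambda>R. v R * \<eta> R - v 0 * \<eta> 0) \<longlongrightarrow> 0 - v 0 * \<eta> 0) at_top" by (intro tendsto_intros)
  moreover have "((\<lambda>R. v R * \<eta> R - v 0 * \<eta> 0) \<longlongrightarrow> (LINT x:{0..}|lborel. v x * \<eta>' x + v' x * \<eta> x)) at_top"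
  proof (rule Lim_transform_eventually[OF set_integral_tendsto_Ici[OF int]])
    show "\<forall>\<^sub>F R in at_top. (LINT x:{0..R}|lborel. v x * \<eta>' x + v' x * \<eta> x) = v R * \<eta> R - v 0 * \<eta> 0"
      using eventually_ge_at_top[of 0]
    proof eventually_elim
      case (elim R)
      show ?case
        by (rule integral_by_parts_H1(2)[OF elim v _ H1_interval_Icc_subset[OF \<eta> elim]])
          (auto intro: continuous_on_subset[OF cv'])
    qed
  qed
  ultimately show "(LINT x:{0..}|lborel. v x * \<eta>' x + v' x * \<eta> x) = - v 0 * \<eta> 0"
    using tendsto_unique[OF trivial_limit_at_top_linorder] by fastforce
qed

section \<open>Differentiable functions as members of H1\<close>

lemma H1_interval_IccI:
  assumes "0 \<le> l" and d: "\<And>x. 0 \<le> x \<Longrightarrow> x \<le> l \<Longrightarrow> (u has_real_derivative v x) (at x)"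
    and c: "continuous_on {0..l} v"
  shows "H1_interval {0..l} u v"
proof -
  have cu: "continuous_on {0..l} u"
    by (rule DERIV_continuous_on, rule has_field_derivative_at_within, rule d) auto
  have "(LINT t:{0..x}|lborel. v t) = u x - u 0" if "x \<in> {0..l}" for x
    using that by (intro set_integral_FTC d continuous_on_subset[OF c]) auto
  moreover have "set_integrable lborel {0..x} v" if "x \<in> {0..l}" for x
    using that by (intro borel_integrable_atLeastAtMost' continuous_on_subset[OF c]) auto
  ultimately show ?thesis
    unfolding H1_interval_def using cu c
    by (auto intro!: set_borel_measurable_continuous_lborel borel_integrable_atLeastAtMost' continuous_intros)
qed

lemma H1_interval_IciI:
  assumes d: "\<And>x. 0 \<le> x \<Longrightarrow> (u has_real_derivative v x) (at x)"
    and c: "continuous_on {0..} v"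
    and bu: "\<And>x. 0 \<le> x \<Longrightarrow> \<bar>u x\<bar> \<le> A * exp (- x)"
    and bv: "\<And>x. 0 \<le> x \<Longrightarrow> \<bar>v x\<bar> \<le> A * exp (- x)"
  shows "H1_interval {0..} u v"
proof -
  have cu: "continuous_on {0..} u"
    by (rule DERIV_continuous_on, rule has_field_derivative_at_within, rule d) auto
  have sq: "set_integrable lborel {0..} (\<lambda>x. (w x)\<^sup>2)"
    if cw: "continuous_on {0..} w" and bw: "\<And>x. 0 \<le> x \<Longrightarrow> \<bar>w x\<bar> \<le> A * exp (- x)" for w
  proof (rule set_integrable_exp_bound[of _ "A\<^sup>2"])
    show "set_borel_measurable lborel {0..} (\<lambda>x. (w x)\<^sup>2)"
      by (intro set_borel_measurable_continuous_lborel continuous_intros cw) auto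
    fix x :: real assume x: "0 \<le> x"
    have "\<bar>w x\<bar>\<^sup>2 \<le> (A * exp (- x))\<^sup>2" using bw[OF x] by (intro power_mono) auto
    also have "\<dots> = A\<^sup>2 * (exp (- x) * exp (- x))" by (simp add: power2_eq_square)
    also have "\<dots> \<le> A\<^sup>2 * (exp (- x) * 1)" using x by (intro mult_left_mono) auto
    finally show "\<bar>(w x)\<^sup>2\<bar> \<le> A\<^sup>2 * exp (- x)" by simp
  qed
  have "(LINT t:{0..x}|lborel. v t) = u x - u 0" if "x \<in> {0..}" for x
    using that by (intro set_integral_FTC d continuous_on_subset[OF c]) auto
  moreover have "set_integrable lborel {0..x} v" if "x \<in> {0..}" for x
    using that by (intro borel_integrable_atLeastAtMost' continuous_on_subset[OF c]) auto
  ultimately show ?thesis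
    unfolding H1_interval_def using cu c sq[OF cu bu] sq[OF c bv]
    by (auto intro!: set_borel_measurable_continuous_lborel)
qed

section \<open>Solutions on edges and half-lines\<close>

text \<open>Derivatives are two-sided at both ends as well, so an edge can be reflected by the
  ordinary chain rule.\<close>

definition solves_on :: "real \<Rightarrow> real \<Rightarrow> (real \<Rightarrow> real) \<Rightarrow> (real \<Rightarrow> real) \<Rightarrow> bool" where
  "solves_on p l u v \<longleftrightarrow> (\<forall>x\<in>{0..l}. (u has_real_derivative v x) (at x) \<and>
     (v has_real_derivative nlforce p (u x)) (at x))"

lemma solves_onD:
  assumes "solves_on p l u v" "0 \<le> x" "x \<le> l"
  shows "(u has_real_derivative v x) (at x)" "(v has_real_derivative nlforce p (u x)) (at x)"
  using assms by (auto simp: solves_on_def)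

lemma solves_on_continuous:
  assumes "solves_on p l u v"
  shows "continuous_on {0..l} u" "continuous_on {0..l} v"
  by (rule DERIV_continuous_on, rule has_field_derivative_at_within, rule solves_onD[OF assms]; simp)+

lemma solves_on_subset: "solves_on p l u v \<Longrightarrow> r \<le> l \<Longrightarrow> solves_on p r u v"
  by (auto simp: solves_on_def)

text \<open>Exchanges the roles of knot and free end: profiles shot from the free end become edge
  functions, and a growing profile becomes comparable with the soliton started at its
  maximum.\<close>

lemma solves_on_reflect:
  assumes "solves_on p l u v"
  shows "solves_on p l (\<lambda>x. u (l - x)) (\<lambda>x. - v (l - x))"
  unfolding solves_on_def
proof (intro ballI conjI)
  fix x assume x: "x \<in> {0..l}"
  note D = solves_onD[OF assms, of "l - x"]
  have "((\<lambda>x. u (l - x)) has_real_derivative v (l - x) * (- 1)) (at x)"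
    using D(1) x by (intro DERIV_chain2[of u]) (auto intro!: derivative_eq_intros)
  thus "((\<lambda>x. u (l - x)) has_real_derivative - v (l - x)) (at x)" by simp
  have "((\<lambda>x. v (l - x)) has_real_derivative nlforce p (u (l - x)) * (- 1)) (at x)"
    using D(2) x by (intro DERIV_chain2[of v]) (auto intro!: derivative_eq_intros)
  from DERIV_minus[OF this] show "((\<lambda>x. - v (l - x)) has_real_derivative nlforce p (u (l - x))) (at x)" by simp
qed

section \<open>Splitting, reflecting and shifting integrals\<close>

lemma set_integral_const_Icc:
  fixes c :: real
  assumes "0 \<le> Y" shows "(LINT y:{0..Y}|lborel. c) = Y * c"
  by (subst set_integral_FTC[of 0 Y "\<lambda>x. x * c"]) (use assms in \<open>auto intro!: derivative_eq_intros\<close>)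

lemma set_integral_Icc_reflect:
  fixes f :: "real \<Rightarrow> real"
  shows "(LINT x:{l - Y..l}|lborel. f x) = (LINT y:{0..Y}|lborel. f (l - y))"
  unfolding set_lebesgue_integral_def
  by (subst lborel_integral_real_affine[where c="-1" and t=l])
     (auto intro!: Bochner_Integration.integral_cong simp: indicator_def)

lemma set_integral_Ici_shift:
  fixes f :: "real \<Rightarrow> real"
  shows "(LINT x:{Y..}|lborel. f x) = (LINT y:{0..}|lborel. f (y + Y))"
  unfolding set_lebesgue_integral_def
  by (subst lborel_integral_real_affine[where c="1" and t=Y])
     (auto intro!: Bochner_Integration.integral_cong simp: indicator_def add.commute)

lemma AE_lborel_neq: "AE x in lborel. x \<noteq> (c :: real)"
  by (rule AE_I[where N="{c}"]) auto

lemma set_integral_Icc_split: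
  fixes f :: "real \<Rightarrow> real"
  assumes "a \<le> b" "b \<le> c" "set_integrable lborel {a..c} f"
  shows "(LINT x:{a..c}|lborel. f x) = (LINT x:{a..b}|lborel. f x) + (LINT x:{b..c}|lborel. f x)"
proof -
  have "(LINT x:{a..b} \<union> {b..c}|lborel. f x) = (LINT x:{a..b}|lborel. f x) + (LINT x:{b..c}|lborel. f x)"
    using assms by (intro set_integral_Un_AE)
      (auto intro: set_integrable_subset AE_mp[OF AE_lborel_neq[of b]])
  moreover have "{a..b} \<union> {b..c} = {a..c}" using assms by auto
  ultimately show ?thesis by simp
qed

lemma set_integral_Ici_split:
  fixes f :: "real \<Rightarrow> real"
  assumes "0 \<le> b" "set_integrable lborel {0..} f"
  shows "(LINT x:{0..}|lborel. f x) = (LINT x:{0..b}|lborel. f x) + (LINT x:{b..}|lborel. f x)"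
proof -
  have "(LINT x:{0..b} \<union> {b..}|lborel. f x) = (LINT x:{0..b}|lborel. f x) + (LINT x:{b..}|lborel. f x)"
    using assms by (intro set_integral_Un_AE)
      (auto intro: set_integrable_subset AE_mp[OF AE_lborel_neq[of b]])
  moreover have "{0..b} \<union> {b..} = {0..}" using assms by auto
  ultimately show ?thesis by simp
qed

lemma integral_even:
  fixes f :: "real \<Rightarrow> real"
  assumes even: "\<And>x. f (- x) = f x" and int: "set_integrable lborel {0..} f"
  shows "(LINT x|lborel. f x) = 2 * (LINT x:{0..}|lborel. f x)"
proof -
  have refl: "(LINT x:{0..}|lborel. f x) = (LINT x:{..0}|lborel. f x)"
    by (subst set_integral_reflect) (auto simp: even atMost_def)
  have "integrable lborel (\<lambda>x. indicator {0..} (0 + (-1) * x) *\<^sub>R f (0 + (-1) * x))"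
    using int unfolding set_integrable_def
    by (subst lborel_integrable_real_affine_iff) auto
  hence "integrable lborel (\<lambda>x. indicator {..0} x *\<^sub>R f x)"
    by (rule Bochner_Integration.integrable_cong[THEN iffD1, rotated -1]) (auto simp: even indicator_def)
  hence int': "set_integrable lborel {..0} f" by (simp add: set_integrable_def)
  have "(LINT x:{0..} \<union> {..0}|lborel. f x) = (LINT x:{0..}|lborel. f x) + (LINT x:{..0}|lborel. f x)"
    using int int' by (intro set_integral_Un_AE) (auto intro: AE_mp[OF AE_lborel_neq[of 0]])
  moreover have "{0..} \<union> {..0} = (UNIV :: real set)" by auto
  ultimately show ?thesis using refl by (simp add: set_lebesgue_integral_def)
qed

context
  fixes p :: real
  assumes p: "p > 2"
begin

lemma powr_abs_continuous_on: "continuous_on S u \<Longrightarrow> continuous_on S (\<lambda>x. \<bar>u x\<bar> powr p)"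
  using p by (auto intro!: continuous_intros continuous_on_powr')

lemma solves_on_continuous_force:
  assumes "solves_on p l u v" shows "continuous_on {0..l} (\<lambda>x. nlforce p (u x))"
  by (rule continuous_on_compose2[OF nlforce_continuous[OF p, of UNIV] solves_on_continuous(1)[OF assms]]) auto

text \<open>Integration by parts of v against the test function leaves only boundary terms. Those at
  x = l vanish for profiles flat at the free end, those at x = 0 are collected by the Kirchhoff
  condition.\<close>

lemma solves_on_weak:
  assumes "0 \<le> l" and s: "solves_on p l u v" and \<eta>: "H1_interval {0..l} \<eta> \<eta>'"
  shows "(LINT x:{0..l}|lborel. v x * \<eta>' x + u x * \<eta> x - \<bar>u x\<bar> powr (p - 2) * u x * \<eta> x)
     = v l * \<eta> l - v 0 * \<eta> 0"
  using integral_by_parts_H1(2)[OF assms(1) solves_onD(2)[OF s] solves_on_continuous_force[OF s] \<eta>]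
  by (simp add: nlforce_def algebra_simps)

lemma solves_on_H1: "0 \<le> l \<Longrightarrow> solves_on p l u v \<Longrightarrow> H1_interval {0..l} u v"
  by (rule H1_interval_IccI) (auto intro: solves_onD solves_on_continuous)

lemma solves_on_integrable:
  assumes "solves_on p l u v"
  shows "set_integrable lborel {0..l} (\<lambda>x. (v x)\<^sup>2 + (u x)\<^sup>2)"
    and "set_integrable lborel {0..l} (\<lambda>x. \<bar>u x\<bar> powr p)"
  by (intro borel_integrable_atLeastAtMost' powr_abs_continuous_on continuous_intros
      solves_on_continuous[OF assms])+

lemma solves_on_identity:
  assumes "0 \<le> l" and s: "solves_on p l u v"
  shows "(LINT x:{0..l}|lborel. (v x)\<^sup>2 + (u x)\<^sup>2) = (LINT x:{0..l}|lborel. \<bar>u x\<bar> powr p) + (v l * u l - v 0 * u 0)"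
proof -
  have "(LINT x:{0..l}|lborel. ((v x)\<^sup>2 + (u x)\<^sup>2) - \<bar>u x\<bar> powr p) = v l * u l - v 0 * u 0"
    using solves_on_weak[OF assms(1) s solves_on_H1[OF assms]]
    by (simp add: abs_powr_mult_self power2_eq_square)
  thus ?thesis using set_integral_diff(2)[OF solves_on_integrable[OF s]] by simp
qed

text \<open>Below \<open>small_bound p\<close> the power u^p is at most u^2 / 2, so its integral is
  at most half of the quadratic one and can be absorbed in the identity. Both integrals are thereby
  controlled by the boundary term X. The set \<open>A\<close> is left general to serve edges and
  half-lines alike.\<close>

lemma small_integral_bounds:
  fixes u v :: "real \<Rightarrow> real"
  assumes A: "A \<in> sets borel" and int: "set_integrable lborel A (\<lambda>x. (v x)\<^sup>2 + (u x)\<^sup>2)" "set_integrable lborel A (\<lambda>x. \<bar>u x\<bar> powr p)"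
    and id: "(LINT x:A|lborel. (v x)\<^sup>2 + (u x)\<^sup>2) = (LINT x:A|lborel. \<bar>u x\<bar> powr p) + X"
    and small: "\<And>x. x \<in> A \<Longrightarrow> 0 \<le> u x \<and> u x \<le> small_bound p"
  shows "0 \<le> (LINT x:A|lborel. (v x)\<^sup>2 + (u x)\<^sup>2)" "(LINT x:A|lborel. (v x)\<^sup>2 + (u x)\<^sup>2) \<le> 2 * X"
    and "0 \<le> (LINT x:A|lborel. \<bar>u x\<bar> powr p)" "(LINT x:A|lborel. \<bar>u x\<bar> powr p) \<le> X"
proof -
  have "(LINT x:A|lborel. \<bar>u x\<bar> powr p) \<le> (LINT x:A|lborel. (1/2) * ((v x)\<^sup>2 + (u x)\<^sup>2))"
  proof (rule set_integral_mono[OF int(2)])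
    show "set_integrable lborel A (\<lambda>x. (1/2) * ((v x)\<^sup>2 + (u x)\<^sup>2))" using int(1) by simp
    fix x assume x: "x \<in> A"
    have "\<bar>u x\<bar> powr p \<le> (u x)\<^sup>2 / 2" using small_powr_p[OF p, of "u x"] small[OF x] by simp
    also have "\<dots> \<le> (1/2) * ((v x)\<^sup>2 + (u x)\<^sup>2)" by simp
    finally show "\<bar>u x\<bar> powr p \<le> (1/2) * ((v x)\<^sup>2 + (u x)\<^sup>2)" .
  qed
  hence 1: "(LINT x:A|lborel. \<bar>u x\<bar> powr p) \<le> 1/2 * (LINT x:A|lborel. (v x)\<^sup>2 + (u x)\<^sup>2)"
    by (simp only: set_integral_mult_right)
  show 2: "0 \<le> (LINT x:A|lborel. \<bar>u x\<bar> powr p)" "0 \<le> (LINT x:A|lborel. (v x)\<^sup>2 + (u x)\<^sup>2)"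
    unfolding set_lebesgue_integral_def by (auto intro!: integral_nonneg)
  show "(LINT x:A|lborel. (v x)\<^sup>2 + (u x)\<^sup>2) \<le> 2 * X" "(LINT x:A|lborel. \<bar>u x\<bar> powr p) \<le> X"
    using 1 2 id by linarith+
qed

lemma solves_on_small:
  assumes "0 \<le> l" and s: "solves_on p l u v"
    and small: "\<And>x. 0 \<le> x \<Longrightarrow> x \<le> l \<Longrightarrow> 0 \<le> u x \<and> u x \<le> small_bound p"
  shows "0 \<le> (LINT x:{0..l}|lborel. (v x)\<^sup>2 + (u x)\<^sup>2)"
    and "(LINT x:{0..l}|lborel. (v x)\<^sup>2 + (u x)\<^sup>2) \<le> 2 * (v l * u l - v 0 * u 0)"
    and "0 \<le> (LINT x:{0..l}|lborel. \<bar>u x\<bar> powr p)"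
    and "(LINT x:{0..l}|lborel. \<bar>u x\<bar> powr p) \<le> v l * u l - v 0 * u 0"
  by (rule small_integral_bounds[OF _ solves_on_integrable[OF s] solves_on_identity[OF assms(1,2)]];
      use small in auto)+

lemma solves_on_energy:
  assumes s: "solves_on p l u v" and pos: "\<And>x. 0 \<le> x \<Longrightarrow> x \<le> l \<Longrightarrow> 0 < u x"
    and x: "0 \<le> x" "x \<le> l"
  shows "(v x)\<^sup>2 - potential p (u x) = (v 0)\<^sup>2 - potential p (u 0)"
proof -
  have d: "((\<lambda>x. (v x)\<^sup>2 - potential p (u x)) has_real_derivative 0) (at y)" if "0 \<le> y" "y \<le> l" for y
  proof -
    have "((\<lambda>x. potential p (u x)) has_real_derivative 2 * nlforce p (u y) * v y) (at y)"
      using that by (intro DERIV_chain2[OF potential_deriv[OF p]] pos solves_onD(1)[OF s])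
    thus ?thesis
      by (auto intro!: derivative_eq_intros solves_onD(2)[OF s] that)
  qed
  have "continuous_on {0..l} (\<lambda>x. (v x)\<^sup>2 - potential p (u x))"
    by (rule DERIV_continuous_on, rule has_field_derivative_at_within, rule d) auto
  from DERIV_isconst2[OF _ this, of x] show ?thesis
    using d x by (cases "l = 0") auto
qed

section \<open>Translated solitons on half-lines\<close>

lemma soliton_shift_deriv:
  "((\<lambda>x. soliton p (x + a)) has_real_derivative soliton_deriv p (x + a)) (at x)"
  "((\<lambda>x. soliton_deriv p (x + a)) has_real_derivative nlforce p (soliton p (x + a))) (at x)"
  using soliton_has_deriv[OF p, of "x + a"] soliton_deriv_has_deriv[OF p, of "x + a"]
  by (simp_all add: DERIV_shift)

lemma nlforce_soliton_le: "\<bar>nlforce p (soliton p x)\<bar> \<le> (1 + p / 2) * soliton p x"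
proof -
  have "1 \<le> (cosh ((p - 2) / 2 * x))\<^sup>2" using cosh_real_ge_1 by (simp add: one_le_power)
  hence "p / 2 / (cosh ((p - 2) / 2 * x))\<^sup>2 \<le> p / 2 / 1" using p by (intro divide_left_mono) auto
  hence 1: "soliton p x powr (p - 2) \<le> p / 2" by (simp only: soliton_powr[OF p] div_by_1)
  have "\<bar>nlforce p (soliton p x)\<bar> \<le> \<bar>soliton p x\<bar> + \<bar>\<bar>soliton p x\<bar> powr (p - 2) * soliton p x\<bar>"
    unfolding nlforce_def by (rule abs_triangle_ineq4)
  also have "\<dots> = soliton p x + soliton p x powr (p - 2) * soliton p x"
    using soliton_pos[OF p, of x] by (simp add: abs_mult)
  also have "\<dots> \<le> soliton p x + p / 2 * soliton p x"
    using 1 soliton_pos[OF p, of x] by (intro add_mono mult_right_mono) auto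
  finally show ?thesis by (simp add: algebra_simps)
qed

text \<open>A single constant majorizes the soliton and its first two derivatives, since integration
  by parts on the half-line asks for one constant for a function and its derivative, and is applied
  to the first derivative.\<close>

lemma soliton_shift_bounds:
  assumes "0 \<le> a" "0 \<le> x"
  defines "A \<equiv> (1 + p / 2) * (peak p * 2 powr (2 / (p - 2)))"
  shows "\<bar>soliton p (x + a)\<bar> \<le> A * exp (- x)"
    "\<bar>soliton_deriv p (x + a)\<bar> \<le> A * exp (- x)"
    "\<bar>nlforce p (soliton p (x + a))\<bar> \<le> A * exp (- x)"
proof -
  define A' where "A' = peak p * 2 powr (2 / (p - 2))"
  have A': "A' > 0" using peak_gt_1[OF p] by (simp add: A'_def)
  have "soliton p (x + a) \<le> A' * exp (- (x + a))" unfolding A'_def by (rule soliton_le_exp[OF p])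
  also have "\<dots> \<le> A' * exp (- x)" using A' assms by (intro mult_left_mono) auto
  finally have "soliton p (x + a) \<le> A' * exp (- x)" .
  hence 1: "(1 + p / 2) * soliton p (x + a) \<le> A * exp (- x)"
    unfolding A_def A'_def[symmetric] mult.assoc using p by (intro mult_left_mono) auto
  have 2: "soliton p (x + a) \<le> (1 + p / 2) * soliton p (x + a)"
    using soliton_pos[OF p, of "x + a"] p by (simp add: algebra_simps)
  show "\<bar>soliton p (x + a)\<bar> \<le> A * exp (- x)" "\<bar>soliton_deriv p (x + a)\<bar> \<le> A * exp (- x)"
    "\<bar>nlforce p (soliton p (x + a))\<bar> \<le> A * exp (- x)"
    using 1 2 soliton_pos[OF p, of "x + a"] soliton_deriv_abs_le[OF p, of "x + a"]
      nlforce_soliton_le[of "x + a"] by linarith+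
qed

lemma soliton_shift_H1:
  assumes "0 \<le> a" shows "H1_interval {0..} (\<lambda>x. soliton p (x + a)) (\<lambda>x. soliton_deriv p (x + a))"
  by (rule H1_interval_IciI[OF soliton_shift_deriv(1) _ soliton_shift_bounds(1,2)[OF assms]])
     (auto intro!: continuous_on_compose2[OF soliton_deriv_continuous[OF p, of UNIV]] continuous_intros)

lemma soliton_shift_by_parts:
  assumes "0 \<le> a" and \<eta>: "H1_interval {0..} \<eta> \<eta>'"
  shows "set_integrable lborel {0..}
      (\<lambda>x. soliton_deriv p (x + a) * \<eta>' x + nlforce p (soliton p (x + a)) * \<eta> x)"
    and "(LINT x:{0..}|lborel. soliton_deriv p (x + a) * \<eta>' x + nlforce p (soliton p (x + a)) * \<eta> x)
      = - soliton_deriv p a * \<eta> 0"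
proof -
  have c: "continuous_on {0..} (\<lambda>x. nlforce p (soliton p (x + a)))"
    by (rule continuous_on_compose2[OF nlforce_continuous[OF p, of UNIV]],
        rule continuous_on_compose2[OF soliton_continuous[OF p, of UNIV]])
       (auto intro!: continuous_intros)
  show "set_integrable lborel {0..}
      (\<lambda>x. soliton_deriv p (x + a) * \<eta>' x + nlforce p (soliton p (x + a)) * \<eta> x)"
    by (rule integral_by_parts_H1_Ici(1)[OF soliton_shift_deriv(2) c
          soliton_shift_bounds(2,3)[OF assms(1)] \<eta>])
  show "(LINT x:{0..}|lborel. soliton_deriv p (x + a) * \<eta>' x + nlforce p (soliton p (x + a)) * \<eta> x)
      = - soliton_deriv p a * \<eta> 0"
    using integral_by_parts_H1_Ici(2)[OF soliton_shift_deriv(2) c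
          soliton_shift_bounds(2,3)[OF assms(1)] \<eta>] by simp
qed

lemma soliton_shift_weak:
  assumes "0 \<le> a" and \<eta>: "H1_interval {0..} \<eta> \<eta>'"
  shows "(LINT x:{0..}|lborel. soliton_deriv p (x + a) * \<eta>' x + soliton p (x + a) * \<eta> x
      - \<bar>soliton p (x + a)\<bar> powr (p - 2) * soliton p (x + a) * \<eta> x) = - soliton_deriv p a * \<eta> 0"
  using soliton_shift_by_parts(2)[OF assms] by (simp add: nlforce_def algebra_simps)

lemma nlforce_mult_self: "nlforce p w * w = w * w - \<bar>w\<bar> powr p"
  by (simp add: nlforce_def left_diff_distrib abs_powr_mult_self)

lemma soliton_shift_integrable:
  assumes "0 \<le> a"
  shows "set_integrable lborel {0..} (\<lambda>x. (soliton_deriv p (x + a))\<^sup>2 + (soliton p (x + a))\<^sup>2)"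
    and "set_integrable lborel {0..} (\<lambda>x. \<bar>soliton p (x + a)\<bar> powr p)"
    and "(LINT x:{0..}|lborel. (soliton_deriv p (x + a))\<^sup>2 + (soliton p (x + a))\<^sup>2)
      = (LINT x:{0..}|lborel. \<bar>soliton p (x + a)\<bar> powr p) + (- soliton_deriv p a * soliton p a)"
proof -
  note H = soliton_shift_H1[OF assms]
  have eq: "(\<lambda>x. soliton_deriv p (x + a) * soliton_deriv p (x + a) + nlforce p (soliton p (x + a)) * soliton p (x + a))
    = (\<lambda>x. ((soliton_deriv p (x + a))\<^sup>2 + (soliton p (x + a))\<^sup>2) - \<bar>soliton p (x + a)\<bar> powr p)"
    unfolding nlforce_mult_self power2_eq_square by (simp add: algebra_simps)
  show 1: "set_integrable lborel {0..} (\<lambda>x. (soliton_deriv p (x + a))\<^sup>2 + (soliton p (x + a))\<^sup>2)"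
    using H1_intervalD(3,4)[OF H] by (intro set_integral_add(1))
  \<comment> \<open>Integrability of the p-th power is read off as the difference of two integrands
    already known to be integrable.\<close>
  have "set_integrable lborel {0..} (\<lambda>x. ((soliton_deriv p (x + a))\<^sup>2 + (soliton p (x + a))\<^sup>2)
     - (((soliton_deriv p (x + a))\<^sup>2 + (soliton p (x + a))\<^sup>2) - \<bar>soliton p (x + a)\<bar> powr p))"
    by (rule set_integral_diff(1)[OF 1 soliton_shift_by_parts(1)[OF assms H, unfolded eq]])
  thus 2: "set_integrable lborel {0..} (\<lambda>x. \<bar>soliton p (x + a)\<bar> powr p)"
    by (simp only: diff_diff_eq2 add_diff_cancel_left')
  show "(LINT x:{0..}|lborel. (soliton_deriv p (x + a))\<^sup>2 + (soliton p (x + a))\<^sup>2)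
      = (LINT x:{0..}|lborel. \<bar>soliton p (x + a)\<bar> powr p) + (- soliton_deriv p a * soliton p a)"
    using soliton_shift_by_parts(2)[OF assms H] unfolding eq set_integral_diff(2)[OF 1 2] by simp
qed

text \<open>The boundary term is - \<open>soliton_deriv p a\<close> \<open>soliton p a\<close>, at
  most the square of the soliton at a. This serves twice: for the half-lines of the graph and for
  the tail of the comparison soliton.\<close>

lemma soliton_shift_small:
  assumes a: "0 \<le> a" "soliton p a \<le> small_bound p"
  shows "0 \<le> (LINT x:{0..}|lborel. (soliton_deriv p (x + a))\<^sup>2 + (soliton p (x + a))\<^sup>2)"
    and "(LINT x:{0..}|lborel. (soliton_deriv p (x + a))\<^sup>2 + (soliton p (x + a))\<^sup>2) \<le> 2 * (soliton p a)\<^sup>2"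
    and "0 \<le> (LINT x:{0..}|lborel. \<bar>soliton p (x + a)\<bar> powr p)"
    and "(LINT x:{0..}|lborel. \<bar>soliton p (x + a)\<bar> powr p) \<le> (soliton p a)\<^sup>2"
proof -
  have small: "0 \<le> soliton p (x + a) \<and> soliton p (x + a) \<le> small_bound p" if "x \<in> {0..}" for x
    using that soliton_decreasing[OF p, of a "x + a"] soliton_pos[OF p, of "x + a"] a
    by (cases "x = 0") auto
  note S = small_integral_bounds[OF _ soliton_shift_integrable[OF a(1)] small, simplified]
  have "- soliton_deriv p a * soliton p a \<le> soliton p a * soliton p a"
    using soliton_deriv_abs_le[OF p, of a] soliton_pos[OF p, of a] by (intro mult_right_mono) auto
  hence X: "- soliton_deriv p a * soliton p a \<le> (soliton p a)\<^sup>2" by (simp add: power2_eq_square)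
  show "0 \<le> (LINT x:{0..}|lborel. (soliton_deriv p (x + a))\<^sup>2 + (soliton p (x + a))\<^sup>2)"
    "(LINT x:{0..}|lborel. (soliton_deriv p (x + a))\<^sup>2 + (soliton p (x + a))\<^sup>2) \<le> 2 * (soliton p a)\<^sup>2"
    "0 \<le> (LINT x:{0..}|lborel. \<bar>soliton p (x + a)\<bar> powr p)"
    "(LINT x:{0..}|lborel. \<bar>soliton p (x + a)\<bar> powr p) \<le> (soliton p a)\<^sup>2"
    using S X by force+
qed

text \<open>Evenness reduces the integrals to the half-line; there the boundary term of the
  self-testing identity vanishes because the soliton is flat at 0.\<close>

lemma soliton_action_eq:
  "soliton_action p = 2 * (1 / 2 - 1 / p) * (LINT x:{0..}|lborel. \<bar>soliton p x\<bar> powr p)"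
proof -
  note I = soliton_shift_integrable[of 0, simplified]
  have d: "deriv (soliton p) = soliton_deriv p"
    by (rule ext) (rule DERIV_imp_deriv[OF soliton_has_deriv[OF p]])
  have e: "soliton_deriv p (- x) = - soliton_deriv p x" for x
    by (simp add: soliton_deriv_def soliton_even[OF p])
  have "(LINT x|lborel. (soliton_deriv p x)\<^sup>2 + (soliton p x)\<^sup>2)
      = 2 * (LINT x:{0..}|lborel. (soliton_deriv p x)\<^sup>2 + (soliton p x)\<^sup>2)"
    by (rule integral_even[OF _ I(1)]) (simp add: e soliton_even[OF p])
  moreover have "(LINT x|lborel. \<bar>soliton p x\<bar> powr p) = 2 * (LINT x:{0..}|lborel. \<bar>soliton p x\<bar> powr p)"
    by (rule integral_even[OF _ I(2)]) (simp add: soliton_even[OF p])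
  ultimately show ?thesis
    using I(3) p by (simp add: soliton_action_def d soliton_deriv_0[OF p] algebra_simps)
qed

text \<open>Both integrals are split at distance Y from the maximum. Near it, pointwise closeness
  and the Lipschitz bound of the power on [0, B] apply; farther away both functions are small, and
  their integrals are bounded by boundary terms.\<close>

lemma powr_integral_near_soliton:
  assumes Y: "0 \<le> Y" "Y \<le> l" and s: "solves_on p l u v"
    and close: "\<And>y. 0 \<le> y \<Longrightarrow> y \<le> Y \<Longrightarrow> \<bar>u (l - y) - soliton p y\<bar> \<le> \<kappa>"
    and B: "\<And>x. 0 \<le> x \<Longrightarrow> x \<le> l \<Longrightarrow> 0 \<le> u x \<and> u x \<le> B" "peak p \<le> B"
    and small: "\<And>x. 0 \<le> x \<Longrightarrow> x \<le> l - Y \<Longrightarrow> u x \<le> small_bound p" "soliton p Y \<le> small_bound p"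
  shows "\<bar>(LINT x:{0..l}|lborel. \<bar>u x\<bar> powr p) - (LINT x:{0..}|lborel. \<bar>soliton p x\<bar> powr p)\<bar>
    \<le> Y * (p * B powr (p - 1) * \<kappa>) + (v (l - Y) * u (l - Y) - v 0 * u 0) + (soliton p Y)\<^sup>2"
proof -
  have ly: "0 \<le> l - Y" "l - Y \<le> l" using Y by auto
  have 1: "(LINT x:{0..l}|lborel. \<bar>u x\<bar> powr p) = (LINT x:{0..l-Y}|lborel. \<bar>u x\<bar> powr p)
     + (LINT y:{0..Y}|lborel. \<bar>u (l - y)\<bar> powr p)"
    using set_integral_Icc_split[OF ly solves_on_integrable(2)[OF s]] by (simp only: set_integral_Icc_reflect[of l Y])
  have 2: "(LINT x:{0..}|lborel. \<bar>soliton p x\<bar> powr p) = (LINT x:{0..Y}|lborel. \<bar>soliton p x\<bar> powr p)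
     + (LINT x:{0..}|lborel. \<bar>soliton p (x + Y)\<bar> powr p)"
    using set_integral_Ici_split[OF Y(1) soliton_shift_integrable(2)[of 0, simplified]]
    by (simp only: set_integral_Ici_shift[of Y])
  note 3 = solves_on_small(3,4)[OF ly(1) solves_on_subset[OF s ly(2)]]
  have 3: "0 \<le> (LINT x:{0..l-Y}|lborel. \<bar>u x\<bar> powr p)"
      "(LINT x:{0..l-Y}|lborel. \<bar>u x\<bar> powr p) \<le> v (l - Y) * u (l - Y) - v 0 * u 0"
    using B(1) small(1) Y by (intro 3; force)+
  note 4 = soliton_shift_small(3,4)[OF Y(1) small(2)]
  have cu: "continuous_on {0..Y} (\<lambda>y. u (l - y))"
    using Y by (intro continuous_on_compose2[OF solves_on_continuous(1)[OF s]] continuous_intros) auto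
  have i1: "set_integrable lborel {0..Y} (\<lambda>y. \<bar>u (l - y)\<bar> powr p)"
    by (intro borel_integrable_atLeastAtMost' powr_abs_continuous_on cu)
  have i2: "set_integrable lborel {0..Y} (\<lambda>y. \<bar>soliton p y\<bar> powr p)"
    by (intro borel_integrable_atLeastAtMost' powr_abs_continuous_on soliton_continuous[OF p])
  have "\<bar>LINT y:{0..Y}|lborel. \<bar>u (l - y)\<bar> powr p - \<bar>soliton p y\<bar> powr p\<bar>
     \<le> (LINT y:{0..Y}|lborel. \<bar>\<bar>u (l - y)\<bar> powr p - \<bar>soliton p y\<bar> powr p\<bar>)"
    using set_integral_norm_bound[OF set_integral_diff(1)[OF i1 i2]] by simp
  also have "\<dots> \<le> (LINT y:{0..Y}|lborel. p * B powr (p - 1) * \<kappa>)"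
  proof (rule set_integral_mono)
    show "set_integrable lborel {0..Y} (\<lambda>y. \<bar>\<bar>u (l - y)\<bar> powr p - \<bar>soliton p y\<bar> powr p\<bar>)"
      by (intro set_integrable_abs set_integral_diff(1) i1 i2)
    show "set_integrable lborel {0..Y} (\<lambda>y. p * B powr (p - 1) * \<kappa>)"
      by (intro borel_integrable_atLeastAtMost' continuous_intros)
    fix y assume y: "y \<in> {0..Y}"
    have "\<bar>(u (l - y)) powr p - (soliton p y) powr p\<bar> \<le> p * B powr (p - 1) * \<bar>u (l - y) - soliton p y\<bar>"
      using p B(1)[of "l - y"] B(2) soliton_pos[OF p, of y] soliton_le_peak[OF p, of y] y Y
      by (intro powr_lipschitz) auto
    also have "\<dots> \<le> p * B powr (p - 1) * \<kappa>" using close[of y] y p by (intro mult_left_mono) auto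
    finally show "\<bar>\<bar>u (l - y)\<bar> powr p - \<bar>soliton p y\<bar> powr p\<bar> \<le> p * B powr (p - 1) * \<kappa>"
      using B(1)[of "l - y"] soliton_pos[OF p, of y] y Y by simp
  qed
  also have "\<dots> = Y * (p * B powr (p - 1) * \<kappa>)"
    by (rule set_integral_const_Icc[OF Y(1)])
  finally have "\<bar>(LINT y:{0..Y}|lborel. \<bar>u (l - y)\<bar> powr p) - (LINT y:{0..Y}|lborel. \<bar>soliton p y\<bar> powr p)\<bar>
     \<le> Y * (p * B powr (p - 1) * \<kappa>)"
    by (simp only: set_integral_diff(2)[OF i1 i2])
  thus ?thesis using 1 2 3 4 by linarith
qed

end

section \<open>Shooting\<close>

lemma deriv_le_imp_growth_le:
  fixes f :: "real \<Rightarrow> real"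
  assumes "a \<le> b" "\<And>x. a \<le> x \<Longrightarrow> x \<le> b \<Longrightarrow> (f has_real_derivative f' x) (at x)"
    and "\<And>x. a \<le> x \<Longrightarrow> x \<le> b \<Longrightarrow> f' x \<le> c"
  shows "f b \<le> f a + c * (b - a)"
proof -
  have "f b - c * b \<le> f a - c * a"
    by (rule DERIV_nonpos_imp_nonincreasing[OF assms(1)])
      (use assms(2,3) in \<open>auto intro!: exI derivative_eq_intros\<close>)
  thus ?thesis by (simp add: algebra_simps)
qed

lemma deriv_ge_imp_growth_ge:
  fixes f :: "real \<Rightarrow> real"
  assumes "a \<le> b" "\<And>x. a \<le> x \<Longrightarrow> x \<le> b \<Longrightarrow> (f has_real_derivative f' x) (at x)"
    and "\<And>x. a \<le> x \<Longrightarrow> x \<le> b \<Longrightarrow> c \<le> f' x"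
  shows "f a + c * (b - a) \<le> f b"
proof -
  have "- f b \<le> - f a + (- c) * (b - a)"
    by (rule deriv_le_imp_growth_le[OF assms(1), of _ "\<lambda>x. - f' x"])
      (use assms(2,3) in \<open>auto intro!: derivative_eq_intros\<close>)
  thus ?thesis by simp
qed

text \<open>m is the infimum of the parameters whose function is nonpositive somewhere. Positivity
  on a compact interval is stable under uniformly small changes, so the infimum has the property
  itself; nonnegativity at m is inherited from the parameters below it.\<close>

lemma first_touching:
  fixes V :: "real \<Rightarrow> real \<Rightarrow> real"
  assumes m01: "m0 \<le> m1" and l: "0 \<le> l"
    and pos: "\<And>x. x \<in> {0..l} \<Longrightarrow> 0 < V m0 x"
    and neg: "\<exists>x\<in>{0..l}. V m1 x \<le> 0"
    and cont: "\<And>m. m \<in> {m0..m1} \<Longrightarrow> continuous_on {0..l} (V m)"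
    and unif: "\<And>m e. m \<in> {m0..m1} \<Longrightarrow> 0 < e \<Longrightarrow>
        \<exists>d>0. \<forall>m'\<in>{m0..m1}. \<bar>m' - m\<bar> < d \<longrightarrow> (\<forall>x\<in>{0..l}. \<bar>V m' x - V m x\<bar> < e)"
  obtains m where "m0 < m" "m \<le> m1" "\<And>x. x \<in> {0..l} \<Longrightarrow> 0 \<le> V m x" "\<exists>x\<in>{0..l}. V m x = 0"
proof -
  define K where "K = {m\<in>{m0..m1}. \<exists>x\<in>{0..l}. V m x \<le> 0}"
  define m where "m = Inf K"
  have m1K: "m1 \<in> K" using m01 neg by (auto simp: K_def)
  have bdd: "bdd_below K" by (rule bdd_belowI[of _ m0]) (auto simp: K_def)
  have "m \<le> m1" unfolding m_def by (rule cInf_lower[OF m1K bdd])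
  have "m0 \<le> m" unfolding m_def using m1K by (intro cInf_greatest) (auto simp: K_def)
  hence m: "m \<in> {m0..m1}" using \<open>m \<le> m1\<close> by simp
  have below: "0 < V m' x" if "m0 \<le> m'" "m' < m" "x \<in> {0..l}" for m' x
  proof -
    have "m' \<notin> K" using cInf_lower[OF _ bdd, of m'] that by (auto simp: m_def)
    thus ?thesis using that \<open>m \<le> m1\<close> by (force simp: K_def)
  qed
  have "m \<in> K"
  proof (rule ccontr)
    assume "m \<notin> K"
    hence p: "0 < V m x" if "x \<in> {0..l}" for x using that m by (force simp: K_def)
    obtain x0 where x0: "x0 \<in> {0..l}" "\<And>x. x \<in> {0..l} \<Longrightarrow> V m x0 \<le> V m x"
      using continuous_attains_inf[of "{0..l}" "V m"] cont[OF m] l by auto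
    obtain d where d: "d > 0" "\<And>m' x. m' \<in> {m0..m1} \<Longrightarrow> \<bar>m' - m\<bar> < d \<Longrightarrow> x \<in> {0..l} \<Longrightarrow> \<bar>V m' x - V m x\<bar> < V m x0"
      using unif[OF m p[OF x0(1)]] by blast
    obtain k where k: "k \<in> K" "k < m + d"
      using cInf_lessD[of K "m + d"] m1K d(1) by (auto simp: m_def)
    hence "m \<le> k" using cInf_lower[OF k(1) bdd] by (simp add: m_def)
    obtain x where x: "x \<in> {0..l}" "V k x \<le> 0" using k by (auto simp: K_def)
    have "\<bar>V k x - V m x\<bar> < V m x0" using k \<open>m \<le> k\<close> x by (intro d) (auto simp: K_def)
    thus False using x x0(2)[of x] by linarith
  qed
  then obtain x0 where x0: "x0 \<in> {0..l}" "V m x0 \<le> 0" by (auto simp: K_def)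
  hence "m \<noteq> m0" using pos[of x0] by auto
  hence "m0 < m" using \<open>m0 \<le> m\<close> by simp
  have nonneg: "0 \<le> V m x" if x: "x \<in> {0..l}" for x
  proof (rule ccontr)
    assume n: "\<not> 0 \<le> V m x"
    obtain d where d: "d > 0" "\<And>m'. m' \<in> {m0..m1} \<Longrightarrow> \<bar>m' - m\<bar> < d \<Longrightarrow> \<bar>V m' x - V m x\<bar> < - V m x"
      using unif[OF m, of "- V m x"] n x by force
    \<comment> \<open>A parameter strictly below m, within distance d and still at least
      \<open>m0\<close>, where positivity is known.\<close>
    define m' where "m' = max m0 (m - d / 2)"
    have "m0 \<le> m'" "m' < m" "\<bar>m' - m\<bar> < d" using d(1) \<open>m0 < m\<close> by (auto simp: m'_def)
    thus False using d(2)[of m'] below[of m' x] x \<open>m \<le> m1\<close> by auto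
  qed
  show ?thesis using that[of m] \<open>m0 < m\<close> \<open>m \<le> m1\<close> nonneg x0 by force
qed

text \<open>Cutting the force off outside \<open>[0, B]\<close> makes it globally Lipschitz; trajectories that stay
  in \<open>[0, B]\<close> solve the original equation.\<close>

definition trunc_lip :: "real \<Rightarrow> real \<Rightarrow> real" where
  "trunc_lip p B = 1 + (1 + (p - 1) * B powr (p - 2))"

definition trunc_solution :: "real \<Rightarrow> real \<Rightarrow> (real \<Rightarrow> real) \<Rightarrow> (real \<Rightarrow> real) \<Rightarrow> bool" where
  "trunc_solution p B u v \<longleftrightarrow> (\<forall>t\<ge>0. (u has_real_derivative v t) (at t) \<and>
     (v has_real_derivative nlforce p (clip B (u t))) (at t))"

section \<open>Trajectories of the truncated equation: decaying family, turning and touching\<close>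

context
  fixes p :: real
  assumes p: "p > 2"
begin

lemma trunc_flow_exists:
  assumes B: "0 \<le> B"
  obtains U V :: "real \<Rightarrow> real \<Rightarrow> real \<Rightarrow> real"
  where "\<And>a b. U a b 0 = a" "\<And>a b. V a b 0 = b" "\<And>a b. trunc_solution p B (U a b) (V a b)"
proof -
  have "\<exists>u v. u 0 = a \<and> v 0 = b \<and> trunc_solution p B u v" for a b
    unfolding trunc_solution_def
    by (rule second_order_ivp[of "1 + (p - 1) * B powr (p - 2)"])
       (use nlforce_lipschitz[OF p B] p in auto)
  then obtain U V where "\<And>a b. U a b 0 = a \<and> V a b 0 = b \<and> trunc_solution p B (U a b) (V a b)" by metis
  thus ?thesis using that by blast
qed

lemma trunc_solutionD:
  assumes "trunc_solution p B u v" "0 \<le> t"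
  shows "(u has_real_derivative v t) (at t)" "(v has_real_derivative nlforce p (clip B (u t))) (at t)"
  using assms by (auto simp: trunc_solution_def)

lemma trunc_solution_continuous:
  assumes "trunc_solution p B u v"
  shows "continuous_on {0..l} u" "continuous_on {0..l} v"
  by (rule DERIV_continuous_on, rule has_field_derivative_at_within, rule trunc_solutionD[OF assms]; simp)+

lemma trunc_solution_gronwall:
  assumes B: "0 \<le> B" and "trunc_solution p B u1 v1" "trunc_solution p B u2 v2" and t: "0 \<le> t" "t \<le> T"
  shows "\<bar>u1 t - u2 t\<bar> \<le> exp (trunc_lip p B * T) * (\<bar>u1 0 - u2 0\<bar> + \<bar>v1 0 - v2 0\<bar>)"
    and "\<bar>v1 t - v2 t\<bar> \<le> exp (trunc_lip p B * T) * (\<bar>u1 0 - u2 0\<bar> + \<bar>v1 0 - v2 0\<bar>)"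
proof -
  have K: "0 \<le> 1 + (p - 1) * B powr (p - 2)" using p by simp
  note G = second_order_gronwall[OF K, of "\<lambda>u. nlforce p (clip B u)" T, OF nlforce_lipschitz[OF p B]
      trunc_solutionD(1)[OF assms(2)] trunc_solutionD(2)[OF assms(2)]
      trunc_solutionD(1)[OF assms(3)] trunc_solutionD(2)[OF assms(3)] t]
  have "exp (trunc_lip p B * t) \<le> exp (trunc_lip p B * T)"
    using K t by (auto simp: trunc_lip_def intro!: mult_left_mono)
  hence "exp (trunc_lip p B * t) * (\<bar>u1 0 - u2 0\<bar> + \<bar>v1 0 - v2 0\<bar>) \<le> exp (trunc_lip p B * T) * (\<bar>u1 0 - u2 0\<bar> + \<bar>v1 0 - v2 0\<bar>)"
    by (intro mult_right_mono) auto
  thus "\<bar>u1 t - u2 t\<bar> \<le> exp (trunc_lip p B * T) * (\<bar>u1 0 - u2 0\<bar> + \<bar>v1 0 - v2 0\<bar>)"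
    and "\<bar>v1 t - v2 t\<bar> \<le> exp (trunc_lip p B * T) * (\<bar>u1 0 - u2 0\<bar> + \<bar>v1 0 - v2 0\<bar>)"
    using G unfolding trunc_lip_def by linarith+
qed

lemma trunc_solution_zero: "trunc_solution p B (\<lambda>_. 0) (\<lambda>_. 0)"
proof -
  have "clip B 0 = 0" by (simp add: clip_def)
  thus ?thesis by (simp add: trunc_solution_def)
qed

lemma trunc_solution_solves_on:
  assumes "trunc_solution p B u v" "\<And>x. 0 \<le> x \<Longrightarrow> x \<le> l \<Longrightarrow> 0 \<le> u x \<and> u x \<le> B"
  shows "solves_on p l u v"
  unfolding solves_on_def
proof (intro ballI)
  fix x assume "x \<in> {0..l}"
  thus "(u has_real_derivative v x) (at x) \<and> (v has_real_derivative nlforce p (u x)) (at x)"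
    using trunc_solutionD[OF assms(1), of x] assms(2)[of x] by (simp add: clip_id)
qed

text \<open>With the cut-off \<open>B = 1\<close> the force is nonnegative, hence all trajectories starting at rest are
  nondecreasing. Choosing \<open>m1\<close> minimal keeps the end value below \<open>\<delta>\<close> for all \<open>m \<le> m1\<close>.\<close>

lemma decaying_family:
  assumes l: "0 < l" and \<delta>: "0 < \<delta>" "\<delta> < 1"
  obtains W W' :: "real \<Rightarrow> real \<Rightarrow> real" and m1
  where "0 < m1" "continuous_on {0..m1} (\<lambda>m. W m l)" "continuous_on {0..m1} (\<lambda>m. W' m l)"
    and "W 0 l = 0" "W' 0 l = 0" "W m1 l = \<delta>"
    and "\<forall>m. 0 < m \<and> m \<le> m1 \<longrightarrow> solves_on p l (W m) (W' m) \<and> W' m 0 = 0 \<and>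
      (\<forall>x. 0 \<le> x \<and> x \<le> l \<longrightarrow> 0 < W m x \<and> W m x \<le> W m l \<and> W m x \<le> \<delta>) \<and>
      (\<forall>x. 0 < x \<and> x \<le> l \<longrightarrow> 0 < W' m x)"
proof -
  obtain U V where U0: "\<And>a b. U a b 0 = a" and V0: "\<And>a b. V a b 0 = b"
    and UV: "\<And>a b. trunc_solution p 1 (U a b) (V a b)"
    using trunc_flow_exists[of 1] by auto
  define W W' where "W m = U m 0" and "W' m = V m 0" for m
  have W0: "W m 0 = m" "W' m 0 = 0" for m by (auto simp: W_def W'_def U0 V0)
  have sol: "trunc_solution p 1 (W m) (W' m)" for m unfolding W_def W'_def by (rule UV)
  note D = trunc_solutionD[OF sol]
  have g: "0 \<le> nlforce p (clip 1 u)" for u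
    by (rule nlforce_nonneg[OF p]) (auto simp: clip_def)
  have W'_nonneg: "0 \<le> W' m x" if "0 \<le> x" for m x
    using deriv_ge_imp_growth_ge[OF that, of "W' m" "\<lambda>x. nlforce p (clip 1 (W m x))" 0] D(2) g by (simp add: W0)
  have W_mono: "W m x \<le> W m y" if "0 \<le> x" "x \<le> y" for m x y
    using deriv_ge_imp_growth_ge[OF that(2), of "W m" "W' m" 0] D(1) W'_nonneg that by auto
  have lip: "\<bar>W m x - W m' x\<bar> \<le> exp (trunc_lip p 1 * l) * \<bar>m - m'\<bar>"
    "\<bar>W' m x - W' m' x\<bar> \<le> exp (trunc_lip p 1 * l) * \<bar>m - m'\<bar>" if "0 \<le> x" "x \<le> l" for m m' x
    using trunc_solution_gronwall[OF _ sol[of m] sol[of m'] that] by (auto simp: W0)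
  have cW: "continuous_on UNIV (\<lambda>m. W m l)"
    by (rule lipschitz_on_continuous_on[of "exp (trunc_lip p 1 * l)"], rule lipschitz_onI)
       (use lip(1) l in \<open>auto simp: dist_real_def\<close>)
  have cW': "continuous_on UNIV (\<lambda>m. W' m l)"
    by (rule lipschitz_on_continuous_on[of "exp (trunc_lip p 1 * l)"], rule lipschitz_onI)
       (use lip(2) l in \<open>auto simp: dist_real_def\<close>)
  have z: "W 0 l = 0" "W' 0 l = 0"
    using trunc_solution_gronwall[OF _ sol[of 0] trunc_solution_zero, of l l] l by (auto simp: W0)
  \<comment> \<open>The starting values whose trajectory reaches exactly \<open>\<delta>\<close> at
    time l; compactness provides the smallest one.\<close>
  define S where "S = {m\<in>{0..\<delta>}. W m l = \<delta>}"
  have "\<exists>m\<ge>0. m \<le> \<delta> \<and> W m l = \<delta>"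
    using W_mono[of 0 l \<delta>] l \<delta> by (intro IVT') (auto simp: z W0 intro: continuous_on_subset[OF cW])
  hence "S \<noteq> {}" by (auto simp: S_def)
  moreover have "compact S"
  proof -
    have "closed ({0..\<delta>} \<inter> (\<lambda>m. W m l) -` {\<delta>})"
      by (intro continuous_closed_preimage continuous_on_subset[OF cW]) auto
    moreover have "S = {0..\<delta>} \<inter> ({0..\<delta>} \<inter> (\<lambda>m. W m l) -` {\<delta>})" by (auto simp: S_def)
    ultimately show ?thesis using compact_Int_closed[of "{0..\<delta>}"] by (metis compact_Icc)
  qed
  ultimately obtain m1 where m1: "m1 \<in> S" "\<And>m. m \<in> S \<Longrightarrow> m1 \<le> m"
    using compact_attains_inf[of S] by auto
  have m1': "W m1 l = \<delta>" "0 \<le> m1" "m1 \<le> \<delta>" using m1 by (auto simp: S_def)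
  \<comment> \<open>A larger end value would, by the intermediate value theorem from W 0 l = 0,
    produce an element of S below m, contradicting the minimality of \<open>m1\<close>.\<close>
  have le: "W m l \<le> \<delta>" if "0 < m" "m \<le> m1" for m
  proof (rule ccontr)
    assume n: "\<not> W m l \<le> \<delta>"
    have "\<exists>m'\<ge>0. m' \<le> m \<and> W m' l = \<delta>"
      using n \<delta> that by (intro IVT') (auto simp: z intro: continuous_on_subset[OF cW])
    then obtain m' where "0 \<le> m'" "m' \<le> m" "W m' l = \<delta>" by blast
    moreover from this have "m1 \<le> m'" using m1 that m1' by (intro m1(2)) (auto simp: S_def)
    ultimately have "m' = m" using that by simp
    thus False using n \<open>W m' l = \<delta>\<close> by simp
  qed
  have range: "0 < W m x \<and> W m x \<le> W m l \<and> W m x \<le> \<delta>" if "0 < m" "m \<le> m1" "0 \<le> x" "x \<le> l" for m x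
    using W_mono[of 0 x m] W_mono[of x l m] le[of m] that by (auto simp: W0)
  show ?thesis
  proof
    show "0 < m1" using m1' z \<delta> by (cases "m1 = 0") auto
    show "continuous_on {0..m1} (\<lambda>m. W m l)" "continuous_on {0..m1} (\<lambda>m. W' m l)"
      by (auto intro: continuous_on_subset[OF cW] continuous_on_subset[OF cW'])
    show "W 0 l = 0" "W' 0 l = 0" "W m1 l = \<delta>" by (fact z m1')+
    show "\<forall>m. 0 < m \<and> m \<le> m1 \<longrightarrow> solves_on p l (W m) (W' m) \<and> W' m 0 = 0 \<and>
      (\<forall>x. 0 \<le> x \<and> x \<le> l \<longrightarrow> 0 < W m x \<and> W m x \<le> W m l \<and> W m x \<le> \<delta>) \<and>
      (\<forall>x. 0 < x \<and> x \<le> l \<longrightarrow> 0 < W' m x)"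
    proof (intro allI impI, elim conjE)
      fix m assume m: "0 < m" "m \<le> m1"
      have s: "solves_on p l (W m) (W' m)"
        by (rule trunc_solution_solves_on[OF sol]) (use range[OF m] \<delta> in force)
      have "0 < W' m x" if x: "0 < x" "x \<le> l" for x
      proof -
        have "W' m 0 < W' m x"
        proof (rule DERIV_pos_imp_increasing[OF x(1)])
          fix y assume y: "0 \<le> y" "y \<le> x"
          have "0 < nlforce p (W m y)" using range[OF m, of y] y x \<delta> by (intro nlforce_pos[OF p]) auto
          thus "\<exists>d. (W' m has_real_derivative d) (at y) \<and> 0 < d"
            using solves_onD(2)[OF s, of y] y x by auto
        qed
        thus ?thesis by (simp add: W0)
      qed
      thus "solves_on p l (W m) (W' m) \<and> W' m 0 = 0 \<and>
        (\<forall>x. 0 \<le> x \<and> x \<le> l \<longrightarrow> 0 < W m x \<and> W m x \<le> W m l \<and> W m x \<le> \<delta>) \<and>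
        (\<forall>x. 0 < x \<and> x \<le> l \<longrightarrow> 0 < W' m x)"
        using s range[OF m] W0(2) by blast
    qed
  qed
qed

text \<open>Suppose v stays positive. While u lies in [delta, r], its potential is at least that at
  delta, so by energy conservation v does not fall below its initial value, and u has passed r by
  time \<open>t1\<close>. From then on the force is at most \<open>nlforce p r\<close> < 0, and the
  velocity, by then at most c1 \<open>\<delta>\<close> + \<open>t1\<close>, is used up within time
  \<open>t2\<close>.\<close>

lemma trajectory_turns:
  assumes sol: "trunc_solution p B u v" and B: "r \<le> B"
    and \<delta>: "0 < \<delta>" "\<delta> < 1" and r: "1 < r" "\<delta>\<^sup>2 < potential p r"
    and init: "u 0 = \<delta>" "c0 * \<delta> \<le> v 0" "v 0 \<le> c1 * \<delta>" and c0: "0 < c0"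
  defines "t1 \<equiv> r / (c0 * \<delta>)"
  defines "t2 \<equiv> (c1 * \<delta> + t1) / - nlforce p r"
  assumes l: "t1 + t2 \<le> l"
  shows "\<exists>x\<in>{0..l}. v x \<le> 0"
proof (rule ccontr)
  assume "\<not> (\<exists>x\<in>{0..l}. v x \<le> 0)"
  hence pos: "0 < v x" if "0 \<le> x" "x \<le> l" for x using that by force
  note D = trunc_solutionD[OF sol]
  have c0\<delta>: "0 < c0 * \<delta>" using c0 \<delta> by simp
  have t1: "0 < t1" using r c0\<delta> by (simp add: t1_def)
  have nr: "nlforce p r < 0" by (rule nlforce_neg[OF p r(1)])
  have "0 \<le> c1 * \<delta>" using init c0\<delta> by linarith
  hence t2: "0 \<le> t2" unfolding t2_def using nr t1 by (intro divide_nonneg_pos) auto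
  have mono: "u x \<le> u y" if "0 \<le> x" "x \<le> y" "y \<le> l" for x y
    using deriv_ge_imp_growth_ge[OF that(2), of u v 0] D(1) pos that by (force intro: less_imp_le)
  have speed: "c0 * \<delta> \<le> v t" if t: "0 \<le> t" "t \<le> l" "u t \<le> r" for t
  proof -
    have range: "\<delta> \<le> u x \<and> u x \<le> r" if "0 \<le> x" "x \<le> t" for x
      using mono[of 0 x] mono[of x t] that t init by auto
    have "solves_on p t u v"
      by (rule trunc_solution_solves_on[OF sol]) (use range \<delta> B in force)
    hence e: "(v t)\<^sup>2 - potential p (u t) = (v 0)\<^sup>2 - potential p (u 0)"
      by (rule solves_on_energy[OF p]) (use range \<delta> t in force)+
    \<comment> \<open>The potential is not monotone on this range: up to 1 it increases, and beyond
      1 it is still at least its value at r, which exceeds \<open>\<delta>\<^sup>2\<close>.\<close>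
    have "potential p \<delta> \<le> potential p (u t)"
    proof (cases "u t \<le> 1")
      case True
      thus ?thesis using range[of t] t \<delta> by (intro potential_mono[OF p]) auto
    next
      case False
      have "potential p \<delta> \<le> \<delta>\<^sup>2" by (rule potential_le_square[OF p])
      also have "\<dots> \<le> potential p r" using r by simp
      also have "\<dots> \<le> potential p (u t)" using False t by (intro potential_antimono[OF p]) auto
      finally show ?thesis .
    qed
    hence "(v 0)\<^sup>2 \<le> (v t)\<^sup>2" using e init by simp
    hence "v 0 \<le> v t" using pos[of t] t by (intro power2_le_imp_le[of "v 0" "v t"]) auto
    thus ?thesis using init by linarith
  qed
  have ut1: "r < u t1"
  proof (rule ccontr)
    assume "\<not> r < u t1"
    hence "c0 * \<delta> \<le> v x" if "0 \<le> x" "x \<le> t1" for x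
      using mono[of x t1] that t2 l by (intro speed) auto
    hence "u 0 + c0 * \<delta> * (t1 - 0) \<le> u t1"
      using t1 D(1) by (intro deriv_ge_imp_growth_ge) auto
    moreover have "c0 * \<delta> * (t1 - 0) = r" using c0 \<delta> by (simp add: t1_def)
    ultimately show False using \<open>\<not> r < u t1\<close> init \<delta> by simp
  qed
  \<comment> \<open>The force never exceeds 1, so the velocity gains at most
    \<open>t1\<close>.\<close>
  have "v t1 \<le> v 0 + 1 * (t1 - 0)"
    using t1 D(2) by (intro deriv_le_imp_growth_le) (auto intro!: nlforce_le_1[OF p] simp: clip_def)
  hence vt1: "v t1 \<le> c1 * \<delta> + t1" using init by simp
  have "v (t1 + t2) \<le> v t1 + nlforce p r * ((t1 + t2) - t1)"
  proof (rule deriv_le_imp_growth_le)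
    fix x assume x: "t1 \<le> x" "x \<le> t1 + t2"
    show "(v has_real_derivative nlforce p (clip B (u x))) (at x)" using x t1 by (intro D) auto
    have "r \<le> clip B (u x)"
      using mono[of t1 x] x t1 l ut1 B by (auto simp: clip_def)
    thus "nlforce p (clip B (u x)) \<le> nlforce p r"
      using r by (intro nlforce_antimono[OF p]) auto
  qed (use t2 in auto)
  also have "nlforce p r * ((t1 + t2) - t1) = - (c1 * \<delta> + t1)" using nr by (simp add: t2_def field_simps)
  finally have "v (t1 + t2) \<le> 0" using vt1 by simp
  thus False using pos[of "t1 + t2"] t1 t2 l by auto
qed

text \<open>Gronwall's inequality against the zero solution keeps u below 1 up to time l; there the
  force is nonnegative, so v cannot drop below its positive initial value.\<close>

lemma small_trajectory_grows:
  assumes sol: "trunc_solution p B u v" and B: "0 \<le> B"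
    and init: "0 < u 0" "0 < v 0" "exp (trunc_lip p B * l) * (u 0 + v 0) \<le> 1"
    and x: "0 \<le> x" "x \<le> l"
  shows "0 < v x"
proof -
  have "u y \<le> 1" if "0 \<le> y" "y \<le> x" for y
    using trunc_solution_gronwall(1)[OF B sol trunc_solution_zero, of y l] that x init by auto
  hence "0 \<le> nlforce p (clip B (u y))" if "0 \<le> y" "y \<le> x" for y
    using that by (intro nlforce_nonneg[OF p]) (force simp: clip_def)+
  hence "v 0 + 0 * (x - 0) \<le> v x"
    using trunc_solutionD(2)[OF sol] x
    by (intro deriv_ge_imp_growth_ge[of _ _ _ "\<lambda>y. nlforce p (clip B (u y))"]) auto
  thus ?thesis using init by simp
qed

text \<open>The energy lies between \<open>- \<delta>\<^sup>2\<close> and (c1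
  \<open>\<delta>\<close>)^2. Reaching \<open>peak p + \<eta>\<close> would make v^2 negative. At a
  zero of v necessarily u > 1, since otherwise the force would have been nonnegative so far; the
  potential there is at most \<open>\<delta>\<^sup>2\<close>, which puts u above
  \<open>peak p - \<eta>\<close>. The force is then negative, so v would become negative right after
  an interior zero.\<close>

lemma touching_trajectory:
  assumes \<eta>: "0 < \<eta>" "\<eta> < 1" "1 < peak p - \<eta>"
    and sol: "trunc_solution p (peak p + 1) u v"
    and init: "0 < u 0" "u 0 \<le> \<delta>" "0 < v 0" "v 0 \<le> c1 * \<delta>"
    and \<delta>: "\<delta> < 1" "(c1 * \<delta>)\<^sup>2 < - potential p (peak p + \<eta>)" "\<delta>\<^sup>2 < potential p (peak p - \<eta>)"
    and nonneg: "\<And>x. 0 \<le> x \<Longrightarrow> x \<le> l \<Longrightarrow> 0 \<le> v x"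
    and touch: "0 \<le> x0" "x0 \<le> l" "v x0 = 0"
  shows "solves_on p l u v" "\<And>x. 0 \<le> x \<Longrightarrow> x < l \<Longrightarrow> 0 < v x" "v l = 0"
    and "\<And>x. 0 \<le> x \<Longrightarrow> x \<le> l \<Longrightarrow> 0 < u x \<and> u x \<le> peak p + \<eta>" "peak p - \<eta> \<le> u l"
proof -
  note D = trunc_solutionD[OF sol]
  have mono: "u x \<le> u y" if "0 \<le> x" "x \<le> y" "y \<le> l" for x y
    using deriv_ge_imp_growth_ge[OF that(2), of u v 0] D(1) nonneg that by force
  have pos: "0 < u x" if "0 \<le> x" "x \<le> l" for x using mono[of 0 x] that init by auto
  have "(u 0)\<^sup>2 \<le> \<delta>\<^sup>2" using init by (intro power_mono) auto
  hence u0': "potential p (u 0) \<le> \<delta>\<^sup>2" by (rule order_trans[OF potential_le_square[OF p]])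
  have u0: "0 \<le> potential p (u 0)"
    using potential_mono[OF p, of 0 "u 0"] init \<delta> by (simp add: potential_0[OF p])
  note u0 = u0 u0'
  have v0: "(v 0)\<^sup>2 \<le> (c1 * \<delta>)\<^sup>2" using init by (intro power_mono) auto
  have upper: "u t \<le> peak p + \<eta>" if t: "0 \<le> t" "t \<le> l" for t
  proof (rule ccontr)
    assume n: "\<not> u t \<le> peak p + \<eta>"
    have "\<exists>t'\<ge>0. t' \<le> t \<and> u t' = peak p + \<eta>"
      using n t init \<delta> \<eta> trunc_solution_continuous(1)[OF sol] by (intro IVT') auto
    then obtain t' where t': "0 \<le> t'" "t' \<le> t" "u t' = peak p + \<eta>" by blast
    have "solves_on p t' u v"
      by (rule trunc_solution_solves_on[OF sol]) (use mono[of _ t'] pos t t' \<eta> in force)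
    hence "(v t')\<^sup>2 - potential p (u t') = (v 0)\<^sup>2 - potential p (u 0)"
      by (rule solves_on_energy[OF p]) (use pos t t' in auto)
    thus False using u0 v0 \<delta> zero_le_power2[of "v t'"] unfolding t'(3) by linarith
  qed
  show sol': "solves_on p l u v"
    by (rule trunc_solution_solves_on[OF sol]) (use pos upper \<eta> in force)
  show "0 < u x \<and> u x \<le> peak p + \<eta>" if "0 \<le> x" "x \<le> l" for x using pos upper that by auto
  have zero: "peak p - \<eta> < u y \<and> y = l" if y: "0 \<le> y" "y \<le> l" "v y = 0" for y
  proof -
    have "1 < u y"
    proof (rule ccontr)
      assume n: "\<not> 1 < u y"
      have "0 \<le> nlforce p (u z)" if "0 \<le> z" "z \<le> y" for z
        using mono[of z y] pos[of z] n that y by (intro nlforce_nonneg[OF p]) auto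
      hence "v 0 + 0 * (y - 0) \<le> v y"
        using solves_onD(2)[OF sol'] y
        by (intro deriv_ge_imp_growth_ge[of _ _ _ "\<lambda>z. nlforce p (u z)"]) auto
      thus False using y init by simp
    qed
    have "(v y)\<^sup>2 - potential p (u y) = (v 0)\<^sup>2 - potential p (u 0)"
      by (rule solves_on_energy[OF p sol']) (use pos y in auto)
    moreover have "(v y)\<^sup>2 = 0" using y by simp
    ultimately have "potential p (u y) \<le> \<delta>\<^sup>2" using u0 zero_le_power2[of "v 0"] by linarith
    hence 1: "peak p - \<eta> < u y"
      using potential_antimono[OF p, of "u y" "peak p - \<eta>"] \<open>1 < u y\<close> \<delta> by force
    have "y = l"
    proof (rule ccontr)
      assume "y \<noteq> l"
      have "nlforce p (u y) < 0" by (rule nlforce_neg[OF p \<open>1 < u y\<close>])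
      then obtain d where d: "d > 0" "\<And>h. 0 < h \<Longrightarrow> h < d \<Longrightarrow> v (y + h) < v y"
        using DERIV_neg_dec_right[OF solves_onD(2)[OF sol' y(1,2)]] by blast
      define h where "h = min (d / 2) (l - y)"
      have "0 < h" "h < d" "y + h \<le> l" using d \<open>y \<noteq> l\<close> y by (auto simp: h_def)
      thus False using d(2)[of h] nonneg[of "y + h"] y by auto
    qed
    thus ?thesis using 1 by blast
  qed
  show "v l = 0" "peak p - \<eta> \<le> u l" using zero[OF touch] touch by auto
  show "0 < v x" if "0 \<le> x" "x < l" for x
    using nonneg[of x] zero[of x] that by (cases "v x = 0") auto
qed

text \<open>The existential over T stands in front because the functions \<open>s\<close> and
  \<open>b\<close> change with l; T is built from \<open>\<delta>\<close>, \<open>\<eta>\<close>, c0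
  and c1 alone (and p). The parameter is the first at which v touches zero on [0, l].\<close>

lemma growing_edge:
  assumes \<eta>: "0 < \<eta>" "\<eta> < 1" "1 < peak p - \<eta>" and c: "0 < c0"
    and \<delta>: "0 < \<delta>" "\<delta> < 1" "(c1 * \<delta>)\<^sup>2 < - potential p (peak p + \<eta>)" "\<delta>\<^sup>2 < potential p (peak p - \<eta>)"
  shows "\<exists>T. \<forall>l (m1 :: real) s b. T \<le> l \<longrightarrow> 0 < l \<longrightarrow> 0 < m1 \<longrightarrow>
      continuous_on {0..m1} s \<longrightarrow> continuous_on {0..m1} b \<longrightarrow> s 0 = 0 \<longrightarrow> s m1 = \<delta> \<longrightarrow>
      (\<forall>m. 0 < m \<and> m \<le> m1 \<longrightarrow> 0 < s m \<and> s m \<le> \<delta> \<and> c0 * s m \<le> b m \<and> b m \<le> c1 * s m) \<longrightarrow>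
      (\<exists>m u v. 0 < m \<and> m \<le> m1 \<and> u 0 = s m \<and> v 0 = b m \<and> solves_on p l u v \<and>
        (\<forall>x. 0 \<le> x \<and> x < l \<longrightarrow> 0 < v x) \<and> v l = 0 \<and>
        (\<forall>x. 0 \<le> x \<and> x \<le> l \<longrightarrow> 0 < u x \<and> u x \<le> peak p + \<eta>) \<and> peak p - \<eta> \<le> u l)"
proof -
  define r where "r = peak p - \<eta>"
  \<comment> \<open>The cut-off lies above \<open>peak p + \<eta>\<close>, hence is never met by the
    trajectory finally selected.\<close>
  define B where "B = peak p + 1"
  have B: "0 \<le> B" "r \<le> B" using peak_gt_1[OF p] \<eta> by (auto simp: B_def r_def)
  obtain U V where U0: "\<And>a b. U a b 0 = a" and V0: "\<And>a b. V a b 0 = b"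
    and UV: "\<And>a b. trunc_solution p B (U a b) (V a b)"
    using trunc_flow_exists[OF B(1)] by auto
  define t1 where "t1 = r / (c0 * \<delta>)"
  show ?thesis
  proof (rule exI[of _ "t1 + (c1 * \<delta> + t1) / - nlforce p r"], intro allI impI)
    fix l m1 :: real and s b :: "real \<Rightarrow> real"
    assume T: "t1 + (c1 * \<delta> + t1) / - nlforce p r \<le> l" and l: "0 < l" and m1: "0 < m1"
      and cs: "continuous_on {0..m1} s" and cb: "continuous_on {0..m1} b"
      and s0: "s 0 = 0" and sm1: "s m1 = \<delta>"
      and sb': "\<forall>m. 0 < m \<and> m \<le> m1 \<longrightarrow> 0 < s m \<and> s m \<le> \<delta> \<and> c0 * s m \<le> b m \<and> b m \<le> c1 * s m"
    hence sb: "0 < s m \<and> s m \<le> \<delta> \<and> c0 * s m \<le> b m \<and> b m \<le> c1 * s m" if "0 < m" "m \<le> m1" for m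
      using that by blast
    define E where "E = exp (trunc_lip p B * l)"
    have E: "0 < E" by (simp add: E_def)
    have sb': "0 < b m \<and> b m \<le> c1 * \<delta>" if "0 < m" "m \<le> m1" for m
    proof -
      have "0 < c0 * s m" using sb[OF that] c by simp
      hence "0 < b m" using sb[OF that] by linarith
      hence "0 < c1 * s m" using sb[OF that] by linarith
      hence "0 < c1" using sb[OF that] by (simp add: zero_less_mult_iff)
      hence "c1 * s m \<le> c1 * \<delta>" using sb[OF that] by (intro mult_left_mono) auto
      thus ?thesis using \<open>0 < b m\<close> sb[OF that] by linarith
    qed
    have c1: "0 < c1"
      using sb'[of m1] m1 \<delta> by (smt (verit) mult_nonpos_nonneg)
    \<comment> \<open>For fixed l the initial data tend to 0 with m, as s is continuous at 0 and b
      <= c1 s; so they can be made small even against the Gronwall factor E of the whole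
      edge.\<close>
    obtain m0 where m0: "0 < m0" "m0 \<le> m1" "E * (s m0 + b m0) \<le> 1"
    proof -
      have "\<exists>d>0. \<forall>m\<in>{0..m1}. dist m 0 < d \<longrightarrow> dist (s m) (s 0) < 1 / (E * (1 + c1))"
        using cs m1 E c1 unfolding continuous_on_iff by (metis atLeastAtMost_iff less_eq_real_def order_refl add_pos_pos zero_less_one divide_pos_pos mult_pos_pos)
      then obtain d where d: "d > 0" "\<And>m. m \<in> {0..m1} \<Longrightarrow> \<bar>m\<bar> < d \<Longrightarrow> \<bar>s m\<bar> < 1 / (E * (1 + c1))"
        by (auto simp: dist_real_def s0)
      define m where "m = min (d / 2) m1"
      have m: "0 < m" "m \<le> m1" "m < d" using d m1 by (auto simp: m_def)
      have "s m < 1 / (E * (1 + c1))" using d(2)[of m] m by auto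
      hence "s m * (E * (1 + c1)) < 1" using E c1 by (subst (asm) pos_less_divide_eq) auto
      hence "E * ((1 + c1) * s m) \<le> 1" by (simp only: mult_ac less_imp_le)
      moreover have "s m + b m \<le> (1 + c1) * s m" using sb[OF m(1,2)] by (simp add: algebra_simps)
      ultimately have "E * (s m + b m) \<le> 1" using E by (meson mult_left_mono less_imp_le order_trans)
      thus ?thesis using that m by blast
    qed
    define F where "F m = V (s m) (b m)" for m
    obtain m where m: "m0 < m" "m \<le> m1" and Fm: "\<And>x. x \<in> {0..l} \<Longrightarrow> 0 \<le> F m x" "\<exists>x\<in>{0..l}. F m x = 0"
    proof (rule first_touching[of m0 m1 l F])
      show "0 < F m0 x" if "x \<in> {0..l}" for x
        unfolding F_def
        using small_trajectory_grows[OF UV[of "s m0" "b m0"] B(1), of l x] sb[of m0] sb'[of m0] m0 that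
        by (auto simp: U0 V0 E_def)
      show "\<exists>x\<in>{0..l}. F m1 x \<le> 0"
        unfolding F_def
        using \<delta> \<eta> c sb[of m1] m1 sm1 T r_def t1_def
        by (intro trajectory_turns[OF UV[of "s m1" "b m1"] B(2), where \<delta>=\<delta> and ?c0.0=c0 and ?c1.0=c1])
          (auto simp: U0 V0)
      show "continuous_on {0..l} (F m)" for m
        unfolding F_def by (rule trunc_solution_continuous(2)[OF UV])
      \<comment> \<open>Gronwall's inequality turns continuity of the initial data in m into
        continuity of the velocities in m, uniformly on [0, l].\<close>
      fix m e :: real assume m: "m \<in> {m0..m1}" and e: "0 < e"
      have m': "m \<in> {0..m1}" using m m0 by auto
      have e': "0 < e / (2 * E)" using e E by simp
      obtain d1 where d1: "d1 > 0" "\<And>m'. m' \<in> {0..m1} \<Longrightarrow> \<bar>m' - m\<bar> < d1 \<Longrightarrow> \<bar>s m' - s m\<bar> < e / (2 * E)"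
        using cs m' e' unfolding continuous_on_iff dist_real_def by blast
      obtain d2 where d2: "d2 > 0" "\<And>m'. m' \<in> {0..m1} \<Longrightarrow> \<bar>m' - m\<bar> < d2 \<Longrightarrow> \<bar>b m' - b m\<bar> < e / (2 * E)"
        using cb m' e' unfolding continuous_on_iff dist_real_def by blast
      show "\<exists>d>0. \<forall>m'\<in>{m0..m1}. \<bar>m' - m\<bar> < d \<longrightarrow> (\<forall>x\<in>{0..l}. \<bar>F m' x - F m x\<bar> < e)"
      proof (intro exI[of _ "min d1 d2"] conjI ballI impI)
        show "0 < min d1 d2" using d1 d2 by simp
        fix m' x assume m'': "m' \<in> {m0..m1}" "\<bar>m' - m\<bar> < min d1 d2" and x: "x \<in> {0..l}"
        have "\<bar>F m' x - F m x\<bar> \<le> E * (\<bar>s m' - s m\<bar> + \<bar>b m' - b m\<bar>)"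
          unfolding F_def E_def
          using trunc_solution_gronwall(2)[OF B(1) UV[of "s m'" "b m'"] UV[of "s m" "b m"], of x l] x
          by (simp add: U0 V0)
        also have "\<dots> < E * (e / (2 * E) + e / (2 * E))"
          using d1(2)[of m'] d2(2)[of m'] m'' m0 E by (intro mult_strict_left_mono add_strict_mono) auto
        also have "\<dots> = e" using E by simp
        finally show "\<bar>F m' x - F m x\<bar> < e" .
      qed
    qed (use m0 l that in auto)
    obtain x0 where x0: "0 \<le> x0" "x0 \<le> l" "F m x0 = 0" using Fm(2) by auto
    have mpos: "0 < m" using m m0 by simp
    define u v where "u = U (s m) (b m)" and "v = V (s m) (b m)"
    have uv: "trunc_solution p (peak p + 1) u v" "u 0 = s m" "v 0 = b m" "v x0 = 0"
      and nonneg: "\<And>x. 0 \<le> x \<Longrightarrow> x \<le> l \<Longrightarrow> 0 \<le> v x"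
      using UV[of "s m" "b m"] U0 V0 x0 Fm(1) by (auto simp: u_def v_def B_def F_def)
    have init: "0 < u 0" "u 0 \<le> \<delta>" "0 < v 0" "v 0 \<le> c1 * \<delta>"
      using uv(2,3) sb[OF mpos m(2)] sb'[OF mpos m(2)] by auto
    note T = touching_trajectory[OF \<eta> uv(1) init \<delta>(2-4) nonneg x0(1,2) uv(4)]
    have "0 < m \<and> m \<le> m1 \<and> u 0 = s m \<and> v 0 = b m \<and> solves_on p l u v \<and>
          (\<forall>x. 0 \<le> x \<and> x < l \<longrightarrow> 0 < v x) \<and> v l = 0 \<and>
          (\<forall>x. 0 \<le> x \<and> x \<le> l \<longrightarrow> 0 < u x \<and> u x \<le> peak p + \<eta>) \<and> peak p - \<eta> \<le> u l"
      using mpos m(2) uv T by blast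
    thus "\<exists>m u v. 0 < m \<and> m \<le> m1 \<and> u 0 = s m \<and> v 0 = b m \<and> solves_on p l u v \<and>
          (\<forall>x. 0 \<le> x \<and> x < l \<longrightarrow> 0 < v x) \<and> v l = 0 \<and>
          (\<forall>x. 0 \<le> x \<and> x \<le> l \<longrightarrow> 0 < u x \<and> u x \<le> peak p + \<eta>) \<and> peak p - \<eta> \<le> u l"
      by blast
  qed
qed

end

section \<open>Profiles on the three kinds of edges\<close>

context
  fixes p :: real
  assumes p: "p > 2"
begin

text \<open>Read backwards from x = l, both functions start with velocity 0 and heights differing by
  at most \<open>\<eta>\<close>. Both stay in [0, peak p + 1], where the clipped force agrees with
  the true one, so Gronwall's inequality applies.\<close>

lemma peak_profile_close:
  assumes s: "solves_on p l u v" and vl: "v l = 0" and \<eta>: "0 \<le> \<eta>" "\<eta> \<le> 1"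
    and u: "\<And>x. 0 \<le> x \<Longrightarrow> x \<le> l \<Longrightarrow> 0 < u x \<and> u x \<le> peak p + \<eta>" "peak p - \<eta> \<le> u l"
    and Y: "0 \<le> Y" "Y \<le> l" and \<kappa>: "exp (trunc_lip p (peak p + 1) * Y) * \<eta> \<le> \<kappa>"
    and y: "0 \<le> y" "y \<le> Y"
  shows "\<bar>u (l - y) - soliton p y\<bar> \<le> \<kappa>" "\<bar>- v (l - y) - soliton_deriv p y\<bar> \<le> \<kappa>"
proof -
  define B where "B = peak p + 1"
  have B: "0 \<le> B" using peak_gt_1[OF p] by (simp add: B_def)
  have K: "0 \<le> 1 + (p - 1) * B powr (p - 2)" using p by simp
  note w = solves_onD[OF solves_on_reflect[OF s]]
  have w1: "clip B (u (l - t)) = u (l - t)" if "0 \<le> t" "t \<le> Y" for t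
    using u(1)[of "l - t"] that Y \<eta> by (intro clip_id) (auto simp: B_def)
  have w2: "clip B (soliton p t) = soliton p t" for t
    using soliton_pos[OF p, of t] soliton_le_peak[OF p, of t] by (intro clip_id) (auto simp: B_def)
  have w3: "((\<lambda>x. - v (l - x)) has_real_derivative nlforce p (clip B (u (l - t)))) (at t)"
    if "0 \<le> t" "t \<le> Y" for t
    using w(2)[of t] that Y by (simp add: w1)
  have w4: "(soliton_deriv p has_real_derivative nlforce p (clip B (soliton p t))) (at t)" for t
    unfolding w2 by (rule soliton_deriv_has_deriv[OF p])
  have w5: "((\<lambda>x. u (l - x)) has_real_derivative - v (l - t)) (at t)" if "0 \<le> t" "t \<le> Y" for t
    using w(1)[of t] that Y by simp
  note G = second_order_gronwall[OF K, of "\<lambda>u. nlforce p (clip B u)" Y, OF nlforce_lipschitz[OF p B]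
      w5 w3 soliton_has_deriv[OF p] w4 y]
  have 1: "\<bar>u (l - 0) - soliton p 0\<bar> + \<bar>- v (l - 0) - soliton_deriv p 0\<bar> \<le> \<eta>"
    using u(1)[of l] u(2) Y vl soliton_0[OF p] soliton_deriv_0[OF p] by (simp add: abs_le_iff)
  have "trunc_lip p B * y \<le> trunc_lip p B * Y" using y K by (intro mult_left_mono) (auto simp: trunc_lip_def)
  hence "exp (trunc_lip p B * y) \<le> exp (trunc_lip p B * Y)" by simp
  hence "exp (trunc_lip p B * y) * (\<bar>u (l - 0) - soliton p 0\<bar> + \<bar>- v (l - 0) - soliton_deriv p 0\<bar>)
     \<le> exp (trunc_lip p B * Y) * \<eta>"
    using 1 \<eta> by (intro mult_mono) auto
  also have "\<dots> \<le> \<kappa>" using \<kappa> by (simp add: B_def)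
  finally show "\<bar>u (l - y) - soliton p y\<bar> \<le> \<kappa>" "\<bar>- v (l - y) - soliton_deriv p y\<bar> \<le> \<kappa>"
    using G unfolding trunc_lip_def by linarith+
qed

text \<open>The slope of the half-line profile depends on the knot value only. The Kirchhoff
  condition can thus be written before the translation a is chosen, and continuity of a is never an
  issue.\<close>

lemma soliton_deriv_eq_sqrt: "0 < a \<Longrightarrow> soliton_deriv p a = - sqrt (potential p (soliton p a))"
  using soliton_deriv_neg[OF p, of a] by (simp flip: soliton_deriv_square[OF p])

lemma exists_small:
  fixes A A' c e :: real
  assumes "0 < A" "0 < A'" "0 < e"
  obtains d where "0 < d" "d < e" "(c * d)\<^sup>2 < A" "d\<^sup>2 < A'"
proof -
  have lim: "((\<lambda>d. (c * d)\<^sup>2) \<longlongrightarrow> (c * 0)\<^sup>2) (at_right 0)" "((\<lambda>d::real. d\<^sup>2) \<longlongrightarrow> 0\<^sup>2) (at_right 0)"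
    by (intro tendsto_intros)+
  have "eventually (\<lambda>d. (c * d)\<^sup>2 < A) (at_right 0)" "eventually (\<lambda>d::real. d\<^sup>2 < A') (at_right 0)"
    using order_tendstoD(2)[OF lim(1), of A] order_tendstoD(2)[OF lim(2), of A'] assms by simp_all
  moreover have "eventually (\<lambda>d. 0 < d \<and> d < e) (at_right 0)"
    using eventually_at_right[of 0 1 "\<lambda>d. 0 < d \<and> d < e"] assms(3) by auto
  ultimately have "eventually (\<lambda>d. (0 < d \<and> d < e) \<and> (c * d)\<^sup>2 < A \<and> d\<^sup>2 < A') (at_right 0)"
    by eventually_elim auto
  from eventually_happens[OF this] show ?thesis using that by auto
qed

text \<open>h, n and k stand for the numbers of half-lines, of compact edges outside
  \<open>G\<^sub>0\<close> and of compact edges in \<open>G\<^sub>0\<close>; the equation with these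
  weights is the Kirchhoff condition at the knot.\<close>

lemma shooting_profiles:
  fixes h n k :: real
  assumes h: "1 \<le> h" and n: "0 \<le> n" and k: "1 \<le> k"
    and \<eta>: "0 < \<eta>" "\<eta> < 1" "1 < peak p - \<eta>" and \<epsilon>: "0 < \<epsilon>" "\<epsilon> \<le> small_bound p"
  shows "\<exists>l0>0. \<forall>l\<ge>l0. \<exists>a u v w w'.
     0 < a \<and> soliton p a < \<epsilon> \<and> solves_on p l u v \<and> solves_on p l w w' \<and>
     u 0 = soliton p a \<and> w 0 = soliton p a \<and> v l = 0 \<and> w' l = 0 \<and>
     h * soliton_deriv p a + n * w' 0 + k * v 0 = 0 \<and>
     - soliton p a \<le> w' 0 \<and> v 0 \<le> (h + n) / k * soliton p a \<and>
     (\<forall>x y. 0 \<le> x \<and> x < y \<and> y \<le> l \<longrightarrow> w y < w x) \<and>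
     (\<forall>x. 0 \<le> x \<and> x \<le> l \<longrightarrow> 0 < w x \<and> w x \<le> soliton p a) \<and>
     (\<forall>x. 0 \<le> x \<and> x < l \<longrightarrow> 0 < v x) \<and>
     (\<forall>x. 0 \<le> x \<and> x \<le> l \<longrightarrow> 0 < u x \<and> u x \<le> peak p + \<eta>) \<and> peak p - \<eta> \<le> u l"
proof -
  \<comment> \<open>Each half-line slope lies between s / 2 and s in modulus, each slope outside
    \<open>G\<^sub>0\<close> between 0 and s; dividing the weighted sums by k gives the two
    constants.\<close>
  define c0 c1 where "c0 = h / (2 * k)" and "c1 = (h + n) / k"
  have c0: "0 < c0" using h k by (simp add: c0_def)
  have "0 < - potential p (peak p + \<eta>)"
    using potential_strict_antimono[OF p, of "peak p" "peak p + \<eta>"] peak_gt_1[OF p] \<eta> potential_peak[OF p] by simp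
  moreover have "0 < potential p (peak p - \<eta>)"
    using potential_strict_antimono[OF p, of "peak p - \<eta>" "peak p"] \<eta> potential_peak[OF p] by simp
  ultimately obtain \<delta> where \<delta>: "0 < \<delta>" "\<delta> < \<epsilon>" "(c1 * \<delta>)\<^sup>2 < - potential p (peak p + \<eta>)"
      "\<delta>\<^sup>2 < potential p (peak p - \<eta>)"
    using exists_small[OF _ _ \<epsilon>(1)] by metis
  have \<delta>1: "\<delta> < 1" "\<delta> \<le> small_bound p" using \<delta> \<epsilon> small_bound_lt_1[OF p] by linarith+
  obtain T where T: "\<forall>l (m1 :: real) s b. T \<le> l \<longrightarrow> 0 < l \<longrightarrow> 0 < m1 \<longrightarrow>
      continuous_on {0..m1} s \<longrightarrow> continuous_on {0..m1} b \<longrightarrow> s 0 = 0 \<longrightarrow> s m1 = \<delta> \<longrightarrow>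
      (\<forall>m. 0 < m \<and> m \<le> m1 \<longrightarrow> 0 < s m \<and> s m \<le> \<delta> \<and> c0 * s m \<le> b m \<and> b m \<le> c1 * s m) \<longrightarrow>
      (\<exists>m u v. 0 < m \<and> m \<le> m1 \<and> u 0 = s m \<and> v 0 = b m \<and> solves_on p l u v \<and>
        (\<forall>x. 0 \<le> x \<and> x < l \<longrightarrow> 0 < v x) \<and> v l = 0 \<and>
        (\<forall>x. 0 \<le> x \<and> x \<le> l \<longrightarrow> 0 < u x \<and> u x \<le> peak p + \<eta>) \<and> peak p - \<eta> \<le> u l)"
    using growing_edge[OF p \<eta> c0 \<delta>(1) \<delta>1(1) \<delta>(3,4)] by blast
  show ?thesis
  proof (rule exI[of _ "max T 1"], intro conjI allI impI)
    show "0 < max T 1" by simp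
    fix l assume l: "max T 1 \<le> l"
    hence l0: "0 < l" and Tl: "T \<le> l" by auto
    obtain W W' :: "real \<Rightarrow> real \<Rightarrow> real" and m1
      where WW: "\<forall>m. 0 < m \<and> m \<le> m1 \<longrightarrow> solves_on p l (W m) (W' m) \<and> W' m 0 = 0 \<and>
        (\<forall>x. 0 \<le> x \<and> x \<le> l \<longrightarrow> 0 < W m x \<and> W m x \<le> W m l \<and> W m x \<le> \<delta>) \<and>
        (\<forall>x. 0 < x \<and> x \<le> l \<longrightarrow> 0 < W' m x)"
      and m1: "0 < m1" and cW: "continuous_on {0..m1} (\<lambda>m. W m l)"
      and cW': "continuous_on {0..m1} (\<lambda>m. W' m l)"
      and W00: "W 0 l = 0" "W' 0 l = 0" and Wm1: "W m1 l = \<delta>"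
      by (rule decaying_family[OF p l0 \<delta>(1) \<delta>1(1)], rule that, assumption+)
    have sol: "solves_on p l (W m) (W' m)" and W'0: "W' m 0 = 0" if "0 < m" "m \<le> m1" for m
      using WW that by blast+
    have range: "0 < W m x \<and> W m x \<le> W m l \<and> W m x \<le> \<delta>"
      if "0 < m" "m \<le> m1" "0 \<le> x" "x \<le> l" for m x using WW that by blast
    have W'pos: "0 < W' m x" if "0 < m" "m \<le> m1" "0 < x" "x \<le> l" for m x using WW that by blast
    define s where "s m = W m l" for m
    \<comment> \<open>The Kirchhoff condition solved for the slope on the edges of
      \<open>G\<^sub>0\<close>.\<close>
    define b where "b m = (h * sqrt (potential p (s m)) + n * W' m l) / k" for m
    have s: "0 < s m \<and> s m \<le> \<delta>" if "0 < m" "m \<le> m1" for m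
      using range[OF that, of l] l0 by (auto simp: s_def)
    \<comment> \<open>The profile starts at rest, so W'(l)^2 is the difference of the potentials at
      its two ends, at most s^2.\<close>
    have W'le: "0 < W' m l \<and> W' m l \<le> s m" if m: "0 < m" "m \<le> m1" for m
    proof -
      have "(W' m l)\<^sup>2 - potential p (W m l) = (W' m 0)\<^sup>2 - potential p (W m 0)"
        by (rule solves_on_energy[OF p sol[OF m]]) (use range[OF m] l0 in auto)
      moreover have "0 \<le> potential p (W m 0)"
        using potential_mono[OF p, of 0 "W m 0"] range[OF m, of 0] l0 \<delta>1 potential_0[OF p] by auto
      ultimately have "(W' m l)\<^sup>2 \<le> (s m)\<^sup>2"
        using W'0[OF m] potential_le_square[OF p, of "W m l"] by (simp add: s_def)
      hence "W' m l \<le> s m" by (rule power2_le_imp_le) (use s[OF m] in auto)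
      thus ?thesis using W'pos[OF m, of l] l0 by auto
    qed
    have b: "c0 * s m \<le> b m \<and> b m \<le> c1 * s m" if m: "0 < m" "m \<le> m1" for m
    proof -
      have "(s m / 2)\<^sup>2 \<le> potential p (s m)"
        using potential_ge[OF p, of "s m"] s[OF m] \<delta>1 by (simp add: power_divide)
      hence 1: "s m / 2 \<le> sqrt (potential p (s m))" by (rule real_le_rsqrt)
      have 2: "sqrt (potential p (s m)) \<le> s m"
        using potential_le_square[OF p, of "s m"] s[OF m] by (intro real_le_lsqrt) auto
      have "h * (s m / 2) + 0 \<le> h * sqrt (potential p (s m)) + n * W' m l"
        using 1 h n W'le[OF m] by (intro add_mono mult_left_mono mult_nonneg_nonneg) auto
      hence "(h * (s m / 2) + 0) / k \<le> b m"
        unfolding b_def by (rule divide_right_mono) (use k in simp)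
      moreover have "h * sqrt (potential p (s m)) + n * W' m l \<le> h * s m + n * s m"
        using 2 h n W'le[OF m] by (intro add_mono mult_left_mono) auto
      hence "b m \<le> (h * s m + n * s m) / k"
        unfolding b_def by (rule divide_right_mono) (use k in simp)
      moreover have "(h * (s m / 2) + 0) / k = c0 * s m" "(h * s m + n * s m) / k = c1 * s m"
        by (simp_all add: c0_def c1_def algebra_simps add_divide_distrib)
      ultimately show ?thesis by simp
    qed
    have s0: "0 \<le> s m" if "m \<in> {0..m1}" for m
      using s[of m] that W00 by (cases "m = 0") (auto simp: s_def)
    have cs: "continuous_on {0..m1} s" using cW by (simp add: s_def[abs_def])
    have cb: "continuous_on {0..m1} b"
      unfolding b_def using k s0
      by (intro continuous_intros cW' continuous_on_compose2[OF potential_continuous[OF p] cs]) auto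
    have "s 0 = 0" "s m1 = \<delta>" by (simp_all add: s_def W00 Wm1)
    moreover have "\<forall>m. 0 < m \<and> m \<le> m1 \<longrightarrow> 0 < s m \<and> s m \<le> \<delta> \<and> c0 * s m \<le> b m \<and> b m \<le> c1 * s m"
      using s b by blast
    ultimately obtain m u v where m: "0 < m" "m \<le> m1"
      and uv: "u 0 = s m" "v 0 = b m" "solves_on p l u v"
        "\<forall>x. 0 \<le> x \<and> x < l \<longrightarrow> 0 < v x" "v l = 0"
        "\<forall>x. 0 \<le> x \<and> x \<le> l \<longrightarrow> 0 < u x \<and> u x \<le> peak p + \<eta>" "peak p - \<eta> \<le> u l"
      using T[rule_format, OF Tl l0 m1 cs cb] by blast
    \<comment> \<open>Only the selected m determines the translation of the half-line
      profile.\<close>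
    obtain a where a: "0 < a" "soliton p a = s m"
      using soliton_attains[OF p, of "s m"] s[OF m] \<delta>1 peak_gt_1[OF p] by force
    define w w' where "w x = W m (l - x)" and "w' x = - W' m (l - x)" for x
    have w: "solves_on p l w w'"
      unfolding w_def[abs_def] w'_def[abs_def] by (rule solves_on_reflect[OF sol[OF m]])
    have dec: "w y < w x" if "0 \<le> x" "x < y" "y \<le> l" for x y
    proof (rule DERIV_neg_imp_decreasing_open[OF that(2)])
      fix z assume "x < z" "z < y"
      thus "\<exists>d. (w has_real_derivative d) (at z) \<and> d < 0"
        using solves_onD(1)[OF w, of z] W'pos[OF m, of "l - z"] that by (auto simp: w'_def)
    qed (use that in \<open>auto intro: continuous_on_subset[OF solves_on_continuous(1)[OF w]]\<close>)
    have K: "h * soliton_deriv p a + n * w' 0 + k * v 0 = 0"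
      using k by (simp add: soliton_deriv_eq_sqrt[OF a(1)] a(2) w'_def uv(2) b_def)
    show "\<exists>a u v w w'.
     0 < a \<and> soliton p a < \<epsilon> \<and> solves_on p l u v \<and> solves_on p l w w' \<and>
     u 0 = soliton p a \<and> w 0 = soliton p a \<and> v l = 0 \<and> w' l = 0 \<and>
     h * soliton_deriv p a + n * w' 0 + k * v 0 = 0 \<and>
     - soliton p a \<le> w' 0 \<and> v 0 \<le> (h + n) / k * soliton p a \<and>
     (\<forall>x y. 0 \<le> x \<and> x < y \<and> y \<le> l \<longrightarrow> w y < w x) \<and>
     (\<forall>x. 0 \<le> x \<and> x \<le> l \<longrightarrow> 0 < w x \<and> w x \<le> soliton p a) \<and>
     (\<forall>x. 0 \<le> x \<and> x < l \<longrightarrow> 0 < v x) \<and>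
     (\<forall>x. 0 \<le> x \<and> x \<le> l \<longrightarrow> 0 < u x \<and> u x \<le> peak p + \<eta>) \<and> peak p - \<eta> \<le> u l"
    proof (rule exI[of _ a], rule exI[of _ u], rule exI[of _ v], rule exI[of _ w], rule exI[of _ w'], intro conjI)
      show "soliton p a < \<epsilon>" using a s[OF m] \<delta> by simp
      show "u 0 = soliton p a" "w 0 = soliton p a" using a uv by (simp_all add: w_def s_def)
      show "w' l = 0" using W'0[OF m] by (simp add: w'_def)
      show "- soliton p a \<le> w' 0" using W'le[OF m] a by (simp add: w'_def)
      show "v 0 \<le> (h + n) / k * soliton p a" using b[OF m] a uv by (simp add: c1_def)
      show "\<forall>x y. 0 \<le> x \<and> x < y \<and> y \<le> l \<longrightarrow> w y < w x" using dec by blast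
      show "\<forall>x. 0 \<le> x \<and> x \<le> l \<longrightarrow> 0 < w x \<and> w x \<le> soliton p a"
        using range[OF m] a by (auto simp: w_def s_def)
    qed (fact a uv w K)+
  qed
qed

text \<open>Converts the tolerance \<open>\<eta>\<close> at the maximum into bounds linear in
  \<open>\<epsilon>\<close>, with C depending on p and the edge counts only.\<close>

lemma knot_profiles:
  fixes h n k :: real
  assumes h: "1 \<le> h" and n: "0 \<le> n" and k: "1 \<le> k"
  shows "\<exists>C>0. \<exists>\<epsilon>0>0. \<epsilon>0 \<le> small_bound p \<and> (\<forall>\<epsilon>. 0 < \<epsilon> \<and> \<epsilon> < \<epsilon>0 \<longrightarrow> (\<exists>l0>0. \<forall>l\<ge>l0. \<exists>a u v w w'.
     0 < a \<and> soliton p a < \<epsilon> \<and> solves_on p l u v \<and> solves_on p l w w' \<and>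
     u 0 = soliton p a \<and> w 0 = soliton p a \<and> v l = 0 \<and> w' l = 0 \<and>
     h * soliton_deriv p a + n * w' 0 + k * v 0 = 0 \<and>
     - soliton p a \<le> w' 0 \<and> 0 \<le> v 0 \<and> v 0 \<le> C * soliton p a \<and>
     (\<forall>x y. 0 \<le> x \<and> x < y \<and> y \<le> l \<longrightarrow> w y < w x) \<and>
     (\<forall>x. 0 \<le> x \<and> x \<le> l \<longrightarrow> 0 < w x \<and> w x \<le> soliton p a) \<and>
     (\<forall>x\<in>{0..l}. \<bar>u x - soliton p (l - x)\<bar> \<le> 2 * \<epsilon>) \<and>
     \<bar>(LINT x:{0..l}|lborel. \<bar>u x\<bar> powr p) - (LINT x:{0..}|lborel. \<bar>soliton p x\<bar> powr p)\<bar> \<le> C * \<epsilon>))"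
proof -
  define B where "B = peak p + 1"
  \<comment> \<open>(h + n) / k bounds the slope at the knot, p B^(p - 1) is the Lipschitz constant
    of the p-th power, and 5 = 4 + 1 covers the boundary term at l - Y and the soliton tail.\<close>
  define C where "C = (h + n) / k + (p * B powr (p - 1) + 5)"
  have hnk: "0 < (h + n) / k" using h n k by simp
  have pB: "0 \<le> p * B powr (p - 1)" using p by simp
  have C: "0 < C" using hnk pB unfolding C_def by linarith
  show ?thesis
  \<comment> \<open>Half of \<open>small_bound p\<close>, because away from the maximum u is bounded
    by \<open>2 * \<epsilon>\<close>.\<close>
  proof (rule exI[of _ C], intro conjI C, rule exI[of _ "small_bound p / 2"], intro conjI allI impI)
    show "0 < small_bound p / 2" "small_bound p / 2 \<le> small_bound p"
      using small_bound_pos[OF p] by auto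
    fix \<epsilon> assume "0 < \<epsilon> \<and> \<epsilon> < small_bound p / 2"
    hence \<epsilon>: "0 < \<epsilon>" "2 * \<epsilon> \<le> small_bound p" "\<epsilon> \<le> small_bound p" "\<epsilon> \<le> 1"
      using small_bound_lt_1[OF p] by auto
    obtain Y where Y: "0 < Y" "soliton p Y < \<epsilon>" using soliton_small[OF p \<epsilon>(1)] by blast
    define E where "E = exp (trunc_lip p B * Y)"
    \<comment> \<open>Gives both \<open>\<kappa> \<le> \<epsilon>\<close> and
      \<open>Y * \<kappa> \<le> \<epsilon>\<close>: the error integrated over [0, Y] stays linear in
      \<open>\<epsilon>\<close> although Y is not bounded in terms of \<open>\<epsilon>\<close>
      beforehand.\<close>
    define \<kappa> where "\<kappa> = \<epsilon> / (1 + Y)"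
    have E: "0 < E" by (simp add: E_def)
    have \<kappa>: "0 < \<kappa>" "\<kappa> \<le> \<epsilon>" "Y * \<kappa> \<le> \<epsilon>" using \<epsilon> Y by (auto simp: \<kappa>_def field_simps)
    \<comment> \<open>The first entry absorbs the Gronwall factor E; the others ensure
      \<open>\<eta>\<close> < 1 and 1 < peak p - \<open>\<eta>\<close>.\<close>
    define \<eta> where "\<eta> = min (\<kappa> / E) (min (1 / 2) ((peak p - 1) / 2))"
    have \<eta>: "0 < \<eta>" "\<eta> < 1" "1 < peak p - \<eta>"
    proof -
      show "0 < \<eta>" using \<kappa> E peak_gt_1[OF p] by (simp add: \<eta>_def)
      have b: "\<eta> \<le> 1 / 2" "\<eta> \<le> (peak p - 1) / 2" unfolding \<eta>_def
        by (rule order_trans[OF min.cobounded2 min.cobounded1],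
            rule order_trans[OF min.cobounded2 min.cobounded2])
      show "\<eta> < 1" using b(1) by linarith
      show "1 < peak p - \<eta>" using b(2) peak_gt_1[OF p] by (simp add: field_simps)
    qed
    have "\<eta> \<le> \<kappa> / E" by (simp add: \<eta>_def)
    hence E\<eta>: "E * \<eta> \<le> \<kappa>" using E by (simp add: field_simps)
    obtain l0 where l0: "0 < l0" and ex: "\<forall>l\<ge>l0. \<exists>a u v w w'.
       0 < a \<and> soliton p a < \<epsilon> \<and> solves_on p l u v \<and> solves_on p l w w' \<and>
       u 0 = soliton p a \<and> w 0 = soliton p a \<and> v l = 0 \<and> w' l = 0 \<and>
       h * soliton_deriv p a + n * w' 0 + k * v 0 = 0 \<and>
       - soliton p a \<le> w' 0 \<and> v 0 \<le> (h + n) / k * soliton p a \<and>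
       (\<forall>x y. 0 \<le> x \<and> x < y \<and> y \<le> l \<longrightarrow> w y < w x) \<and>
       (\<forall>x. 0 \<le> x \<and> x \<le> l \<longrightarrow> 0 < w x \<and> w x \<le> soliton p a) \<and>
       (\<forall>x. 0 \<le> x \<and> x < l \<longrightarrow> 0 < v x) \<and>
       (\<forall>x. 0 \<le> x \<and> x \<le> l \<longrightarrow> 0 < u x \<and> u x \<le> peak p + \<eta>) \<and> peak p - \<eta> \<le> u l"
      using shooting_profiles[OF h n k \<eta> \<epsilon>(1,3)] by (elim exE conjE) (rule that)
    show "\<exists>l0>0. \<forall>l\<ge>l0. \<exists>a u v w w'.
     0 < a \<and> soliton p a < \<epsilon> \<and> solves_on p l u v \<and> solves_on p l w w' \<and>
     u 0 = soliton p a \<and> w 0 = soliton p a \<and> v l = 0 \<and> w' l = 0 \<and>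
     h * soliton_deriv p a + n * w' 0 + k * v 0 = 0 \<and>
     - soliton p a \<le> w' 0 \<and> 0 \<le> v 0 \<and> v 0 \<le> C * soliton p a \<and>
     (\<forall>x y. 0 \<le> x \<and> x < y \<and> y \<le> l \<longrightarrow> w y < w x) \<and>
     (\<forall>x. 0 \<le> x \<and> x \<le> l \<longrightarrow> 0 < w x \<and> w x \<le> soliton p a) \<and>
     (\<forall>x\<in>{0..l}. \<bar>u x - soliton p (l - x)\<bar> \<le> 2 * \<epsilon>) \<and>
     \<bar>(LINT x:{0..l}|lborel. \<bar>u x\<bar> powr p) - (LINT x:{0..}|lborel. \<bar>soliton p x\<bar> powr p)\<bar> \<le> C * \<epsilon>"
    proof (rule exI[of _ "max l0 Y"], intro conjI allI impI)
      show "0 < max l0 Y" using l0 by simp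
      fix l assume "max l0 Y \<le> l"
      hence l: "l0 \<le> l" "Y \<le> l" "0 < l" using l0 by auto
      from ex[rule_format, OF l(1)] obtain a u v w w' where
        1: "0 < a" "soliton p a < \<epsilon>" "solves_on p l u v" "solves_on p l w w'"
           "u 0 = soliton p a" "w 0 = soliton p a" "v l = 0" "w' l = 0"
           "h * soliton_deriv p a + n * w' 0 + k * v 0 = 0" "- soliton p a \<le> w' 0"
        and v0: "v 0 \<le> (h + n) / k * soliton p a"
        and 2: "\<forall>x y. 0 \<le> x \<and> x < y \<and> y \<le> l \<longrightarrow> w y < w x"
           "\<forall>x. 0 \<le> x \<and> x \<le> l \<longrightarrow> 0 < w x \<and> w x \<le> soliton p a"
        and v': "\<forall>x. 0 \<le> x \<and> x < l \<longrightarrow> 0 < v x"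
        and u': "\<forall>x. 0 \<le> x \<and> x \<le> l \<longrightarrow> 0 < u x \<and> u x \<le> peak p + \<eta>" "peak p - \<eta> \<le> u l"
        by (elim exE conjE) (rule that)
      have v: "0 < v x" if "0 \<le> x" "x < l" for x using v' that by blast
      have u: "0 < u x \<and> u x \<le> peak p + \<eta>" if "0 \<le> x" "x \<le> l" for x using u' that by blast
      note u = u u'(2)
      have close: "\<bar>u (l - y) - soliton p y\<bar> \<le> \<kappa>" "\<bar>- v (l - y) - soliton_deriv p y\<bar> \<le> \<kappa>"
        if "0 \<le> y" "y \<le> Y" for y
        by (rule peak_profile_close[OF 1(3,7) _ _ u]; use \<eta> Y l E\<eta> that in \<open>simp add: E_def B_def\<close>)+
      have mono: "u x \<le> u y" if "0 \<le> x" "x \<le> y" "y \<le> l" for x y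
        using deriv_ge_imp_growth_ge[OF that(2), of u v 0] solves_onD(1)[OF 1(3)] v 1(7) that
        by (smt (verit) mult_zero_left)
      have uY: "u (l - Y) \<le> 2 * \<epsilon>" using close(1)[of Y] Y \<kappa> by (simp add: abs_le_iff)
      have vY: "v (l - Y) \<le> 2 * \<epsilon>"
        using close(2)[of Y] soliton_deriv_abs_le[OF p, of Y] Y \<kappa> by (simp add: abs_le_iff)
      \<comment> \<open>Within distance Y of the maximum by Gronwall; beyond it both functions are
        monotone and positive, hence below \<open>2 * \<epsilon>\<close>.\<close>
      have sup: "\<bar>u x - soliton p (l - x)\<bar> \<le> 2 * \<epsilon>" if x: "0 \<le> x" "x \<le> l" for x
      proof (cases "l - Y \<le> x")
        case True
        thus ?thesis using close(1)[of "l - x"] x \<kappa> \<epsilon> by simp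
      next
        case False
        have "u x \<le> 2 * \<epsilon>" using mono[of x "l - Y"] False x Y uY by simp
        moreover have "soliton p (l - x) < \<epsilon>"
          using soliton_decreasing[OF p, of Y "l - x"] Y False by simp
        ultimately show ?thesis using u(1)[of x] x soliton_pos[OF p, of "l - x"] \<epsilon> by (simp add: abs_le_iff)
      qed
      have "\<bar>(LINT x:{0..l}|lborel. \<bar>u x\<bar> powr p) - (LINT x:{0..}|lborel. \<bar>soliton p x\<bar> powr p)\<bar>
        \<le> Y * (p * B powr (p - 1) * \<kappa>) + (v (l - Y) * u (l - Y) - v 0 * u 0) + (soliton p Y)\<^sup>2"
      proof (rule powr_integral_near_soliton[OF p _ l(2) 1(3) close(1)])
        show "0 \<le> u x \<and> u x \<le> B" if "0 \<le> x" "x \<le> l" for x using u(1)[OF that] \<eta> by (simp add: B_def)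
        show "u x \<le> small_bound p" if "0 \<le> x" "x \<le> l - Y" for x
          using mono[of x "l - Y"] that Y uY \<epsilon> by simp
      qed (use Y \<epsilon> in \<open>auto simp: B_def\<close>)
      also have "\<dots> \<le> p * B powr (p - 1) * \<epsilon> + (4 * \<epsilon> - 0) + \<epsilon>"
      proof (intro add_mono diff_mono)
        have "Y * (p * B powr (p - 1) * \<kappa>) = p * B powr (p - 1) * (Y * \<kappa>)" by simp
        also have "\<dots> \<le> p * B powr (p - 1) * \<epsilon>" by (intro mult_left_mono \<kappa> pB)
        finally show "Y * (p * B powr (p - 1) * \<kappa>) \<le> p * B powr (p - 1) * \<epsilon>" .
        have ee: "\<epsilon> * \<epsilon> \<le> \<epsilon> * 1" using \<epsilon> by (intro mult_left_mono) auto
        have "v (l - Y) * u (l - Y) \<le> (2 * \<epsilon>) * (2 * \<epsilon>)"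
          using uY vY u(1)[of "l - Y"] l Y \<epsilon> by (intro mult_mono) auto
        thus "v (l - Y) * u (l - Y) \<le> 4 * \<epsilon>" using ee by simp
        show "0 \<le> v 0 * u 0" using v[of 0] u(1)[of 0] l by simp
        have "(soliton p Y)\<^sup>2 \<le> \<epsilon>\<^sup>2" using Y soliton_pos[OF p, of Y] by (intro power_mono) auto
        thus "(soliton p Y)\<^sup>2 \<le> \<epsilon>" using ee by (simp add: power2_eq_square)
      qed
      also have "\<dots> = (p * B powr (p - 1) + 5) * \<epsilon>" by (simp add: algebra_simps)
      also have "\<dots> \<le> C * \<epsilon>" using \<epsilon> hnk by (intro mult_right_mono) (auto simp: C_def)
      finally have int: "\<bar>(LINT x:{0..l}|lborel. \<bar>u x\<bar> powr p) - (LINT x:{0..}|lborel. \<bar>soliton p x\<bar> powr p)\<bar> \<le> C * \<epsilon>" .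
      have "(h + n) / k * soliton p a \<le> C * soliton p a"
        using pB soliton_pos[OF p, of a] by (intro mult_right_mono) (auto simp: C_def)
      hence v0': "0 \<le> v 0" "v 0 \<le> C * soliton p a" using v0 v[of 0] l by auto
      have sup': "\<forall>x\<in>{0..l}. \<bar>u x - soliton p (l - x)\<bar> \<le> 2 * \<epsilon>" using sup by simp
      show "\<exists>a u v w w'.
       0 < a \<and> soliton p a < \<epsilon> \<and> solves_on p l u v \<and> solves_on p l w w' \<and>
       u 0 = soliton p a \<and> w 0 = soliton p a \<and> v l = 0 \<and> w' l = 0 \<and>
       h * soliton_deriv p a + n * w' 0 + k * v 0 = 0 \<and>
       - soliton p a \<le> w' 0 \<and> 0 \<le> v 0 \<and> v 0 \<le> C * soliton p a \<and>
       (\<forall>x y. 0 \<le> x \<and> x < y \<and> y \<le> l \<longrightarrow> w y < w x) \<and>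
       (\<forall>x. 0 \<le> x \<and> x \<le> l \<longrightarrow> 0 < w x \<and> w x \<le> soliton p a) \<and>
       (\<forall>x\<in>{0..l}. \<bar>u x - soliton p (l - x)\<bar> \<le> 2 * \<epsilon>) \<and>
       \<bar>(LINT x:{0..l}|lborel. \<bar>u x\<bar> powr p) - (LINT x:{0..}|lborel. \<bar>soliton p x\<bar> powr p)\<bar> \<le> C * \<epsilon>"
        by (rule exI[of _ a], rule exI[of _ u], rule exI[of _ v], rule exI[of _ w], rule exI[of _ w'])
          (intro conjI 1 2 v0' sup' int)
    qed
  qed
qed

end

section \<open>Assembly on the graph\<close>

lemma G0_edges_subset:
  assumes "Ps \<subseteq> {..<P}" "Ls \<subseteq> {..<L}"
  shows "G0_edges P Ps Ls \<subseteq> {..<P + 2 * L}"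
  using assms unfolding G0_edges_def by fastforce

lemma card_G0_edges:
  assumes Ps: "Ps \<subseteq> {..<P}" and Ls: "Ls \<subseteq> {..<L}"
  shows "card (G0_edges P Ps Ls) = card Ps + 2 * card Ls"
proof -
  have fin: "finite Ps" "finite Ls" using Ps Ls finite_subset by blast+
  define A B where "A = (\<lambda>j. P + 2 * j) ` Ls" and "B = (\<lambda>j. P + 2 * j + 1) ` Ls"
  have G: "G0_edges P Ps Ls = Ps \<union> (A \<union> B)" by (auto simp: G0_edges_def A_def B_def)
  have "Ps \<inter> (A \<union> B) = {}" using Ps by (force simp: A_def B_def)
  moreover have "A \<inter> B = {}"
  proof -
    have "P + 2 * i \<noteq> P + 2 * j + 1" for i j by presburger
    thus ?thesis by (auto simp: A_def B_def)
  qed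
  moreover have "card A = card Ls" "card B = card Ls"
    by (auto simp: A_def B_def card_image inj_on_def)
  moreover have "finite A" "finite B" using fin by (auto simp: A_def B_def)
  ultimately show ?thesis unfolding G using fin by (simp add: card_Un_disjoint)
qed

text \<open>Both halves of a loop receive the same profile, which makes the assembled function
  continuous at the dummy vertex.\<close>

lemma G0_edges_loop:
  assumes "Ps \<subseteq> {..<P}"
  shows "P + 2 * j \<in> G0_edges P Ps Ls \<longleftrightarrow> P + 2 * j + 1 \<in> G0_edges P Ps Ls"
proof -
  have "P + 2 * j \<in> G0_edges P Ps Ls \<longleftrightarrow> j \<in> Ls"
    using assms unfolding G0_edges_def by (auto; presburger)
  moreover have "P + 2 * j + 1 \<in> G0_edges P Ps Ls \<longleftrightarrow> j \<in> Ls"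
    using assms unfolding G0_edges_def by (auto; presburger)
  ultimately show ?thesis by simp
qed

lemma sum_two_valued:
  fixes A B :: real
  assumes "G \<subseteq> {..<N}"
  shows "(\<Sum>e<N. if e \<in> G then A else B) = real (card G) * A + (real N - real (card G)) * B"
proof -
  have fin: "finite G" using assms finite_subset by blast
  have "(\<Sum>e<N. if e \<in> G then A else B) = (\<Sum>e\<in>{..<N} \<inter> G. A) + (\<Sum>e\<in>{..<N} \<inter> - G. B)"
    by (subst sum.If_cases) auto
  also have "{..<N} \<inter> G = G" using assms by auto
  also have "{..<N} \<inter> - G = {..<N} - G" by auto
  also have "card ({..<N} - G) = N - card G" using assms fin by (simp add: card_Diff_subset)
  moreover have "card G \<le> N" using card_mono[OF _ assms] by simp
  ultimately show ?thesis by (simp add: of_nat_diff)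
qed

text \<open>All test function components share one value c at the knot, and boundary terms at x = l
  vanish as v l = w' l = 0. The weak form is therefore - c times the Kirchhoff sum.\<close>

lemma knot_bound_state:
  fixes u v w w' :: "real \<Rightarrow> real"
  assumes p: "p > 2" and H: "H \<ge> 1" and Ps: "Ps \<subseteq> {..<P}" and Ls: "Ls \<subseteq> {..<L}" and l: "0 \<le> l" and a: "0 \<le> a"
    and u: "solves_on p l u v" "u 0 = soliton p a" "v l = 0"
    and w: "solves_on p l w w'" "w 0 = soliton p a" "w' l = 0"
    and kirchhoff: "real H * soliton_deriv p a + (real (P + 2 * L) - real (card (G0_edges P Ps Ls))) * w' 0
      + real (card (G0_edges P Ps Ls)) * v 0 = 0"
  shows "bound_state H P L l p (\<lambda>_ x. soliton p (x + a)) (\<lambda>e. if e \<in> G0_edges P Ps Ls then u else w)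
    (\<lambda>_ x. soliton_deriv p (x + a)) (\<lambda>e. if e \<in> G0_edges P Ps Ls then v else w')"
  unfolding bound_state_def
proof (intro conjI allI impI)
  define G where "G = G0_edges P Ps Ls"
  note loop = G0_edges_loop[OF Ps, of _ Ls, folded G_def]
  show "H1_graph H P L l (\<lambda>_ x. soliton p (x + a)) (\<lambda>e. if e \<in> G0_edges P Ps Ls then u else w)
    (\<lambda>_ x. soliton_deriv p (x + a)) (\<lambda>e. if e \<in> G0_edges P Ps Ls then v else w')"
    unfolding H1_graph_def G_def[symmetric]
  proof (intro conjI allI impI)
    show "H1_interval {0..} (\<lambda>x. soliton p (x + a)) (\<lambda>x. soliton_deriv p (x + a))"
      by (rule soliton_shift_H1[OF p a])
    show "H1_interval {0..l} (if e \<in> G then u else w) (if e \<in> G then v else w')" for e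
      using solves_on_H1[OF p l u(1)] solves_on_H1[OF p l w(1)] by simp
    show "\<exists>c. (\<forall>h<H. soliton p (0 + a) = c) \<and> (\<forall>e<P + 2 * L. (if e \<in> G then u else w) 0 = c)"
      using u(2) w(2) by auto
    show "(if P + 2 * j \<in> G then u else w) l = (if P + 2 * j + 1 \<in> G then u else w) l" for j
      using loop[of j] by simp
  qed
  show "nontrivial_graph_fun H P L l (\<lambda>_ x. soliton p (x + a)) (\<lambda>e. if e \<in> G0_edges P Ps Ls then u else w)"
    unfolding nontrivial_graph_fun_def using H soliton_pos[OF p, of "0 + a"]
    by (intro disjI1 exI[of _ 0] conjI) auto
  fix \<eta>h \<eta>c \<eta>h' \<eta>c' assume "H1_graph H P L l \<eta>h \<eta>c \<eta>h' \<eta>c'"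
  then obtain c where \<eta>: "\<And>h. h < H \<Longrightarrow> H1_interval {0..} (\<eta>h h) (\<eta>h' h)"
      "\<And>e. e < P + 2 * L \<Longrightarrow> H1_interval {0..l} (\<eta>c e) (\<eta>c' e)"
    and c: "\<And>h. h < H \<Longrightarrow> \<eta>h h 0 = c" "\<And>e. e < P + 2 * L \<Longrightarrow> \<eta>c e 0 = c"
    unfolding H1_graph_def by blast
  have half: "(LINT x:{0..}|lborel. soliton_deriv p (x + a) * \<eta>h' h x + soliton p (x + a) * \<eta>h h x
      - \<bar>soliton p (x + a)\<bar> powr (p - 2) * soliton p (x + a) * \<eta>h h x) = - soliton_deriv p a * c" if "h < H" for h
    using soliton_shift_weak[OF p a \<eta>(1)[OF that]] c(1)[OF that] by simp
  have edge: "(LINT x:{0..l}|lborel. (if e \<in> G then v else w') x * \<eta>c' e x + (if e \<in> G then u else w) x * \<eta>c e x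
      - \<bar>(if e \<in> G then u else w) x\<bar> powr (p - 2) * (if e \<in> G then u else w) x * \<eta>c e x)
      = (if e \<in> G then - v 0 * c else - w' 0 * c)" if "e < P + 2 * L" for e
    using solves_on_weak[OF p l u(1) \<eta>(2)[OF that]] solves_on_weak[OF p l w(1) \<eta>(2)[OF that]]
      c(2)[OF that] u(3) w(3) by simp
  have "(\<Sum>h<H. LINT x:{0..}|lborel. soliton_deriv p (x + a) * \<eta>h' h x + soliton p (x + a) * \<eta>h h x
      - \<bar>soliton p (x + a)\<bar> powr (p - 2) * soliton p (x + a) * \<eta>h h x)
    + (\<Sum>e<P + 2 * L. LINT x:{0..l}|lborel. (if e \<in> G then v else w') x * \<eta>c' e x + (if e \<in> G then u else w) x * \<eta>c e x
      - \<bar>(if e \<in> G then u else w) x\<bar> powr (p - 2) * (if e \<in> G then u else w) x * \<eta>c e x)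
    = (\<Sum>h<H. - soliton_deriv p a * c) + (\<Sum>e<P + 2 * L. if e \<in> G then - v 0 * c else - w' 0 * c)"
    using half edge by (intro arg_cong2[of _ _ _ _ "(+)"] sum.cong) auto
  also have "\<dots> = - c * (real H * soliton_deriv p a + (real (P + 2 * L) - real (card G)) * w' 0 + real (card G) * v 0)"
    by (subst sum_two_valued) (use G0_edges_subset[OF Ps Ls] in \<open>simp_all add: G_def algebra_simps\<close>)
  also have "\<dots> = 0" using kirchhoff by (simp only: G_def mult_zero_right)
  finally show "(\<Sum>h<H. LINT x:{0..}|lborel. soliton_deriv p (x + a) * \<eta>h' h x + soliton p (x + a) * \<eta>h h x
      - \<bar>soliton p (x + a)\<bar> powr (p - 2) * soliton p (x + a) * \<eta>h h x)
    + (\<Sum>e<P + 2 * L. LINT x:{0..l}|lborel. (if e \<in> G0_edges P Ps Ls then v else w') x * \<eta>c' e x + (if e \<in> G0_edges P Ps Ls then u else w) x * \<eta>c e x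
      - \<bar>(if e \<in> G0_edges P Ps Ls then u else w) x\<bar> powr (p - 2) * (if e \<in> G0_edges P Ps Ls then u else w) x * \<eta>c e x) = 0"
    by (simp only: G_def)
qed

lemma action_split:
  fixes u v w w' f f' :: "real \<Rightarrow> real"
  assumes G: "G \<subseteq> {..<P + 2 * L}"
  shows "action H P L l p (\<lambda>_. f) (\<lambda>e. if e \<in> G then u else w) (\<lambda>_. f') (\<lambda>e. if e \<in> G then v else w')
    = real H * (1/2 * (LINT x:{0..}|lborel. (f' x)\<^sup>2 + (f x)\<^sup>2) - 1/p * (LINT x:{0..}|lborel. \<bar>f x\<bar> powr p))
    + (real (P + 2 * L) - real (card G)) *
       (1/2 * (LINT x:{0..l}|lborel. (w' x)\<^sup>2 + (w x)\<^sup>2) - 1/p * (LINT x:{0..l}|lborel. \<bar>w x\<bar> powr p))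
    + real (card G) *
       (1/2 * (LINT x:{0..l}|lborel. (v x)\<^sup>2 + (u x)\<^sup>2) - 1/p * (LINT x:{0..l}|lborel. \<bar>u x\<bar> powr p))"
proof -
  have 1: "(\<Sum>e<P + 2 * L. LINT x:{0..l}|lborel. ((if e \<in> G then v else w') x)\<^sup>2 + ((if e \<in> G then u else w) x)\<^sup>2)
    = real (card G) * (LINT x:{0..l}|lborel. (v x)\<^sup>2 + (u x)\<^sup>2)
    + (real (P + 2 * L) - real (card G)) * (LINT x:{0..l}|lborel. (w' x)\<^sup>2 + (w x)\<^sup>2)"
    unfolding sum_two_valued[OF G, symmetric] by (intro sum.cong) auto
  have 2: "(\<Sum>e<P + 2 * L. LINT x:{0..l}|lborel. \<bar>(if e \<in> G then u else w) x\<bar> powr p)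
    = real (card G) * (LINT x:{0..l}|lborel. \<bar>u x\<bar> powr p)
    + (real (P + 2 * L) - real (card G)) * (LINT x:{0..l}|lborel. \<bar>w x\<bar> powr p)"
    unfolding sum_two_valued[OF G, symmetric] by (intro sum.cong) auto
  have alg: "1/2 * (c * a0 + (b * a1 + d * a2)) - 1/p * (c * q0 + (b * q1 + d * q2))
    = c * (1/2 * a0 - 1/p * q0) + d * (1/2 * a2 - 1/p * q2) + b * (1/2 * a1 - 1/p * q1)"
    for a0 a1 a2 b c d q0 q1 q2 :: real
    by (simp add: algebra_simps add_divide_distrib)
  show ?thesis unfolding action_def 1 2 sum_constant card_lessThan by (rule alg)
qed

lemma small_action_bound:
  fixes I Q :: real
  assumes "p > 2" "0 \<le> I" "I \<le> 2 * X" "0 \<le> Q" "Q \<le> X"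
  shows "\<bar>1/2 * I - 1/p * Q\<bar> \<le> X"
proof -
  have "1/p * Q \<le> 1 * Q" using assms by (intro mult_right_mono) auto
  moreover have "0 \<le> 1/p * Q" using assms by (intro mult_nonneg_nonneg) auto
  ultimately show ?thesis using assms unfolding abs_le_iff by linarith
qed

theorem theorem1p14:
  fixes p :: real and H P L P0 L0 :: nat and Ps Ls :: "nat set"
  assumes "p > 2" and "H \<ge> 1"
    and "P0 \<le> P" and "L0 \<le> L" and "P0 + 2 * L0 > 0"
    and "Ps \<subseteq> {..<P}" and "card Ps = P0"
    and "Ls \<subseteq> {..<L}" and "card Ls = L0"
  shows "\<exists>C>0. \<exists>\<epsilon>0>0. \<forall>\<epsilon>. 0 < \<epsilon> \<and> \<epsilon> < \<epsilon>0 \<longrightarrow>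
    (\<exists>l0. \<forall>l\<ge>l0. \<exists>uh uc uh' uc'.
       bound_state H P L l p uh uc uh' uc' \<and>
       0 < uh 0 0 \<and> uh 0 0 < \<epsilon> \<and>
       (\<forall>e\<in>G0_edges P Ps Ls. \<forall>e'\<in>G0_edges P Ps Ls. \<forall>x\<in>{0..l}. uc e x = uc e' x) \<and>
       (\<forall>e<P + 2 * L. \<forall>e'<P + 2 * L. e \<notin> G0_edges P Ps Ls \<longrightarrow> e' \<notin> G0_edges P Ps Ls \<longrightarrow>
           (\<forall>x\<in>{0..l}. uc e x = uc e' x)) \<and>
       (\<forall>e<P + 2 * L. e \<notin> G0_edges P Ps Ls \<longrightarrow>
           (\<forall>x y. 0 \<le> x \<and> x < y \<and> y \<le> l \<longrightarrow> uc e y < uc e x) \<and>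
           (\<forall>x\<in>{0..l}. \<bar>uc e x\<bar> < \<epsilon>)) \<and>
       (\<forall>e\<in>G0_edges P Ps Ls. \<forall>x\<in>{0..l}. \<bar>uc e x - soliton p (l - x)\<bar> \<le> C * \<epsilon>) \<and>
       (\<forall>h<H. \<forall>x y. 0 \<le> x \<and> x < y \<longrightarrow> uh h y < uh h x) \<and>
       \<bar>action H P L l p uh uc uh' uc' - real (P0 + 2 * L0) / 2 * soliton_action p\<bar> \<le> C * \<epsilon>)"
proof -
  note p = \<open>p > 2\<close>
  define G where "G = G0_edges P Ps Ls"
  define h n k where "h = real H" and "n = real (P + 2 * L) - real (card G)" and "k = real (card G)"
  have G: "G \<subseteq> {..<P + 2 * L}" unfolding G_def using assms by (intro G0_edges_subset) auto
  have card: "card G = P0 + 2 * L0" unfolding G_def using assms by (simp add: card_G0_edges)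
  have h: "1 \<le> h" using assms by (simp add: h_def)
  have n: "0 \<le> n" using card_mono[OF _ G] by (simp add: n_def)
  have "1 \<le> card G" using assms(5) card by linarith
  hence k: "1 \<le> k" unfolding k_def by linarith
  from knot_profiles[OF p h n k] obtain C \<epsilon>0 where C: "0 < C" and \<epsilon>0: "0 < \<epsilon>0" "\<epsilon>0 \<le> small_bound p"
    and ex: "\<forall>\<epsilon>. 0 < \<epsilon> \<and> \<epsilon> < \<epsilon>0 \<longrightarrow> (\<exists>l0>0. \<forall>l\<ge>l0. \<exists>a u v w w'.
     0 < a \<and> soliton p a < \<epsilon> \<and> solves_on p l u v \<and> solves_on p l w w' \<and>
     u 0 = soliton p a \<and> w 0 = soliton p a \<and> v l = 0 \<and> w' l = 0 \<and>
     h * soliton_deriv p a + n * w' 0 + k * v 0 = 0 \<and>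
     - soliton p a \<le> w' 0 \<and> 0 \<le> v 0 \<and> v 0 \<le> C * soliton p a \<and>
     (\<forall>x y. 0 \<le> x \<and> x < y \<and> y \<le> l \<longrightarrow> w y < w x) \<and>
     (\<forall>x. 0 \<le> x \<and> x \<le> l \<longrightarrow> 0 < w x \<and> w x \<le> soliton p a) \<and>
     (\<forall>x\<in>{0..l}. \<bar>u x - soliton p (l - x)\<bar> \<le> 2 * \<epsilon>) \<and>
     \<bar>(LINT x:{0..l}|lborel. \<bar>u x\<bar> powr p) - (LINT x:{0..}|lborel. \<bar>soliton p x\<bar> powr p)\<bar> \<le> C * \<epsilon>)"
    by (elim exE conjE) (rule that)
  \<comment> \<open>h + n for half-lines and edges outside \<open>G\<^sub>0\<close>, each
    contributing at most \<open>s * s\<close>; 2 C for each of the k edges of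
    \<open>G\<^sub>0\<close>; and 2 for the uniform distance to the soliton.\<close>
  define C' where "C' = h + n + 2 * k * C + 2"
  have C': "0 < C'" "2 \<le> C'" using h n k C by (auto simp: C'_def add_pos_nonneg)
  show ?thesis
  proof (rule exI[of _ C'], intro conjI C'(1), rule exI[of _ \<epsilon>0], intro conjI \<epsilon>0(1) allI impI)
    fix \<epsilon> assume \<epsilon>': "0 < \<epsilon> \<and> \<epsilon> < \<epsilon>0"
    hence \<epsilon>: "0 < \<epsilon>" "\<epsilon> < small_bound p" "\<epsilon> < 1" using \<epsilon>0 small_bound_lt_1[OF p] by auto
    from ex[rule_format, OF \<epsilon>'] obtain l0 where l0: "0 < l0" and exl: "\<forall>l\<ge>l0. \<exists>a u v w w'.
     0 < a \<and> soliton p a < \<epsilon> \<and> solves_on p l u v \<and> solves_on p l w w' \<and>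
     u 0 = soliton p a \<and> w 0 = soliton p a \<and> v l = 0 \<and> w' l = 0 \<and>
     h * soliton_deriv p a + n * w' 0 + k * v 0 = 0 \<and>
     - soliton p a \<le> w' 0 \<and> 0 \<le> v 0 \<and> v 0 \<le> C * soliton p a \<and>
     (\<forall>x y. 0 \<le> x \<and> x < y \<and> y \<le> l \<longrightarrow> w y < w x) \<and>
     (\<forall>x. 0 \<le> x \<and> x \<le> l \<longrightarrow> 0 < w x \<and> w x \<le> soliton p a) \<and>
     (\<forall>x\<in>{0..l}. \<bar>u x - soliton p (l - x)\<bar> \<le> 2 * \<epsilon>) \<and>
     \<bar>(LINT x:{0..l}|lborel. \<bar>u x\<bar> powr p) - (LINT x:{0..}|lborel. \<bar>soliton p x\<bar> powr p)\<bar> \<le> C * \<epsilon>"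
      by (elim exE conjE) (rule that)
    show "\<exists>l0. \<forall>l\<ge>l0. \<exists>uh uc uh' uc'.
       bound_state H P L l p uh uc uh' uc' \<and>
       0 < uh 0 0 \<and> uh 0 0 < \<epsilon> \<and>
       (\<forall>e\<in>G0_edges P Ps Ls. \<forall>e'\<in>G0_edges P Ps Ls. \<forall>x\<in>{0..l}. uc e x = uc e' x) \<and>
       (\<forall>e<P + 2 * L. \<forall>e'<P + 2 * L. e \<notin> G0_edges P Ps Ls \<longrightarrow> e' \<notin> G0_edges P Ps Ls \<longrightarrow>
           (\<forall>x\<in>{0..l}. uc e x = uc e' x)) \<and>
       (\<forall>e<P + 2 * L. e \<notin> G0_edges P Ps Ls \<longrightarrow>
           (\<forall>x y. 0 \<le> x \<and> x < y \<and> y \<le> l \<longrightarrow> uc e y < uc e x) \<and>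
           (\<forall>x\<in>{0..l}. \<bar>uc e x\<bar> < \<epsilon>)) \<and>
       (\<forall>e\<in>G0_edges P Ps Ls. \<forall>x\<in>{0..l}. \<bar>uc e x - soliton p (l - x)\<bar> \<le> C' * \<epsilon>) \<and>
       (\<forall>h<H. \<forall>x y. 0 \<le> x \<and> x < y \<longrightarrow> uh h y < uh h x) \<and>
       \<bar>action H P L l p uh uc uh' uc' - real (P0 + 2 * L0) / 2 * soliton_action p\<bar> \<le> C' * \<epsilon>"
    proof (rule exI[of _ l0], intro allI impI)
      fix l assume l: "l0 \<le> l"
      hence l': "0 \<le> l" using l0 by simp
      from exl[rule_format, OF l] obtain a u v w w' where
        a: "0 < a" "soliton p a < \<epsilon>" and u: "solves_on p l u v" and w: "solves_on p l w w'"
        and bd: "u 0 = soliton p a" "w 0 = soliton p a" "v l = 0" "w' l = 0"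
        and kir: "h * soliton_deriv p a + n * w' 0 + k * v 0 = 0"
        and w'0: "- soliton p a \<le> w' 0" and v0: "0 \<le> v 0" "v 0 \<le> C * soliton p a"
        and wdec: "\<forall>x y. 0 \<le> x \<and> x < y \<and> y \<le> l \<longrightarrow> w y < w x"
        and wran: "\<forall>x. 0 \<le> x \<and> x \<le> l \<longrightarrow> 0 < w x \<and> w x \<le> soliton p a"
        and close: "\<forall>x\<in>{0..l}. \<bar>u x - soliton p (l - x)\<bar> \<le> 2 * \<epsilon>"
        and int: "\<bar>(LINT x:{0..l}|lborel. \<bar>u x\<bar> powr p) - (LINT x:{0..}|lborel. \<bar>soliton p x\<bar> powr p)\<bar> \<le> C * \<epsilon>"
        by (elim exE conjE) (rule that)
      define s where "s = soliton p a"
      have s: "0 < s" "s < \<epsilon>" using a soliton_pos[OF p, of a] by (auto simp: s_def)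
      \<comment> \<open>Quadratic contributions of the knot value become linear in
        \<open>\<epsilon>\<close>, as s < \<open>\<epsilon>\<close> < 1.\<close>
      have ss: "s * s \<le> \<epsilon> * 1" using s \<epsilon> by (intro mult_mono) auto
      let ?uc = "\<lambda>e. if e \<in> G then u else w" and ?uc' = "\<lambda>e. if e \<in> G then v else w'"
      let ?uh = "\<lambda>(_::nat) x. soliton p (x + a)" and ?uh' = "\<lambda>(_::nat) x. soliton_deriv p (x + a)"
      have bs: "bound_state H P L l p ?uh ?uc ?uh' ?uc'"
        unfolding G_def
        by (rule knot_bound_state[OF p assms(2,6,8) l' _ u bd(1,3) w bd(2,4)])
          (use a kir in \<open>simp_all add: h_def n_def k_def G_def\<close>)
      have close': "\<bar>u x - soliton p (l - x)\<bar> \<le> C' * \<epsilon>" if "x \<in> {0..l}" for x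
      proof -
        have "2 * \<epsilon> \<le> C' * \<epsilon>" using C' \<epsilon> by (intro mult_right_mono) auto
        thus ?thesis using close that by force
      qed
      define Ih Qh Iw Qw Iu Qu Q where
        "Ih = (LINT x:{0..}|lborel. (soliton_deriv p (x + a))\<^sup>2 + (soliton p (x + a))\<^sup>2)"
        and "Qh = (LINT x:{0..}|lborel. \<bar>soliton p (x + a)\<bar> powr p)"
        and "Iw = (LINT x:{0..l}|lborel. (w' x)\<^sup>2 + (w x)\<^sup>2)"
        and "Qw = (LINT x:{0..l}|lborel. \<bar>w x\<bar> powr p)"
        and "Iu = (LINT x:{0..l}|lborel. (v x)\<^sup>2 + (u x)\<^sup>2)"
        and "Qu = (LINT x:{0..l}|lborel. \<bar>u x\<bar> powr p)"
        and "Q = (LINT x:{0..}|lborel. \<bar>soliton p x\<bar> powr p)"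
      have Th: "\<bar>1/2 * Ih - 1/p * Qh\<bar> \<le> s * s"
        unfolding Ih_def Qh_def
        by (rule small_action_bound[OF p])
          (use soliton_shift_small[OF p, of a] a \<epsilon> in \<open>simp_all add: s_def power2_eq_square\<close>)
      have "0 \<le> w x \<and> w x \<le> small_bound p" if "0 \<le> x" "x \<le> l" for x
        using wran that a \<epsilon> by force
      note W = solves_on_small[OF p l' w this]
      have "- w' 0 * w 0 \<le> s * s" using w'0 s bd by (intro mult_mono) (auto simp: s_def)
      hence Tw: "\<bar>1/2 * Iw - 1/p * Qw\<bar> \<le> s * s"
        unfolding Iw_def Qw_def using W bd(4)
        by (intro small_action_bound[OF p]) auto
      have Iu: "Iu = Qu - v 0 * s"
        unfolding Iu_def Qu_def using solves_on_identity[OF p l' u] bd by (simp add: s_def)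
      have "v 0 * s \<le> (C * s) * s" using v0 s by (intro mult_right_mono) (auto simp: s_def)
      also have "\<dots> \<le> C * \<epsilon>" using mult_left_mono[OF ss, of C] C by simp
      finally have vs: "v 0 * s \<le> C * \<epsilon>" "0 \<le> v 0 * s" using v0 s by auto
      have Tu: "\<bar>(1/2 * Iu - 1/p * Qu) - (1/2 - 1/p) * Q\<bar> \<le> 2 * C * \<epsilon>"
      proof -
        \<comment> \<open>Self-testing replaces Iu by Qu - v 0 s; what remains is the difference of
          the p-th power integrals and a boundary term at the knot.\<close>
        have "(1/2 * Iu - 1/p * Qu) - (1/2 - 1/p) * Q = (1/2 - 1/p) * (Qu - Q) - v 0 * s / 2"
          unfolding Iu by (simp add: algebra_simps diff_divide_distrib)
        also have "\<bar>\<dots>\<bar> \<le> \<bar>(1/2 - 1/p) * (Qu - Q)\<bar> + \<bar>v 0 * s / 2\<bar>" by (rule abs_triangle_ineq4)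
        also have "\<bar>(1/2 - 1/p) * (Qu - Q)\<bar> \<le> 1 * (C * \<epsilon>)"
          unfolding abs_mult
        proof (rule mult_mono)
          have "1/p \<le> 1/2" "0 < 1/p" using p by (auto simp: field_simps)
          thus "\<bar>1/2 - 1/p\<bar> \<le> 1" by linarith
        qed (use int in \<open>auto simp: Qu_def Q_def\<close>)
        also have "\<bar>v 0 * s / 2\<bar> \<le> C * \<epsilon>" using vs by simp
        finally show ?thesis by simp
      qed
      \<comment> \<open>The action of the soliton is twice its half-line share (1/2 - 1/p) Q, so E_0
        / 2 solitons are k half solitons.\<close>
      have sa: "real (P0 + 2 * L0) / 2 * soliton_action p = k * ((1/2 - 1/p) * Q)"
        by (simp add: soliton_action_eq[OF p] k_def card Q_def)
      have "action H P L l p ?uh ?uc ?uh' ?uc' - real (P0 + 2 * L0) / 2 * soliton_action p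
        = h * (1/2 * Ih - 1/p * Qh) + n * (1/2 * Iw - 1/p * Qw)
          + k * ((1/2 * Iu - 1/p * Qu) - (1/2 - 1/p) * Q)"
        unfolding action_split[OF G] sa
          Ih_def[symmetric] Qh_def[symmetric] Iw_def[symmetric] Qw_def[symmetric] Iu_def[symmetric] Qu_def[symmetric]
          h_def[symmetric] n_def[symmetric] k_def[symmetric]
        by (simp only: right_diff_distrib[of "real (card G)" _ "(1/2 - 1/p) * Q"] add_diff_eq n_def k_def)
      also have "\<bar>\<dots>\<bar> \<le> h * (s * s) + n * (s * s) + k * (2 * C * \<epsilon>)"
      proof -
        have "\<bar>h * (1/2 * Ih - 1/p * Qh)\<bar> \<le> h * (s * s)"
          unfolding abs_mult using h Th by (simp only: abs_of_nonneg mult_left_mono)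
        moreover have "\<bar>n * (1/2 * Iw - 1/p * Qw)\<bar> \<le> n * (s * s)"
          unfolding abs_mult using n Tw by (simp only: abs_of_nonneg mult_left_mono)
        moreover have "\<bar>k * ((1/2 * Iu - 1/p * Qu) - (1/2 - 1/p) * Q)\<bar> \<le> k * (2 * C * \<epsilon>)"
          unfolding abs_mult using k Tu by (simp only: abs_of_nonneg mult_left_mono)
        ultimately show ?thesis by linarith
      qed
      also have "\<dots> \<le> h * \<epsilon> + n * \<epsilon> + k * (2 * C * \<epsilon>)"
        using ss h n k C \<epsilon> by (intro add_mono mult_left_mono) auto
      also have "\<dots> \<le> C' * \<epsilon>" using \<epsilon> by (simp add: C'_def algebra_simps)
      finally have act: "\<bar>action H P L l p ?uh ?uc ?uh' ?uc' - real (P0 + 2 * L0) / 2 * soliton_action p\<bar> \<le> C' * \<epsilon>" .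
      have half: "soliton p (y + a) < soliton p (x + a)" if "0 \<le> x" "x < y" for x y
        using soliton_decreasing[OF p, of "x + a" "y + a"] that a by simp
      have wsmall: "\<bar>w x\<bar> < \<epsilon>" if "x \<in> {0..l}" for x using wran that a by force
      show "\<exists>uh uc uh' uc'.
       bound_state H P L l p uh uc uh' uc' \<and>
       0 < uh 0 0 \<and> uh 0 0 < \<epsilon> \<and>
       (\<forall>e\<in>G0_edges P Ps Ls. \<forall>e'\<in>G0_edges P Ps Ls. \<forall>x\<in>{0..l}. uc e x = uc e' x) \<and>
       (\<forall>e<P + 2 * L. \<forall>e'<P + 2 * L. e \<notin> G0_edges P Ps Ls \<longrightarrow> e' \<notin> G0_edges P Ps Ls \<longrightarrow>
           (\<forall>x\<in>{0..l}. uc e x = uc e' x)) \<and>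
       (\<forall>e<P + 2 * L. e \<notin> G0_edges P Ps Ls \<longrightarrow>
           (\<forall>x y. 0 \<le> x \<and> x < y \<and> y \<le> l \<longrightarrow> uc e y < uc e x) \<and>
           (\<forall>x\<in>{0..l}. \<bar>uc e x\<bar> < \<epsilon>)) \<and>
       (\<forall>e\<in>G0_edges P Ps Ls. \<forall>x\<in>{0..l}. \<bar>uc e x - soliton p (l - x)\<bar> \<le> C' * \<epsilon>) \<and>
       (\<forall>h<H. \<forall>x y. 0 \<le> x \<and> x < y \<longrightarrow> uh h y < uh h x) \<and>
       \<bar>action H P L l p uh uc uh' uc' - real (P0 + 2 * L0) / 2 * soliton_action p\<bar> \<le> C' * \<epsilon>"
        unfolding G_def[symmetric]
        by (rule exI[of _ ?uh], rule exI[of _ ?uc], rule exI[of _ ?uh'], rule exI[of _ ?uc'], intro conjI bs act)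
          (use s wdec wsmall close' half in \<open>simp_all add: s_def\<close>)
    qed
  qed
qed

end
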